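(* There exist quantum channels $\Phi$ and $\Psi$ (between operator algebras on finite-dimensional Hilbert spaces), each admitting a dominating transmittable algebra, for which the tensor product channel $\Phi\otimes\Psi$ has no dominating transmittable algebra.
   Context: All Hilbert spaces are finite-dimensional and complex; all $C^*$-algebras are finite-dimensional and nonzero. $\mathcal{L}(\mathcal{H})$ is the algebra of linear operators on $\mathcal{H}$. A quantum channel is a linear, completely positive, trace-preserving map $\Phi:\mathcal{L}(\mathcal{H})\to\mathcal{L}(\mathcal{K})$; its adjoint $\Phi^*$ is defined by $\mathrm{Tr}(Y\Phi(X))=\mathrm{Tr}(\Phi^*(Y)X)$. Embedding: $\mathscr{A}\leq\mathscr{B}$ means there is an injective (not necessarily unital) $*$-homomorphism $\mathscr{A}\to\mathscr{B}$. Correctability: a $*$-subalgebra $\mathscr{A}\subseteq\mathcal{L}(\mathcal{H})$ with unit projection $P$ (possibly $P\neq 1_{\mathcal{H}}$) is correctable for $\Phi$ if, with $C=P\mathcal{H}$, $V:C\to\mathcal{H}$ the inclusion and $\Phi|_C(Y)=\Phi(VYV^* )$, there is a channel $\mathcal{D}:\mathcal{L}(\mathcal{K})\to\mathcal{L}(C)$ with $(\mathcal{D}\circ\Phi|_C)^*(X)=X$ for all $X\in V^*\mathscr{A}V$. $\mathscr{A}$ is transmittable via $\Phi$ if there is an injective $*$-homomorphism $\pi:\mathscr{A}\to\mathcal{L}(\mathcal{H})$ whose image is correctable for $\Phi$; $\mathscr{T}(\Phi)$ is the set of transmittable algebras up to $*$-isomorphism. A dominating transmittable algebra for $\Phi$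 is an element of $\mathscr{T}(\Phi)$ into which every element of $\mathscr{T}(\Phi)$ embeds. *)

theory Defs
  imports "Jordan_Normal_Form.Schur_Decomposition" "Jordan_Normal_Form.VS_Connect"
begin

text \<open>
  A finite-dimensional complex Hilbert space is \<open>\<complex>\<^sup>n\<close>, and \<open>\<L>(\<complex>\<^sup>n)\<close> is \<open>carrier_mat n n\<close>. The tensor
  product of \<open>\<complex>\<^sup>n\<close> and \<open>\<complex>\<^sup>k\<close> is the space of dimension \<open>n * k\<close>, where the basis vector \<open>e\<^sub>i \<otimes> e\<^sub>j\<close> has index \<open>i * k + j\<close>.
  Maps \<open>\<L>(\<complex>\<^sup>n) \<rightarrow> \<L>(\<complex>\<^sup>m)\<close> are functions on matrices whose values outside \<open>carrier_mat n n\<close>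
  are irrelevant; the dimensions \<open>n\<close> and \<open>m\<close> are passed explicitly.
\<close>

section \<open>Operators and linear maps between operator algebras\<close>

definition mat_trace :: "complex mat \<Rightarrow> complex" where
  "mat_trace A = (\<Sum>i<dim_row A. A $$ (i, i))"

definition mat_unit :: "nat \<Rightarrow> nat \<Rightarrow> nat \<Rightarrow> complex mat" where
  "mat_unit n i j = mat n n (\<lambda>(a, b). if a = i \<and> b = j then 1 else 0)"

definition kron :: "complex mat \<Rightarrow> complex mat \<Rightarrow> complex mat" where
  "kron A B = mat (dim_row A * dim_row B) (dim_col A * dim_col B)
     (\<lambda>(i, j). A $$ (i div dim_row B, j div dim_col B) * B $$ (i mod dim_row B, j mod dim_col B))"

definition psd :: "nat \<Rightarrow> complex mat \<Rightarrow> bool" where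
  "psd n A \<longleftrightarrow> A \<in> carrier_mat n n \<and> (\<forall>v\<in>carrier_vec n. (A *\<^sub>v v) \<bullet>c v \<ge> 0)"

definition linear_op_map :: "nat \<Rightarrow> nat \<Rightarrow> (complex mat \<Rightarrow> complex mat) \<Rightarrow> bool" where
  "linear_op_map n m \<Phi> \<longleftrightarrow>
     (\<forall>X\<in>carrier_mat n n. \<Phi> X \<in> carrier_mat m m) \<and>
     (\<forall>X\<in>carrier_mat n n. \<forall>Y\<in>carrier_mat n n. \<Phi> (X + Y) = \<Phi> X + \<Phi> Y) \<and>
     (\<forall>c. \<forall>X\<in>carrier_mat n n. \<Phi> (c \<cdot>\<^sub>m X) = c \<cdot>\<^sub>m \<Phi> X)"

lemma linear_op_map_expand:
  assumes L: "linear_op_map n m \<Phi>" and X: "X \<in> carrier_mat n n" and p: "p < m" and q: "q < m"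
  shows "\<Phi> X $$ (p, q) = (\<Sum>i<n. \<Sum>j<n. X $$ (i, j) * \<Phi> (mat_unit n i j) $$ (p, q))"
proof -
  have cl: "\<Phi> Y \<in> carrier_mat m m" if "Y \<in> carrier_mat n n" for Y
    using L that by (auto simp: linear_op_map_def)
  have U: "mat_unit n i j \<in> carrier_mat n n" for i j by (simp add: mat_unit_def)
  define R where "R S = mat n n (\<lambda>ij. if ij \<in> S then X $$ ij else 0)" for S
  have R: "R ({..<n} \<times> {..<n}) = X"
    using X by (intro eq_matI) (auto simp: R_def)
  have Rc: "R S \<in> carrier_mat n n" for S by (simp add: R_def)
  have "\<Phi> (R S) $$ (p, q) = (\<Sum>(i, j)\<in>S. X $$ (i, j) * \<Phi> (mat_unit n i j) $$ (p, q))"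
    if "finite S" "S \<subseteq> {..<n} \<times> {..<n}" for S
    using that
  proof (induction S rule: finite_induct)
    case empty
    have "R {} = 0 \<cdot>\<^sub>m R {}" by (rule eq_matI) (auto simp: R_def)
    then have "\<Phi> (R {}) = 0 \<cdot>\<^sub>m \<Phi> (R {})"
      using L Rc[of "{}"] unfolding linear_op_map_def by metis
    then have "\<Phi> (R {}) $$ (p, q) = (0 \<cdot>\<^sub>m \<Phi> (R {})) $$ (p, q)" by simp
    also have "\<dots> = 0" using cl[OF Rc[of "{}"]] p q by simp
    finally show ?case by simp
  next
    case (insert s S)
    obtain i j where s: "s = (i, j)" by force
    have "R (insert s S) = X $$ (i, j) \<cdot>\<^sub>m mat_unit n i j + R S"
      using insert by (intro eq_matI) (auto simp: R_def mat_unit_def s)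
    then have "\<Phi> (R (insert s S)) = X $$ (i, j) \<cdot>\<^sub>m \<Phi> (mat_unit n i j) + \<Phi> (R S)"
      using L Rc[of S] U[of i j] by (auto simp: linear_op_map_def)
    then show ?case
      using insert cl[OF Rc[of S]] cl[OF U[of i j]] p q by (auto simp: s)
  qed
  from this[of "{..<n} \<times> {..<n}"] show ?thesis
    by (simp add: R sum.cartesian_product)
qed

text \<open>
  For \<open>\<Phi> : \<L>(\<complex>\<^sup>n) \<rightarrow> \<L>(\<complex>\<^sup>m)\<close> and \<open>\<Psi> : \<L>(\<complex>\<^sup>n\<^sup>') \<rightarrow> \<L>(\<complex>\<^sup>m\<^sup>')\<close>, the linear map \<open>\<Phi> \<otimes> \<Psi>\<close>, obtained
  by expanding the argument in the basis \<open>E\<^sub>i\<^sub>j \<otimes> E\<^sub>k\<^sub>l\<close> (see \<open>tensor_map_kron\<close> below).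
\<close>

definition tensor_map ::
  "nat \<Rightarrow> nat \<Rightarrow> nat \<Rightarrow> nat \<Rightarrow> (complex mat \<Rightarrow> complex mat) \<Rightarrow> (complex mat \<Rightarrow> complex mat)
     \<Rightarrow> complex mat \<Rightarrow> complex mat" where
  "tensor_map n m n' m' \<Phi> \<Psi> Z = mat (m * m') (m * m') (\<lambda>pq.
     \<Sum>i<n. \<Sum>j<n. \<Sum>k<n'. \<Sum>l<n'.
       Z $$ (i * n' + k, j * n' + l) * kron (\<Phi> (mat_unit n i j)) (\<Psi> (mat_unit n' k l)) $$ pq)"

lemma tensor_map_kron:
  assumes L: "linear_op_map n m \<Phi>" "linear_op_map n' m' \<Psi>"
    and X: "X \<in> carrier_mat n n" and Y: "Y \<in> carrier_mat n' n'"
  shows "tensor_map n m n' m' \<Phi> \<Psi> (kron X Y) = kron (\<Phi> X) (\<Psi> Y)"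
proof -
  have cl: "\<Phi> Z \<in> carrier_mat m m" if "Z \<in> carrier_mat n n" for Z
    using L that by (auto simp: linear_op_map_def)
  have cl': "\<Psi> Z \<in> carrier_mat m' m'" if "Z \<in> carrier_mat n' n'" for Z
    using L that by (auto simp: linear_op_map_def)
  have U: "mat_unit n i j \<in> carrier_mat n n" for n i j by (simp add: mat_unit_def)
  have lt: "i * n' + k < n * n'" if "i < n" "k < n'" for i k
  proof -
    have "i * n' + k < Suc i * n'" using that by simp
    also have "\<dots> \<le> n * n'" using that by (intro mult_right_mono) auto
    finally show ?thesis .
  qed
  have K: "kron X Y $$ (i * n' + k, j * n' + l) = X $$ (i, j) * Y $$ (k, l)"
    if "i < n" "j < n" "k < n'" "l < n'" for i j k l
    using X Y that lt by (auto simp: kron_def)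
  have F: "kron (\<Phi> A) (\<Psi> B) $$ (p, q) = \<Phi> A $$ (p div m', q div m') * \<Psi> B $$ (p mod m', q mod m')"
    if "A \<in> carrier_mat n n" "B \<in> carrier_mat n' n'" "p < m * m'" "q < m * m'" for A B p q
    using cl[OF that(1)] cl'[OF that(2)] that by (auto simp: kron_def)
  show ?thesis
  proof (rule eq_matI)
    fix p q assume "p < dim_row (kron (\<Phi> X) (\<Psi> Y))" "q < dim_col (kron (\<Phi> X) (\<Psi> Y))"
    then have pq: "p < m * m'" "q < m * m'" using cl[OF X] cl'[OF Y] by (auto simp: kron_def)
    have "0 < m'" using pq by (cases m') auto
    then have b: "p div m' < m" "q div m' < m" "p mod m' < m'" "q mod m' < m'"
      using pq by (auto simp: less_mult_imp_div_less)
    have "tensor_map n m n' m' \<Phi> \<Psi> (kron X Y) $$ (p, q) =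
      (\<Sum>i<n. \<Sum>j<n. \<Sum>k<n'. \<Sum>l<n'. (X $$ (i, j) * \<Phi> (mat_unit n i j) $$ (p div m', q div m')) *
         (Y $$ (k, l) * \<Psi> (mat_unit n' k l) $$ (p mod m', q mod m')))"
      using pq by (auto simp: tensor_map_def K F U intro!: sum.cong)
    also have "\<dots> = \<Phi> X $$ (p div m', q div m') * \<Psi> Y $$ (p mod m', q mod m')"
      unfolding linear_op_map_expand[OF L(1) X b(1,2)] linear_op_map_expand[OF L(2) Y b(3,4)]
      by (simp only: sum_distrib_right, simp only: sum_distrib_left)
    finally show "tensor_map n m n' m' \<Phi> \<Psi> (kron X Y) $$ (p, q) = kron (\<Phi> X) (\<Psi> Y) $$ (p, q)"
      using F[OF X Y pq] by simp
  qed (use cl[OF X] cl'[OF Y] in \<open>auto simp: tensor_map_def kron_def\<close>)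
qed

definition completely_positive :: "nat \<Rightarrow> nat \<Rightarrow> (complex mat \<Rightarrow> complex mat) \<Rightarrow> bool" where
  "completely_positive n m \<Phi> \<longleftrightarrow>
     (\<forall>k X. psd (k * n) X \<longrightarrow> psd (k * m) (tensor_map k k n m (\<lambda>Y. Y) \<Phi> X))"

definition quantum_channel :: "nat \<Rightarrow> nat \<Rightarrow> (complex mat \<Rightarrow> complex mat) \<Rightarrow> bool" where
  "quantum_channel n m \<Phi> \<longleftrightarrow>
     linear_op_map n m \<Phi> \<and> completely_positive n m \<Phi> \<and>
     (\<forall>X\<in>carrier_mat n n. mat_trace (\<Phi> X) = mat_trace X)"

definition adjoint_map ::
  "nat \<Rightarrow> (complex mat \<Rightarrow> complex mat) \<Rightarrow> complex mat \<Rightarrow> complex mat" where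
  "adjoint_map n \<Phi> Y = (THE Z. Z \<in> carrier_mat n n \<and>
     (\<forall>X\<in>carrier_mat n n. mat_trace (Y * \<Phi> X) = mat_trace (Z * X)))"

lemma sum_swap3:
  "(\<Sum>a\<in>A. \<Sum>b\<in>B. \<Sum>c\<in>C. f a b c) = (\<Sum>b\<in>B. \<Sum>c\<in>C. \<Sum>a\<in>A. f a b c)"
  by (rule trans[OF sum.swap]) (intro sum.cong refl sum.swap)

lemma mat_trace_mult:
  assumes "A \<in> carrier_mat n m" "B \<in> carrier_mat m n"
  shows "mat_trace (A * B) = (\<Sum>i<n. \<Sum>j<m. A $$ (i, j) * B $$ (j, i))"
  using assms by (auto simp: mat_trace_def scalar_prod_def atLeast0LessThan intro!: sum.cong)

lemma adjoint_map_eq: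
  assumes L: "linear_op_map n m \<Phi>" and Y: "Y \<in> carrier_mat m m"
  shows "adjoint_map n \<Phi> Y = mat n n (\<lambda>(i, j). mat_trace (Y * \<Phi> (mat_unit n j i)))" (is "_ = ?Z")
  unfolding adjoint_map_def
proof (rule the_equality)
  have cl: "\<Phi> X \<in> carrier_mat m m" if "X \<in> carrier_mat n n" for X
    using L that by (auto simp: linear_op_map_def)
  have U: "mat_unit n i j \<in> carrier_mat n n" for i j by (simp add: mat_unit_def)
  have "mat_trace (Y * \<Phi> X) = mat_trace (?Z * X)" if X: "X \<in> carrier_mat n n" for X
  proof -
    have "mat_trace (Y * \<Phi> X) = (\<Sum>p<m. \<Sum>q<m. Y $$ (p, q) *
        (\<Sum>j<n. \<Sum>i<n. X $$ (j, i) * \<Phi> (mat_unit n j i) $$ (q, p)))"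
      by (subst mat_trace_mult[OF Y cl[OF X]])
        (auto simp: linear_op_map_expand[OF L X] intro!: sum.cong)
    also have "\<dots> = (\<Sum>p<m. \<Sum>q<m. \<Sum>j<n. \<Sum>i<n.
        X $$ (j, i) * (Y $$ (p, q) * \<Phi> (mat_unit n j i) $$ (q, p)))"
      by (simp add: sum_distrib_left mult_ac)
    also have "\<dots> = (\<Sum>p<m. \<Sum>j<n. \<Sum>i<n. \<Sum>q<m.
        X $$ (j, i) * (Y $$ (p, q) * \<Phi> (mat_unit n j i) $$ (q, p)))"
      by (intro sum.cong refl sum_swap3)
    also have "\<dots> = (\<Sum>j<n. \<Sum>i<n. \<Sum>p<m. \<Sum>q<m.
        X $$ (j, i) * (Y $$ (p, q) * \<Phi> (mat_unit n j i) $$ (q, p)))"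
      by (rule sum_swap3)
    also have "\<dots> = (\<Sum>i<n. \<Sum>j<n. \<Sum>p<m. \<Sum>q<m.
        X $$ (j, i) * (Y $$ (p, q) * \<Phi> (mat_unit n j i) $$ (q, p)))"
      by (rule sum.swap)
    also have "\<dots> = (\<Sum>i<n. \<Sum>j<n. mat_trace (Y * \<Phi> (mat_unit n j i)) * X $$ (j, i))"
      by (simp add: mat_trace_mult[OF Y cl[OF U]] sum_distrib_left sum_distrib_right mult_ac)
    also have "\<dots> = mat_trace (?Z * X)"
      by (subst mat_trace_mult[of ?Z n n X]) (use X in auto)
    finally show ?thesis .
  qed
  then show "?Z \<in> carrier_mat n n \<and>
      (\<forall>X\<in>carrier_mat n n. mat_trace (Y * \<Phi> X) = mat_trace (?Z * X))" by simp
  fix Z assume Z: "Z \<in> carrier_mat n n \<and>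
      (\<forall>X\<in>carrier_mat n n. mat_trace (Y * \<Phi> X) = mat_trace (Z * X))"
  have tr: "mat_trace (Z * mat_unit n j i) = Z $$ (i, j)" if "i < n" "j < n" for i j
  proof -
    have "mat_trace (Z * mat_unit n j i)
        = (\<Sum>a<n. \<Sum>b<n. if a = i then if b = j then Z $$ (a, b) else 0 else 0)"
      by (subst mat_trace_mult[of _ n n]) (use Z U in \<open>auto simp: mat_unit_def intro!: sum.cong\<close>)
    also have "\<dots> = (\<Sum>a<n. if a = i then (\<Sum>b<n. if b = j then Z $$ (a, b) else 0) else 0)"
      by (intro sum.cong) auto
    also have "\<dots> = Z $$ (i, j)" using that by simp
    finally show ?thesis .
  qed
  show "Z = ?Z"
    using Z U by (intro eq_matI) (auto simp: tr)
qed

section \<open>Finite-dimensional \<open>C\<^sup>*\<close>-algebras\<close>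

record 'a star_algebra = "(complex, 'a) module" +
  adj :: "'a \<Rightarrow> 'a"

text \<open>
  The norm of a \<open>C\<^sup>*\<close>-algebra is determined by the \<open>*\<close>-algebra structure, so it is not part of the
  record. Completeness is automatic in finite dimension, and so is the unit required by \<open>ring\<close>.
\<close>

definition cstar_norm :: "'a star_algebra \<Rightarrow> ('a \<Rightarrow> real) \<Rightarrow> bool" where
  "cstar_norm A N \<longleftrightarrow>
     (\<forall>x\<in>carrier A. N x \<ge> 0 \<and> (N x = 0 \<longleftrightarrow> x = \<zero>\<^bsub>A\<^esub>)) \<and>
     (\<forall>c. \<forall>x\<in>carrier A. N (c \<odot>\<^bsub>A\<^esub> x) = cmod c * N x) \<and>
     (\<forall>x\<in>carrier A. \<forall>y\<in>carrier A. N (x \<oplus>\<^bsub>A\<^esub> y) \<le> N x + N y) \<and>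
     (\<forall>x\<in>carrier A. \<forall>y\<in>carrier A. N (x \<otimes>\<^bsub>A\<^esub> y) \<le> N x * N y) \<and>
     (\<forall>x\<in>carrier A. N (adj A x \<otimes>\<^bsub>A\<^esub> x) = (N x)\<^sup>2)"

definition fd_cstar_algebra :: "'a star_algebra \<Rightarrow> bool" where
  "fd_cstar_algebra A \<longleftrightarrow>
     ring A \<and> vectorspace class_ring A \<and> vectorspace.fin_dim class_ring A \<and>
     carrier A \<noteq> {\<zero>\<^bsub>A\<^esub>} \<and>
     (\<forall>c. \<forall>x\<in>carrier A. \<forall>y\<in>carrier A.
        (c \<odot>\<^bsub>A\<^esub> x) \<otimes>\<^bsub>A\<^esub> y = c \<odot>\<^bsub>A\<^esub> (x \<otimes>\<^bsub>A\<^esub> y) \<and> x \<otimes>\<^bsub>A\<^esub> (c \<odot>\<^bsub>A\<^esub> y) = c \<odot>\<^bsub>A\<^esub> (x \<otimes>\<^bsub>A\<^esub> y)) \<and>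
     (\<forall>x\<in>carrier A. adj A x \<in> carrier A \<and> adj A (adj A x) = x) \<and>
     (\<forall>x\<in>carrier A. \<forall>y\<in>carrier A.
        adj A (x \<oplus>\<^bsub>A\<^esub> y) = adj A x \<oplus>\<^bsub>A\<^esub> adj A y \<and>
        adj A (x \<otimes>\<^bsub>A\<^esub> y) = adj A y \<otimes>\<^bsub>A\<^esub> adj A x) \<and>
     (\<forall>c. \<forall>x\<in>carrier A. adj A (c \<odot>\<^bsub>A\<^esub> x) = cnj c \<odot>\<^bsub>A\<^esub> adj A x) \<and>
     (\<exists>N. cstar_norm A N)"

text \<open>Homomorphisms are not required to preserve the unit.\<close>

definition star_hom :: "'a star_algebra \<Rightarrow> 'b star_algebra \<Rightarrow> ('a \<Rightarrow> 'b) set" where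
  "star_hom A B = {f \<in> carrier A \<rightarrow> carrier B.
     (\<forall>x\<in>carrier A. \<forall>y\<in>carrier A.
        f (x \<oplus>\<^bsub>A\<^esub> y) = f x \<oplus>\<^bsub>B\<^esub> f y \<and> f (x \<otimes>\<^bsub>A\<^esub> y) = f x \<otimes>\<^bsub>B\<^esub> f y) \<and>
     (\<forall>c. \<forall>x\<in>carrier A. f (c \<odot>\<^bsub>A\<^esub> x) = c \<odot>\<^bsub>B\<^esub> f x) \<and>
     (\<forall>x\<in>carrier A. f (adj A x) = adj B (f x))}"

definition embeds :: "'a star_algebra \<Rightarrow> 'b star_algebra \<Rightarrow> bool" where
  "embeds A B \<longleftrightarrow> (\<exists>f \<in> star_hom A B. inj_on f (carrier A))"

definition op_algebra :: "nat \<Rightarrow> complex mat star_algebra" where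
  "op_algebra n =
     \<lparr>carrier = carrier_mat n n, monoid.mult = (*), one = 1\<^sub>m n, zero = 0\<^sub>m n n, add = (+),
      module.smult = (\<cdot>\<^sub>m), adj = mat_adjoint\<rparr>"

definition star_subalgebra :: "nat \<Rightarrow> complex mat set \<Rightarrow> bool" where
  "star_subalgebra n S \<longleftrightarrow>
     S \<subseteq> carrier_mat n n \<and> 0\<^sub>m n n \<in> S \<and> S \<noteq> {0\<^sub>m n n} \<and>
     (\<forall>X\<in>S. \<forall>Y\<in>S. X + Y \<in> S \<and> X * Y \<in> S) \<and>
     (\<forall>c. \<forall>X\<in>S. c \<cdot>\<^sub>m X \<in> S) \<and> (\<forall>X\<in>S. mat_adjoint X \<in> S)"

section \<open>Correctable and transmittable algebras\<close>

text \<open>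
  The code space \<open>C = P \<complex>\<^sup>n\<close> is identified with \<open>\<complex>\<^sup>k\<close>, \<open>k = dim C\<close>, by choosing an orthonormal basis
  of \<open>C\<close>; the inclusion \<open>C \<rightarrow> \<complex>\<^sup>n\<close> becomes the \<open>n \<times> k\<close> isometry \<open>V\<close> whose columns are the basis
  vectors, so that \<open>V\<^sup>* V = 1\<close> and \<open>V V\<^sup>* = P\<close>. The choice of basis is immaterial, since it can be
  absorbed in the decoder \<open>D\<close>. The unit \<open>P\<close> of a \<open>*\<close>-subalgebra is unique and automatically a projection.
\<close>

definition correctable ::
  "nat \<Rightarrow> nat \<Rightarrow> (complex mat \<Rightarrow> complex mat) \<Rightarrow> complex mat set \<Rightarrow> bool" where
  "correctable n m \<Phi> S \<longleftrightarrow> star_subalgebra n S \<and>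
     (\<exists>P\<in>S. (\<forall>X\<in>S. P * X = X \<and> X * P = X) \<and>
       (\<exists>k. \<exists>V\<in>carrier_mat n k. mat_adjoint V * V = 1\<^sub>m k \<and> V * mat_adjoint V = P \<and>
         (\<exists>D. quantum_channel m k D \<and>
           (\<forall>X \<in> (\<lambda>X. mat_adjoint V * X * V) ` S.
              adjoint_map k (D \<circ> (\<lambda>Y. \<Phi> (V * Y * mat_adjoint V))) X = X))))"

text \<open>
  Transmittability only depends on the \<open>*\<close>-isomorphism class, and every finite-dimensional
  \<open>C\<^sup>*\<close>-algebra is \<open>*\<close>-isomorphic to one whose carrier consists of complex matrices. So no
  isomorphism class is lost by fixing the type of elements to be \<open>complex mat\<close>.
\<close>

definition transmittable_algebras ::
  "nat \<Rightarrow> nat \<Rightarrow> (complex mat \<Rightarrow> complex mat) \<Rightarrow> complex mat star_algebra set" where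
  "transmittable_algebras n m \<Phi> = {A. fd_cstar_algebra A \<and>
     (\<exists>\<pi> \<in> star_hom A (op_algebra n).
        inj_on \<pi> (carrier A) \<and> correctable n m \<Phi> (\<pi> ` carrier A))}"

definition dominating_transmittable ::
  "nat \<Rightarrow> nat \<Rightarrow> (complex mat \<Rightarrow> complex mat) \<Rightarrow> complex mat star_algebra \<Rightarrow> bool" where
  "dominating_transmittable n m \<Phi> A \<longleftrightarrow>
     A \<in> transmittable_algebras n m \<Phi> \<and> (\<forall>B \<in> transmittable_algebras n m \<Phi>. embeds B A)"

end

theory Submission
  imports Defs "Jordan_Normal_Form.Spectral_Radius" "HOL-Analysis.L2_Norm"
begin

text \<open>
  Take for \<open>\<Psi>\<close> the identity on \<open>\<L>(\<complex>\<^sup>2)\<close>, dominated by \<open>M\<^sub>2\<close>, and for \<open>\<Phi>\<close> a rank-one measurement on \<open>\<complex>\<^sup>4\<close>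
  with vectors \<open>a\<^sub>l\<close> such that no two nonzero vectors \<open>\<phi>\<close>, \<open>\<psi>\<close> are distinguished by it: some \<open>a\<^sub>l\<close> is orthogonal
  to neither. Then only \<open>\<complex>\<close> is transmittable via \<open>\<Phi>\<close>. The channel \<open>\<Phi> \<otimes> \<Psi>\<close> transmits \<open>M\<^sub>2\<close>, and it transmits
  \<open>\<complex>\<^sup>3\<close> by an entanglement-assisted code: three vectors of \<open>\<complex>\<^sup>4 \<otimes> \<complex>\<^sup>2\<close> which every outcome leaves in pairwise
  orthogonal (possibly zero) states of \<open>\<complex>\<^sup>2\<close>. An algebra containing both \<open>M\<^sub>2\<close> and \<open>\<complex>\<^sup>3\<close> contains \<open>M\<^sub>2 \<oplus> \<complex>\<close>;
  correctability would give \<open>u\<^sub>1, u\<^sub>2, u\<^sub>3\<close> that every outcome leaves in pairwise orthogonal states of \<open>\<complex>\<^sup>2\<close>, the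
  first two of equal norm, so every outcome annihilates \<open>u\<^sub>1\<close> or \<open>u\<^sub>3\<close>, against the choice of the measurement.
\<close>

section \<open>Kraus maps\<close>

text \<open>Correctability is used only through a necessary condition: on the code space every
  single effect \<open>K_i^* K_i\<close> commutes with the algebra, that is,
  \<open><K_i X v, K_i w> = <K_i v, K_i X^* w>\<close>; no mixed products \<open>K_i^* K_j\<close>
  occur. This turns a relation such as \<open>B^* v = 0\<close> into orthogonality of the states
  that each outcome leaves. In the other direction decoders are explicit, and what has to be checked
  is that the products of decoder and channel Kraus operators lie in the commutant of the algebra.
  Three is the first size at which the diagonal algebra conflicts with \<open>M_2\<close>: two
  orthogonal idempotents still fit into \<open>M_2\<close>, three do not. The sum of
  \<open>M_2\<close> and \<open>C\<close> is never built. It suffices to have a vector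
  \<open>v = e_00 v\<close>, its partner \<open>e_10 v\<close>, and a nonzero element
  \<open>B\<close> whose adjoint kills both. Embeddings need not preserve units, so \<open>B\<close>
  must be found both when \<open>M_2\<close> has the unit of the large algebra and when it has a
  smaller one. Entangled inputs reduce to the property of the measurement on \<open>C^4\<close>
  alone by cutting vectors of \<open>C^4 \<otimes> C^2\<close> into slices.\<close>

lemma adjoint_carrier [simp, intro]: "A \<in> carrier_mat n m \<Longrightarrow> mat_adjoint A \<in> carrier_mat m n"
  by (auto simp: mat_adjoint_def)

lemma adjoint_index [simp]:
  "i < dim_col A \<Longrightarrow> j < dim_row A \<Longrightarrow> mat_adjoint (A :: complex mat) $$ (i, j) = cnj (A $$ (j, i))"
  by (auto simp: mat_adjoint_def mat_of_rows_def)

lemma adjoint_dims [simp]: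
  "dim_row (mat_adjoint A) = dim_col A" "dim_col (mat_adjoint A) = dim_row A"
  by (auto simp: mat_adjoint_def)

lemma adjoint_adjoint [simp]: "mat_adjoint (mat_adjoint A) = (A :: complex mat)"
  by (rule eq_matI) auto

lemma adjoint_mult:
  "A \<in> carrier_mat n m \<Longrightarrow> B \<in> carrier_mat m k \<Longrightarrow>
    mat_adjoint (A * B) = mat_adjoint B * mat_adjoint (A :: complex mat)"
  by (rule eq_matI) (auto simp: scalar_prod_def mult.commute intro!: sum.cong)

lemma adjoint_add:
  "A \<in> carrier_mat n m \<Longrightarrow> B \<in> carrier_mat n m \<Longrightarrow>
    mat_adjoint (A + B) = mat_adjoint A + mat_adjoint (B :: complex mat)"
  by (rule eq_matI) auto

lemma adjoint_smult: "mat_adjoint (c \<cdot>\<^sub>m A) = cnj c \<cdot>\<^sub>m mat_adjoint (A :: complex mat)"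
  by (rule eq_matI) auto

lemma adjoint_one [simp]: "mat_adjoint (1\<^sub>m n) = (1\<^sub>m n :: complex mat)"
  by (rule eq_matI) auto

lemma mult_vec_cscalar:
  fixes A :: "complex mat"
  assumes "A \<in> carrier_mat m n" "v \<in> carrier_vec n" "w \<in> carrier_vec m"
  shows "(A *\<^sub>v v) \<bullet>c w = (\<Sum>a<m. \<Sum>b<n. A $$ (a, b) * v $ b * cnj (w $ a))"
  using assms by (auto simp: scalar_prod_def atLeast0LessThan sum_distrib_right intro!: sum.cong)

lemma cscalar_adjoint:
  fixes A :: "complex mat"
  assumes "A \<in> carrier_mat m n" "v \<in> carrier_vec n" "w \<in> carrier_vec m"
  shows "(A *\<^sub>v v) \<bullet>c w = v \<bullet>c (mat_adjoint A *\<^sub>v w)"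
proof -
  have "v \<bullet>c (mat_adjoint A *\<^sub>v w) = (\<Sum>b<n. \<Sum>a<m. A $$ (a, b) * v $ b * cnj (w $ a))"
    using assms
    by (auto simp: scalar_prod_def atLeast0LessThan sum_distrib_left mult_ac intro!: sum.cong)
  then show ?thesis using assms by (simp add: mult_vec_cscalar) (rule sum.swap)
qed

lemma sum_eq_single:
  fixes f :: "nat \<Rightarrow> 'a :: comm_monoid_add"
  assumes "c < n" "\<And>a. a < n \<Longrightarrow> a \<noteq> c \<Longrightarrow> f a = 0"
  shows "(\<Sum>a<n. f a) = f c"
proof -
  have "(\<Sum>a<n. f a) = (\<Sum>a<n. if a = c then f a else 0)"
    by (rule sum.cong) (use assms in auto)
  then show ?thesis using assms(1) by (simp only: sum.delta finite_lessThan lessThan_iff if_True)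
qed

lemma sum2_eq_single:
  fixes f :: "nat \<Rightarrow> nat \<Rightarrow> 'a :: comm_monoid_add"
  assumes "c < n" "d < m" "\<And>a b. a < n \<Longrightarrow> b < m \<Longrightarrow> (a, b) \<noteq> (c, d) \<Longrightarrow> f a b = 0"
  shows "(\<Sum>a<n. \<Sum>b<m. f a b) = f c d"
  using assms by (subst sum_eq_single[of c]) (auto intro: sum.neutral sum_eq_single)

lemma sum_product_index:
  fixes f :: "nat \<Rightarrow> 'a :: comm_monoid_add"
  shows "(\<Sum>a<n * k. f a) = (\<Sum>i<n. \<Sum>j<k. f (i * k + j))"
proof -
  have "(\<Sum>j<k. f (i * k + j)) = sum f {i * k..<i * k + k}" for i
    using sum.shift_bounds_nat_ivl[of f 0 "i * k" k] by (simp add: atLeast0LessThan add.commute)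
  then show ?thesis by (simp add: sum.nat_group)
qed

lemma index_product_less: "i < n \<Longrightarrow> j < k \<Longrightarrow> i * k + j < n * (k :: nat)"
proof -
  assume "i < n" "j < k"
  then have "i * k + j < Suc i * k" by simp
  also have "\<dots> \<le> n * k" using \<open>i < n\<close> by (intro mult_right_mono) auto
  finally show ?thesis .
qed

text \<open>The map \<open>X \<mapsto> sum_i K_i X K_i^*\<close>, written entry by entry:
  manipulations become rearrangements of finite sums of complex numbers, and
  \<open>kraus_map_index\<close> restores the matrix form where it is wanted.\<close>

definition kraus_map :: "nat \<Rightarrow> nat \<Rightarrow> 'i set \<Rightarrow> ('i \<Rightarrow> complex mat) \<Rightarrow> complex mat \<Rightarrow> complex mat" where
  "kraus_map n m I K X = mat m m (\<lambda>(p, q).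
     \<Sum>i\<in>I. \<Sum>a<n. \<Sum>b<n. K i $$ (p, a) * X $$ (a, b) * cnj (K i $$ (q, b)))"

lemma kraus_map_carrier [simp]: "kraus_map n m I K X \<in> carrier_mat m m"
  by (simp add: kraus_map_def)

lemma linear_kraus_map: "linear_op_map n m (kraus_map n m I K)"
  unfolding linear_op_map_def
proof (intro conjI ballI allI)
  fix X Y :: "complex mat" assume "X \<in> carrier_mat n n" "Y \<in> carrier_mat n n"
  then show "kraus_map n m I K (X + Y) = kraus_map n m I K X + kraus_map n m I K Y"
    by (intro eq_matI) (auto simp: kraus_map_def algebra_simps sum.distrib)
next
  fix c and X :: "complex mat" assume "X \<in> carrier_mat n n"
  then show "kraus_map n m I K (c \<cdot>\<^sub>m X) = c \<cdot>\<^sub>m kraus_map n m I K X"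
    by (intro eq_matI) (auto simp: kraus_map_def sum_distrib_left mult_ac)
qed auto

lemma sum_Times: "(\<Sum>x\<in>A \<times> B. g x) = (\<Sum>a\<in>A. \<Sum>b\<in>B. g (a, b))"
  by (simp add: sum.cartesian_product)

lemma sum_swap_2_3:
  "(\<Sum>p\<in>P. \<Sum>q\<in>Q. \<Sum>i\<in>I. \<Sum>a\<in>A. \<Sum>b\<in>B. f p q i a b) =
   (\<Sum>i\<in>I. \<Sum>a\<in>A. \<Sum>b\<in>B. \<Sum>p\<in>P. \<Sum>q\<in>Q. f p q i a b)"
proof -
  have "(\<Sum>p\<in>P. \<Sum>q\<in>Q. \<Sum>i\<in>I. \<Sum>a\<in>A. \<Sum>b\<in>B. f p q i a b) =
    (\<Sum>x\<in>P \<times> Q. \<Sum>y\<in>I \<times> A \<times> B. f (fst x) (snd x) (fst y) (fst (snd y)) (snd (snd y)))"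
    by (simp add: sum_Times)
  also have "\<dots> = (\<Sum>y\<in>I \<times> A \<times> B. \<Sum>x\<in>P \<times> Q.
      f (fst x) (snd x) (fst y) (fst (snd y)) (snd (snd y)))"
    by (rule sum.swap)
  also have "\<dots> = (\<Sum>i\<in>I. \<Sum>a\<in>A. \<Sum>b\<in>B. \<Sum>p\<in>P. \<Sum>q\<in>Q. f p q i a b)"
    by (simp add: sum_Times)
  finally show ?thesis .
qed

text \<open>The quadratic form of the image at \<open>v\<close> is the sum over \<open>i\<close> of
  the quadratic forms of \<open>X\<close> at \<open>K_i^* v\<close>, the vectors called
  \<open>w i\<close> below.\<close>

lemma psd_kraus_map:
  assumes "psd n X"
  shows "psd m (kraus_map n m I K X)"
  unfolding psd_def
proof (intro conjI ballI)
  have X: "X \<in> carrier_mat n n" using assms by (simp add: psd_def)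
  fix v :: "complex vec" assume v: "v \<in> carrier_vec m"
  define w where "w i = vec n (\<lambda>a. \<Sum>p<m. cnj (K i $$ (p, a)) * v $ p)" for i
  have "(kraus_map n m I K X *\<^sub>v v) \<bullet>c v = (\<Sum>p<m. \<Sum>q<m. \<Sum>i\<in>I. \<Sum>a<n. \<Sum>b<n.
      K i $$ (p, a) * X $$ (a, b) * cnj (K i $$ (q, b)) * v $ q * cnj (v $ p))"
    by (subst mult_vec_cscalar[OF kraus_map_carrier v v])
      (simp add: kraus_map_def sum_distrib_right)
  also have "\<dots> = (\<Sum>i\<in>I. \<Sum>a<n. \<Sum>b<n. \<Sum>p<m. \<Sum>q<m.
      K i $$ (p, a) * X $$ (a, b) * cnj (K i $$ (q, b)) * v $ q * cnj (v $ p))"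
    by (rule sum_swap_2_3)
  also have "\<dots> = (\<Sum>i\<in>I. (X *\<^sub>v w i) \<bullet>c w i)"
    by (subst mult_vec_cscalar[OF X])
      (auto simp: w_def sum_distrib_left sum_distrib_right mult_ac intro!: sum.cong sum.swap)
  also have "\<dots> \<ge> 0"
    using assms by (intro sum_nonneg) (auto simp: psd_def w_def)
  finally show "(kraus_map n m I K X *\<^sub>v v) \<bullet>c v \<ge> 0" .
qed simp

lemma kraus_map_unit:
  assumes "p < m" "q < m" "c < n" "d < n"
  shows "kraus_map n m I K (mat_unit n c d) $$ (p, q) = (\<Sum>i\<in>I. K i $$ (p, c) * cnj (K i $$ (q, d)))"
proof -
  have "(\<Sum>a<n. \<Sum>b<n. K i $$ (p, a) * mat_unit n c d $$ (a, b) * cnj (K i $$ (q, b))) =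
      K i $$ (p, c) * cnj (K i $$ (q, d))" for i
    by (subst sum2_eq_single[OF assms(3,4)]) (use assms in \<open>auto simp: mat_unit_def\<close>)
  then show ?thesis using assms by (simp add: kraus_map_def)
qed

lemma sum_swap_4_4:
  "(\<Sum>i\<in>I. \<Sum>j\<in>J. \<Sum>k\<in>K. \<Sum>l\<in>L. \<Sum>r\<in>R. \<Sum>s\<in>S. f i j k l r s) =
   (\<Sum>r\<in>R. \<Sum>s\<in>S. \<Sum>i\<in>I. \<Sum>k\<in>K. \<Sum>j\<in>J. \<Sum>l\<in>L. f i j k l r s)"
proof -
  have "(\<Sum>i\<in>I. \<Sum>j\<in>J. \<Sum>k\<in>K. \<Sum>l\<in>L. \<Sum>r\<in>R. \<Sum>s\<in>S. f i j k l r s) =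
     (\<Sum>i\<in>I. \<Sum>k\<in>K. \<Sum>j\<in>J. \<Sum>l\<in>L. \<Sum>r\<in>R. \<Sum>s\<in>S. f i j k l r s)"
    by (intro sum.cong refl sum.swap)
  also have "\<dots> = (\<Sum>x\<in>I \<times> K \<times> J \<times> L. \<Sum>y\<in>R \<times> S.
      f (fst x) (fst (snd (snd x))) (fst (snd x)) (snd (snd (snd x))) (fst y) (snd y))"
    by (simp add: sum_Times)
  also have "\<dots> = (\<Sum>y\<in>R \<times> S. \<Sum>x\<in>I \<times> K \<times> J \<times> L.
      f (fst x) (fst (snd (snd x))) (fst (snd x)) (snd (snd (snd x))) (fst y) (snd y))"
    by (rule sum.swap)
  also have "\<dots> = (\<Sum>r\<in>R. \<Sum>s\<in>S. \<Sum>i\<in>I. \<Sum>k\<in>K. \<Sum>j\<in>J. \<Sum>l\<in>L. f i j k l r s)"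
    by (simp add: sum_Times)
  finally show ?thesis .
qed

text \<open>Entries of a Kronecker product are products of entries, so after expansion both sides
  differ only in the order of six summations. The lemma serves twice: for complete positivity and
  for computing \<open>\<Phi> \<otimes> \<Psi>\<close>.\<close>

lemma tensor_kraus_map:
  assumes K: "\<And>i. i \<in> I \<Longrightarrow> K i \<in> carrier_mat m n" and L: "\<And>j. j \<in> J \<Longrightarrow> L j \<in> carrier_mat m' n'"
  shows "tensor_map n m n' m' (kraus_map n m I K) (kraus_map n' m' J L) Z =
    kraus_map (n * n') (m * m') (I \<times> J) (\<lambda>(i, j). kron (K i) (L j)) Z"
proof (rule eq_matI)
  fix P Q assume "P < dim_row (kraus_map (n * n') (m * m') (I \<times> J) (\<lambda>(i, j). kron (K i) (L j)) Z)"
    "Q < dim_col (kraus_map (n * n') (m * m') (I \<times> J) (\<lambda>(i, j). kron (K i) (L j)) Z)"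
  then have PQ: "P < m * m'" "Q < m * m'" by (auto simp: kraus_map_def)
  then have "0 < m'" by (cases m') auto
  then have b: "P div m' < m" "Q div m' < m" "P mod m' < m'" "Q mod m' < m'"
    using PQ by (auto simp: less_mult_imp_div_less)
  let ?f = "\<lambda>i j k l r s. K r $$ (P div m', i) * L s $$ (P mod m', k) * Z $$ (i * n' + k, j * n' + l) *
      (cnj (K r $$ (Q div m', j)) * cnj (L s $$ (Q mod m', l)))"
  have kr: "kron (kraus_map n m I K A) (kraus_map n' m' J L B) $$ (P, Q) =
     kraus_map n m I K A $$ (P div m', Q div m') * kraus_map n' m' J L B $$ (P mod m', Q mod m')" for A B
    using PQ by (simp add: kron_def kraus_map_def[of n m] kraus_map_def[of n' m'])
  have kr2: "kron (K r) (L s) $$ (R, i * n' + k) = K r $$ (R div m', i) * L s $$ (R mod m', k)"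
    if "r \<in> I" "s \<in> J" "R < m * m'" "i < n" "k < n'" for r s R i k
    using K[OF that(1)] L[OF that(2)] that(3-) index_product_less[OF that(4,5)]
    by (auto simp: kron_def)
  have "tensor_map n m n' m' (kraus_map n m I K) (kraus_map n' m' J L) Z $$ (P, Q) =
     (\<Sum>i<n. \<Sum>j<n. \<Sum>k<n'. \<Sum>l<n'. \<Sum>r\<in>I. \<Sum>s\<in>J. ?f i j k l r s)"
    using PQ b
    by (auto simp: tensor_map_def kr kraus_map_unit sum_product sum_distrib_left mult_ac intro!: sum.cong sum.swap)
  also have "\<dots> = (\<Sum>r\<in>I. \<Sum>s\<in>J. \<Sum>i<n. \<Sum>k<n'. \<Sum>j<n. \<Sum>l<n'. ?f i j k l r s)"
    by (rule sum_swap_4_4)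
  also have "\<dots> = kraus_map (n * n') (m * m') (I \<times> J) (\<lambda>(i, j). kron (K i) (L j)) Z $$ (P, Q)"
    using PQ
    by (auto simp: kraus_map_def sum_product_index kr2 sum_Times intro!: sum.cong)
  finally show "tensor_map n m n' m' (kraus_map n m I K) (kraus_map n' m' J L) Z $$ (P, Q) =
    kraus_map (n * n') (m * m') (I \<times> J) (\<lambda>(i, j). kron (K i) (L j)) Z $$ (P, Q)" .
qed (auto simp: tensor_map_def kraus_map_def)

text \<open>\<open>tensor_map\<close> evaluates its arguments at matrix units only. The identity
  function can therefore be traded for the Kraus map with the single operator
  \<open>1\<^sub>m k\<close>, although the two agree only on the carrier.\<close>

lemma tensor_map_cong:
  assumes "\<And>i j. i < n \<Longrightarrow> j < n \<Longrightarrow> \<Phi> (mat_unit n i j) = \<Phi>' (mat_unit n i j)"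
    and "\<And>i j. i < n' \<Longrightarrow> j < n' \<Longrightarrow> \<Psi> (mat_unit n' i j) = \<Psi>' (mat_unit n' i j)"
  shows "tensor_map n m n' m' \<Phi> \<Psi> = tensor_map n m n' m' \<Phi>' \<Psi>'"
  using assms by (auto simp: tensor_map_def fun_eq_iff intro!: eq_matI sum.cong)

lemma kraus_map_one:
  assumes "X \<in> carrier_mat n n"
  shows "kraus_map n n {()} (\<lambda>_. 1\<^sub>m n) X = X"
proof (rule eq_matI)
  fix p q assume pq: "p < dim_row X" "q < dim_col X"
  have "(\<Sum>a<n. \<Sum>b<n. 1\<^sub>m n $$ (p, a) * X $$ (a, b) * cnj (1\<^sub>m n $$ (q, b))) = X $$ (p, q)"
    by (subst sum2_eq_single[of p _ q]) (use assms pq in auto)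
  then show "kraus_map n n {()} (\<lambda>_. 1\<^sub>m n) X $$ (p, q) = X $$ (p, q)"
    using assms pq by (simp add: kraus_map_def)
qed (use assms in \<open>auto simp: kraus_map_def\<close>)

lemma mat_unit_carrier [simp]: "mat_unit n i j \<in> carrier_mat n n"
  by (simp add: mat_unit_def)

lemma tensor_id_kraus_map:
  assumes K: "\<And>i. i \<in> I \<Longrightarrow> K i \<in> carrier_mat m n"
  shows "tensor_map k k n m (\<lambda>Y. Y) (kraus_map n m I K) =
      kraus_map (k * n) (k * m) ({()} \<times> I) (\<lambda>(_, i). kron (1\<^sub>m k) (K i))"
    and "tensor_map n m k k (kraus_map n m I K) (\<lambda>Y. Y) =
      kraus_map (n * k) (m * k) (I \<times> {()}) (\<lambda>(i, _). kron (K i) (1\<^sub>m k))"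
proof -
  have "tensor_map k k n m (\<lambda>Y. Y) (kraus_map n m I K) =
      tensor_map k k n m (kraus_map k k {()} (\<lambda>_. 1\<^sub>m k)) (kraus_map n m I K)"
    "tensor_map n m k k (kraus_map n m I K) (\<lambda>Y. Y) =
      tensor_map n m k k (kraus_map n m I K) (kraus_map k k {()} (\<lambda>_. 1\<^sub>m k))"
    by (rule tensor_map_cong; simp add: kraus_map_one)+
  then show "tensor_map k k n m (\<lambda>Y. Y) (kraus_map n m I K) =
      kraus_map (k * n) (k * m) ({()} \<times> I) (\<lambda>(_, i). kron (1\<^sub>m k) (K i))"
    "tensor_map n m k k (kraus_map n m I K) (\<lambda>Y. Y) =
      kraus_map (n * k) (m * k) (I \<times> {()}) (\<lambda>(i, _). kron (K i) (1\<^sub>m k))"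
    using K by (auto simp: fun_eq_iff tensor_kraus_map)
qed

lemma mat_trace_kraus_map:
  "mat_trace (kraus_map n m I K X) =
    (\<Sum>a<n. \<Sum>b<n. X $$ (a, b) * (\<Sum>i\<in>I. \<Sum>p<m. cnj (K i $$ (p, b)) * K i $$ (p, a)))"
proof -
  have "mat_trace (kraus_map n m I K X) = (\<Sum>p<m. \<Sum>i\<in>I. \<Sum>a<n. \<Sum>b<n.
      K i $$ (p, a) * X $$ (a, b) * cnj (K i $$ (p, b)))"
    by (simp add: mat_trace_def kraus_map_def)
  also have "\<dots> = (\<Sum>i\<in>I. \<Sum>p<m. \<Sum>a<n. \<Sum>b<n.
      K i $$ (p, a) * X $$ (a, b) * cnj (K i $$ (p, b)))" by (rule sum.swap)
  also have "\<dots> = (\<Sum>i\<in>I. \<Sum>a<n. \<Sum>b<n. \<Sum>p<m.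
      K i $$ (p, a) * X $$ (a, b) * cnj (K i $$ (p, b)))" by (intro sum.cong refl sum_swap3)
  also have "\<dots> = (\<Sum>a<n. \<Sum>b<n. \<Sum>i\<in>I. \<Sum>p<m.
      K i $$ (p, a) * X $$ (a, b) * cnj (K i $$ (p, b)))" by (rule sum_swap3)
  finally show ?thesis by (simp add: sum_distrib_left mult_ac)
qed

text \<open>The hypothesis \<open>one\<close> reads \<open>sum_i K_i^* K_i = 1\<close>, which is
  trace preservation. Complete positivity holds because amplification by an identity yields a Kraus
  map again, and Kraus maps preserve positivity.\<close>

lemma quantum_channel_kraus_map:
  assumes K: "\<And>i. i \<in> I \<Longrightarrow> K i \<in> carrier_mat m n"
    and one: "\<And>a b. a < n \<Longrightarrow> b < n \<Longrightarrow>
      (\<Sum>i\<in>I. \<Sum>p<m. cnj (K i $$ (p, a)) * K i $$ (p, b)) = (if a = b then 1 else 0)"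
  shows "quantum_channel n m (kraus_map n m I K)"
  unfolding quantum_channel_def completely_positive_def
proof (intro conjI allI ballI impI)
  fix X :: "complex mat" assume X: "X \<in> carrier_mat n n"
  have "(\<Sum>b<n. X $$ (a, b) * (\<Sum>i\<in>I. \<Sum>p<m. cnj (K i $$ (p, b)) * K i $$ (p, a))) = X $$ (a, a)"
    if "a < n" for a
    using that by (subst sum_eq_single[of a]) (auto simp: one)
  then show "mat_trace (kraus_map n m I K X) = mat_trace X"
    using X by (subst mat_trace_kraus_map) (simp add: mat_trace_def)
qed (auto simp: linear_kraus_map tensor_id_kraus_map K psd_kraus_map)

lemma quantum_channel_id: "quantum_channel n n (\<lambda>Y. Y)"
proof -
  have "tensor_map k k n n (\<lambda>Y. Y) (\<lambda>Y. Y) = tensor_map k k n n (\<lambda>Y. Y) (kraus_map n n {()} (\<lambda>_. 1\<^sub>m n))" for k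
    by (rule tensor_map_cong) (auto simp: kraus_map_one)
  then show ?thesis
    by (auto simp: quantum_channel_def linear_op_map_def completely_positive_def
        tensor_id_kraus_map psd_kraus_map)
qed

section \<open>Correctable algebras commute with the effects of the channel\<close>

definition dyad :: "complex vec \<Rightarrow> complex vec \<Rightarrow> complex mat" where
  "dyad x y = mat (dim_vec x) (dim_vec y) (\<lambda>(p, q). x $ p * cnj (y $ q))"

lemma dyad_carrier [simp]: "x \<in> carrier_vec n \<Longrightarrow> y \<in> carrier_vec m \<Longrightarrow> dyad x y \<in> carrier_mat n m"
  by (auto simp: dyad_def)

lemma dyad_index [simp]:
  "x \<in> carrier_vec n \<Longrightarrow> y \<in> carrier_vec m \<Longrightarrow> i < n \<Longrightarrow> j < m \<Longrightarrow> dyad x y $$ (i, j) = x $ i * cnj (y $ j)"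
  by (auto simp: dyad_def)

lemma cscalar_sum: "x \<in> carrier_vec n \<Longrightarrow> y \<in> carrier_vec n \<Longrightarrow> x \<bullet>c y = (\<Sum>i<n. x $ i * cnj (y $ i))"
  by (auto simp: scalar_prod_def atLeast0LessThan)

lemma cscalar_add_left:
  "x \<in> carrier_vec n \<Longrightarrow> y \<in> carrier_vec n \<Longrightarrow> z \<in> carrier_vec n \<Longrightarrow>
    (x + y) \<bullet>c z = x \<bullet>c z + y \<bullet>c (z :: complex vec)"
  by (auto simp: scalar_prod_def ring_distribs sum.distrib)

lemma cscalar_add_right:
  "x \<in> carrier_vec n \<Longrightarrow> y \<in> carrier_vec n \<Longrightarrow> z \<in> carrier_vec n \<Longrightarrow>
    x \<bullet>c (y + z) = x \<bullet>c y + x \<bullet>c (z :: complex vec)"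
  by (auto simp: scalar_prod_def ring_distribs sum.distrib)

lemma cscalar_smult_left:
  "x \<in> carrier_vec n \<Longrightarrow> y \<in> carrier_vec n \<Longrightarrow> (c \<cdot>\<^sub>v x) \<bullet>c y = c * (x \<bullet>c (y :: complex vec))"
  by (auto simp: scalar_prod_def sum_distrib_left mult_ac)

lemma cscalar_smult_right:
  "x \<in> carrier_vec n \<Longrightarrow> y \<in> carrier_vec n \<Longrightarrow> x \<bullet>c (c \<cdot>\<^sub>v y) = cnj c * (x \<bullet>c (y :: complex vec))"
  by (auto simp: scalar_prod_def sum_distrib_left mult_ac)

lemma mat_trace_dyad:
  assumes "Y \<in> carrier_mat n n" "x \<in> carrier_vec n" "y \<in> carrier_vec n"
  shows "mat_trace (Y * dyad x y) = (Y *\<^sub>v x) \<bullet>c y"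
  using assms by (subst mat_trace_mult[of _ n n]) (auto simp: mult_vec_cscalar mult.assoc)

lemma mat_trace_dyad_self: "x \<in> carrier_vec n \<Longrightarrow> mat_trace (dyad x x) = x \<bullet>c x"
  by (auto simp: mat_trace_def cscalar_sum dyad_def)

lemma mat_trace_linear_map:
  assumes D: "linear_op_map m k D" and Y: "Y \<in> carrier_mat k k" and Z: "Z \<in> carrier_mat m m"
  shows "mat_trace (Y * D Z) = (\<Sum>p<m. \<Sum>q<m. Z $$ (p, q) * mat_trace (Y * D (mat_unit m p q)))"
proof -
  have cl: "D X \<in> carrier_mat k k" if "X \<in> carrier_mat m m" for X
    using D that by (auto simp: linear_op_map_def)
  have "mat_trace (Y * D Z) = (\<Sum>i<k. \<Sum>j<k. \<Sum>p<m. \<Sum>q<m. Z $$ (p, q) * (Y $$ (i, j) * D (mat_unit m p q) $$ (j, i)))"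
    by (subst mat_trace_mult[OF Y cl[OF Z]])
      (auto simp: linear_op_map_expand[OF D Z] sum_distrib_left mult_ac intro!: sum.cong)
  also have "\<dots> = (\<Sum>i<k. \<Sum>p<m. \<Sum>q<m. \<Sum>j<k. Z $$ (p, q) * (Y $$ (i, j) * D (mat_unit m p q) $$ (j, i)))"
    by (intro sum.cong refl sum_swap3)
  also have "\<dots> = (\<Sum>p<m. \<Sum>q<m. \<Sum>i<k. \<Sum>j<k. Z $$ (p, q) * (Y $$ (i, j) * D (mat_unit m p q) $$ (j, i)))"
    by (rule sum_swap3)
  also have "\<dots> = (\<Sum>p<m. \<Sum>q<m. Z $$ (p, q) * mat_trace (Y * D (mat_unit m p q)))"
    by (simp add: mat_trace_mult[OF Y cl] sum_distrib_left)
  finally show ?thesis .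
qed

lemma psd_dyad:
  assumes "x \<in> carrier_vec n"
  shows "psd n (dyad x x)"
  unfolding psd_def
proof (intro conjI ballI)
  fix v :: "complex vec" assume v: "v \<in> carrier_vec n"
  have "(dyad x x *\<^sub>v v) \<bullet>c v = (\<Sum>a<n. x $ a * cnj (v $ a)) * (\<Sum>b<n. cnj (x $ b) * v $ b)"
    using assms v unfolding sum_product
    by (subst mult_vec_cscalar[of _ n n]) (auto intro!: sum.cong)
  also have "\<dots> = (x \<bullet>c v) * cnj (x \<bullet>c v)"
    using assms v by (simp add: cscalar_sum)
  also have "\<dots> \<ge> 0" using conjugate_square_positive[of "x \<bullet>c v"] by simp
  finally show "(dyad x x *\<^sub>v v) \<bullet>c v \<ge> 0" .
qed (use assms in simp)

text \<open>The positive matrix \<open>R\<^sup>* R\<close> with \<open>R = (X, 1)\<close> is paired with the image of a rank-one matrix on \<open>\<complex>\<^sup>2 \<otimes> \<complex>\<^sup>m\<close>.\<close>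

lemma channel_schwarz:
  assumes D: "linear_op_map m k D" "completely_positive m k D"
    and X: "X \<in> carrier_mat k k" and z: "z 0 \<in> carrier_vec m" "z (Suc 0) \<in> carrier_vec m"
  shows "mat_trace (mat_adjoint X * X * D (dyad (z 0) (z 0))) + mat_trace (X * D (dyad (z 0) (z 1))) +
    mat_trace (mat_adjoint X * D (dyad (z 1) (z 0))) + mat_trace (D (dyad (z 1) (z 1))) \<ge> 0"
proof -
  have cl: "D Y \<in> carrier_mat k k" if "Y \<in> carrier_mat m m" for Y
    using D that by (auto simp: linear_op_map_def)
  have z: "z \<alpha> \<in> carrier_vec m" if "\<alpha> < 2" for \<alpha>
    using z that by (cases \<alpha>) auto
  \<comment> \<open>\<open>Z\<close> is the rank-one operator of the vector that stacks
    \<open>z 0\<close> on \<open>z 1\<close>. Its blocks are the dyads of \<open>z \<alpha>\<close>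
    and \<open>z \<beta>\<close>, so \<open>T\<close> has the blocks
    \<open>\<rho> \<alpha> \<beta>\<close>.\<close>
  define Z where "Z = dyad (vec (2 * m) (\<lambda>P. z (P div m) $ (P mod m))) (vec (2 * m) (\<lambda>P. z (P div m) $ (P mod m)))"
  define T where "T = tensor_map 2 2 m k (\<lambda>Y. Y) D Z"
  define \<rho> where "\<rho> \<alpha> \<beta> = D (dyad (z \<alpha>) (z \<beta>))" for \<alpha> \<beta>
  have rho: "\<rho> \<alpha> \<beta> \<in> carrier_mat k k" if "\<alpha> < 2" "\<beta> < 2" for \<alpha> \<beta>
    using that z by (auto simp: \<rho>_def intro!: cl)
  have Zi: "Z $$ (i * m + a, j * m + b) = z i $ a * cnj (z j $ b)" if "i < 2" "j < 2" "a < m" "b < m" for i j a b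
    using that index_product_less[of i 2 a m] index_product_less[of j 2 b m] by (simp add: Z_def dyad_def)
  have T: "T $$ (\<alpha> * k + p, \<beta> * k + q) = \<rho> \<alpha> \<beta> $$ (p, q)" if "\<alpha> < 2" "\<beta> < 2" "p < k" "q < k" for \<alpha> \<beta> p q
  proof -
    have lt: "\<alpha> * k + p < 2 * k" "\<beta> * k + q < 2 * k" using that index_product_less by blast+
    have kr: "kron (mat_unit 2 i j) (D (mat_unit m a b)) $$ (\<alpha> * k + p, \<beta> * k + q) =
        (if i = \<alpha> \<and> j = \<beta> then D (mat_unit m a b) $$ (p, q) else 0)" if "i < 2" "j < 2" for i j a b
      using that lt \<open>p < k\<close> \<open>q < k\<close> \<open>\<alpha> < 2\<close> \<open>\<beta> < 2\<close> cl[of "mat_unit m a b"] by (auto simp: kron_def mat_unit_def)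
    have "T $$ (\<alpha> * k + p, \<beta> * k + q) = (\<Sum>i<2. \<Sum>j<2. \<Sum>a<m. \<Sum>b<m.
       Z $$ (i * m + a, j * m + b) * kron (mat_unit 2 i j) (D (mat_unit m a b)) $$ (\<alpha> * k + p, \<beta> * k + q))"
      using lt by (simp add: T_def tensor_map_def)
    also have "\<dots> = (\<Sum>a<m. \<Sum>b<m. dyad (z \<alpha>) (z \<beta>) $$ (a, b) * D (mat_unit m a b) $$ (p, q))"
      using that z by (subst sum2_eq_single[of \<alpha> 2 \<beta> 2]) (auto simp: kr Zi dyad_index[OF z z] intro!: sum.cong sum.neutral)
    also have "\<dots> = \<rho> \<alpha> \<beta> $$ (p, q)"
      unfolding \<rho>_def using that z by (intro linear_op_map_expand[OF D(1), symmetric]) auto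
    finally show ?thesis .
  qed
  have "psd (2 * m) Z" unfolding Z_def by (rule psd_dyad) simp
  then have psd: "psd (2 * k) T" using D(2) by (auto simp: T_def completely_positive_def)
  then have Tc: "T \<in> carrier_mat (2 * k) (2 * k)" by (simp add: psd_def)
  \<comment> \<open>\<open>v r\<close> is column \<open>r\<close> of \<open>R^*\<close>. Summing the
    quadratic forms of \<open>T\<close> at these vectors gives the trace of \<open>R^* R T\<close>,
    and its four block contributions are the four terms of the claim.\<close>
  define v where "v r = vec (2 * k) (\<lambda>P. if P div k = 0 then cnj (X $$ (r, P mod k)) else if P mod k = r then 1 else 0)" for r
  have vc: "v r \<in> carrier_vec (2 * k)" for r by (simp add: v_def)
  have v: "v r $ q = cnj (X $$ (r, q))" "v r $ (k + q) = (if q = r then 1 else 0)" if "q < k" for q r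
    using that by (auto simp: v_def)
  have T': "T $$ (p, q) = \<rho> 0 0 $$ (p, q)" "T $$ (p, k + q) = \<rho> 0 1 $$ (p, q)"
    "T $$ (k + p, q) = \<rho> 1 0 $$ (p, q)" "T $$ (k + p, k + q) = \<rho> 1 1 $$ (p, q)" if "p < k" "q < k" for p q
    using T[of 0 0 p q] T[of 0 1 p q] T[of 1 0 p q] T[of 1 1 p q] that by auto
  have s2: "(\<Sum>i<2. f i) = f 0 + f (1 :: nat)" for f :: "nat \<Rightarrow> complex"
    by (simp add: numeral_2_eq_2)
  have "(T *\<^sub>v v r) \<bullet>c v r =
     (\<Sum>p<k. \<Sum>q<k. cnj (X $$ (r, q)) * X $$ (r, p) * \<rho> 0 0 $$ (p, q)) + (\<Sum>p<k. X $$ (r, p) * \<rho> 0 1 $$ (p, r)) +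
     (\<Sum>q<k. cnj (X $$ (r, q)) * \<rho> 1 0 $$ (r, q)) + \<rho> 1 1 $$ (r, r)" if r: "r < k" for r
  proof -
    have "(T *\<^sub>v v r) \<bullet>c v r = (\<Sum>\<alpha><2. \<Sum>p<k. \<Sum>\<beta><2. \<Sum>q<k.
        T $$ (\<alpha> * k + p, \<beta> * k + q) * v r $ (\<beta> * k + q) * cnj (v r $ (\<alpha> * k + p)))"
      by (simp add: mult_vec_cscalar[OF Tc vc vc] sum_product_index)
    also have "\<dots> = (\<Sum>p<k. \<Sum>q<k. \<rho> 0 0 $$ (p, q) * cnj (X $$ (r, q)) * X $$ (r, p)) +
        (\<Sum>p<k. \<Sum>q<k. \<rho> 0 1 $$ (p, q) * (if q = r then 1 else 0) * X $$ (r, p)) +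
        (\<Sum>p<k. \<Sum>q<k. \<rho> 1 0 $$ (p, q) * cnj (X $$ (r, q)) * (if p = r then 1 else 0)) +
        (\<Sum>p<k. \<Sum>q<k. \<rho> 1 1 $$ (p, q) * (if q = r then 1 else 0) * (if p = r then 1 else 0))"
      by (simp add: s2 v T' sum.distrib if_distrib[of cnj] cong: if_cong)
    also have "(\<Sum>p<k. \<Sum>q<k. \<rho> 0 1 $$ (p, q) * (if q = r then 1 else 0) * X $$ (r, p)) =
        (\<Sum>p<k. X $$ (r, p) * \<rho> 0 1 $$ (p, r))"
      using r by (intro sum.cong refl) (subst sum_eq_single[of r], auto)
    also have "(\<Sum>p<k. \<Sum>q<k. \<rho> 1 0 $$ (p, q) * cnj (X $$ (r, q)) * (if p = r then 1 else 0)) =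
        (\<Sum>q<k. cnj (X $$ (r, q)) * \<rho> 1 0 $$ (r, q))"
      using r by (subst sum_eq_single[of r]) (auto simp: mult.commute)
    also have "(\<Sum>p<k. \<Sum>q<k. \<rho> 1 1 $$ (p, q) * (if q = r then 1 else 0) * (if p = r then 1 else 0)) =
        \<rho> 1 1 $$ (r, r)"
      using r by (subst sum2_eq_single[of r _ r]) auto
    finally show ?thesis by (simp add: mult_ac)
  qed
  then have sum: "(\<Sum>r<k. (T *\<^sub>v v r) \<bullet>c v r) =
     (\<Sum>r<k. \<Sum>p<k. \<Sum>q<k. cnj (X $$ (r, q)) * X $$ (r, p) * \<rho> 0 0 $$ (p, q)) +
     (\<Sum>r<k. \<Sum>p<k. X $$ (r, p) * \<rho> 0 1 $$ (p, r)) +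
     (\<Sum>r<k. \<Sum>q<k. cnj (X $$ (r, q)) * \<rho> 1 0 $$ (r, q)) + (\<Sum>r<k. \<rho> 1 1 $$ (r, r))"
    by (simp add: sum.distrib)
  have "(\<Sum>r<k. \<Sum>p<k. X $$ (r, p) * \<rho> 0 1 $$ (p, r)) = mat_trace (X * \<rho> 0 1)"
    using X rho[of 0 1] by (simp add: mat_trace_mult[of _ k k])
  moreover have "(\<Sum>r<k. \<Sum>q<k. cnj (X $$ (r, q)) * \<rho> 1 0 $$ (r, q)) = mat_trace (mat_adjoint X * \<rho> 1 0)"
    using X rho[of 1 0] by (simp add: mat_trace_mult[of _ k k]) (rule sum.swap)
  moreover have "(\<Sum>r<k. \<rho> 1 1 $$ (r, r)) = mat_trace (\<rho> 1 1)"
    using carrier_matD(1)[OF rho[of 1 1]] by (simp add: mat_trace_def)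
  moreover have "(\<Sum>r<k. \<Sum>p<k. \<Sum>q<k. cnj (X $$ (r, q)) * X $$ (r, p) * \<rho> 0 0 $$ (p, q)) =
      mat_trace (mat_adjoint X * X * \<rho> 0 0)"
  proof -
    have "(\<Sum>r<k. \<Sum>p<k. \<Sum>q<k. cnj (X $$ (r, q)) * X $$ (r, p) * \<rho> 0 0 $$ (p, q)) =
      (\<Sum>q<k. \<Sum>p<k. \<Sum>r<k. cnj (X $$ (r, q)) * X $$ (r, p) * \<rho> 0 0 $$ (p, q))"
      by (subst sum_swap3) (rule sum.swap)
    also have "\<dots> = mat_trace (mat_adjoint X * X * \<rho> 0 0)"
      using X rho[of 0 0] by (subst mat_trace_mult[of _ k k])
        (auto simp: scalar_prod_def atLeast0LessThan sum_distrib_right intro!: sum.cong)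
    finally show ?thesis .
  qed
  moreover have "(\<Sum>r<k. (T *\<^sub>v v r) \<bullet>c v r) \<ge> 0"
    using psd vc by (intro sum_nonneg) (auto simp: psd_def)
  ultimately show ?thesis by (simp add: sum \<rho>_def)
qed

lemma real_quadratic_nonneg_imp_zero:
  fixes a w :: real
  assumes "\<And>s. s * a + s * s * w \<ge> 0"
  shows "a = 0"
proof (rule ccontr)
  assume a: "a \<noteq> 0"
  \<comment> \<open>\<open>d\<close> is positive and exceeds \<open>w\<close>, so at
    \<open>s = - a / d\<close> the quadratic has the negative value
    \<open>a^2 (w - d) / d^2\<close>.\<close>
  define d where "d = 1 + \<bar>w\<bar>"
  have d: "d > 0" "w < d" by (auto simp: d_def)
  have "0 \<le> ((- a / d) * a + (- a / d) * (- a / d) * w) * (d * d)"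
    using assms[of "- a / d"] by (intro mult_nonneg_nonneg) (auto simp: d_def)
  also have "\<dots> = a * a * (w - d)" using d by (simp add: field_simps)
  also have "\<dots> < 0" using a d by (intro mult_pos_neg) (auto simp: zero_less_mult_iff)
  finally show False by simp
qed

text \<open>Real and purely imaginary \<open>t\<close> each reduce to the real quadratic and give
  one real linear relation between \<open>c\<close> and \<open>c'\<close>. The missing relations
  come from the imaginary parts, since nonnegativity of a complex number includes being
  real.\<close>

lemma complex_quadratic_nonneg_imp_zero:
  fixes c c' W :: complex
  assumes "\<And>t. cnj t * c + t * c' + t * cnj t * W \<ge> 0"
  shows "c = 0" "c' = 0"
proof -
  have "Re (c + c') = 0"
    by (rule real_quadratic_nonneg_imp_zero[of _ "Re W"])
      (use assms[of "of_real _"] in \<open>auto simp: less_eq_complex_def algebra_simps\<close>)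
  moreover have "Im c - Im c' = 0"
    by (rule real_quadratic_nonneg_imp_zero[of _ "Re W"])
      (use assms[of "\<i> * of_real _"] in \<open>auto simp: less_eq_complex_def algebra_simps\<close>)
  moreover have "Im (c + c') = 0 \<and> Re (c' - c) = 0"
    using assms[of 1] assms[of "-1"] assms[of "\<i>"] assms[of "-\<i>"]
    by (auto simp: less_eq_complex_def algebra_simps)
  ultimately show "c = 0" "c' = 0" by (auto simp: complex_eq_iff)
qed


text \<open>
  Summed over the Kraus operators, the expressions of \<open>channel_schwarz\<close> at \<open>(L\<^sub>i \<psi>, - L\<^sub>i X \<psi>)\<close> add up to \<open>0\<close>. So these
  are null vectors of a positive form, which is therefore orthogonal to everything there.
\<close>

lemma correctable_commute:
  assumes D: "quantum_channel m k D" and L: "\<And>i. i \<in> I \<Longrightarrow> L i \<in> carrier_mat m k" and I: "finite I"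
    and X: "X \<in> carrier_mat k k"
    and fixed: "\<And>Y Z. Y \<in> {1\<^sub>m k, X, mat_adjoint X, mat_adjoint X * X, X * mat_adjoint X} \<Longrightarrow> Z \<in> carrier_mat k k \<Longrightarrow>
      mat_trace (Y * D (kraus_map k m I L Z)) = mat_trace (Y * Z)"
    and i: "i \<in> I" and \<psi>: "\<psi> \<in> carrier_vec k" and \<phi>: "\<phi> \<in> carrier_vec k"
  shows "(L i *\<^sub>v (X *\<^sub>v \<psi>)) \<bullet>c (L i *\<^sub>v \<phi>) = (L i *\<^sub>v \<psi>) \<bullet>c (L i *\<^sub>v (mat_adjoint X *\<^sub>v \<phi>))"
proof -
  have lin: "linear_op_map m k D" and cp: "completely_positive m k D"
    and tp: "\<And>Z. Z \<in> carrier_mat m m \<Longrightarrow> mat_trace (D Z) = mat_trace Z"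
    using D by (auto simp: quantum_channel_def)
  have cl: "D Y \<in> carrier_mat k k" if "Y \<in> carrier_mat m m" for Y
    using lin that by (auto simp: linear_op_map_def)
  \<comment> \<open>This is \<open><D^*(Y) x, y>\<close>, the sesquilinear form of the decoded
    observable, written without the adjoint map.\<close>
  define \<beta> where "\<beta> Y x y = mat_trace (Y * D (dyad x y))" for Y x y
  have b: "\<beta> Y x y = (\<Sum>p<m. \<Sum>q<m. x $ p * cnj (y $ q) * mat_trace (Y * D (mat_unit m p q)))"
    if "Y \<in> carrier_mat k k" "x \<in> carrier_vec m" "y \<in> carrier_vec m" for Y x y
    unfolding \<beta>_def using that by (subst mat_trace_linear_map[OF lin]) auto
  have Lc: "L i *\<^sub>v x \<in> carrier_vec m" if "i \<in> I" "x \<in> carrier_vec k" for i x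
    using L[OF that(1)] that(2) by simp
  have Lx: "(L i *\<^sub>v x) $ p = (\<Sum>a<k. L i $$ (p, a) * x $ a)" if "i \<in> I" "x \<in> carrier_vec k" "p < m" for i x p
    using L[OF that(1)] that(2,3) by (simp add: scalar_prod_def atLeast0LessThan)
  \<comment> \<open>Recovery enters here: the dyads of the vectors \<open>L i *\<^sub>v x\<close>
    and \<open>L i *\<^sub>v y\<close> add up to the channel image of \<open>dyad x y\<close>, from
    which \<open>D\<close> recovers the pairing with \<open>Y\<close>.\<close>
  have b_sum: "(\<Sum>i\<in>I. \<beta> Y (L i *\<^sub>v x) (L i *\<^sub>v y)) = (Y *\<^sub>v x) \<bullet>c y"
    if Y: "Y \<in> {1\<^sub>m k, X, mat_adjoint X, mat_adjoint X * X, X * mat_adjoint X}"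
      and x: "x \<in> carrier_vec k" and y: "y \<in> carrier_vec k" for Y x y
  proof -
    have Yc: "Y \<in> carrier_mat k k" using Y X by auto
    have K: "kraus_map k m I L (dyad x y) $$ (p, q) = (\<Sum>i\<in>I. (L i *\<^sub>v x) $ p * cnj ((L i *\<^sub>v y) $ q))"
      if "p < m" "q < m" for p q
      using that x y by (auto simp: kraus_map_def Lx sum_product mult_ac intro!: sum.cong)
    have "(\<Sum>i\<in>I. \<beta> Y (L i *\<^sub>v x) (L i *\<^sub>v y)) =
      (\<Sum>i\<in>I. \<Sum>p<m. \<Sum>q<m. (L i *\<^sub>v x) $ p * cnj ((L i *\<^sub>v y) $ q) * mat_trace (Y * D (mat_unit m p q)))"
      using x y Lc Yc by (intro sum.cong refl b) auto
    also have "\<dots> = (\<Sum>p<m. \<Sum>q<m. \<Sum>i\<in>I. (L i *\<^sub>v x) $ p * cnj ((L i *\<^sub>v y) $ q) * mat_trace (Y * D (mat_unit m p q)))"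
      by (rule sum_swap3)
    also have "\<dots> = mat_trace (Y * D (kraus_map k m I L (dyad x y)))"
      by (subst mat_trace_linear_map[OF lin Yc kraus_map_carrier]) (auto simp: K sum_distrib_right intro!: sum.cong)
    also have "\<dots> = mat_trace (Y * dyad x y)" using x y Y by (intro fixed) auto
    finally show ?thesis using Yc x y by (simp add: mat_trace_dyad)
  qed
  have null: "\<beta> A (L i *\<^sub>v x) w = (L i *\<^sub>v (A *\<^sub>v x)) \<bullet>c w"
    "\<beta> (mat_adjoint A) w (L i *\<^sub>v x) = w \<bullet>c (L i *\<^sub>v (A *\<^sub>v x))"
    if A: "A = X \<or> A = mat_adjoint X" and x: "x \<in> carrier_vec k" and w: "w \<in> carrier_vec m" for A x w
  proof -
    have Ac: "A \<in> carrier_mat k k" "mat_adjoint A \<in> carrier_mat k k" "mat_adjoint A * A \<in> carrier_mat k k"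
      using A X by auto
    have Ax: "A *\<^sub>v x \<in> carrier_vec k" using Ac x by simp
    \<comment> \<open>The positive form of \<open>channel_schwarz\<close> for \<open>A\<close>;
      trace preservation has turned its last term into a squared length.\<close>
    define g where "g z1 z2 = \<beta> (mat_adjoint A * A) z1 z1 + \<beta> A z1 z2 + \<beta> (mat_adjoint A) z2 z1 + z2 \<bullet>c z2" for z1 z2
    have g: "g z1 z2 \<ge> 0" if "z1 \<in> carrier_vec m" "z2 \<in> carrier_vec m" for z1 z2
    proof -
      have "mat_trace (D (dyad z2 z2)) = z2 \<bullet>c z2"
        using that by (simp add: tp mat_trace_dyad_self)
      then show ?thesis
        using channel_schwarz[OF lin cp Ac(1), of "\<lambda>i. if i = 0 then z1 else z2"] that
        by (simp add: g_def \<beta>_def)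
    qed
    let ?z1 = "\<lambda>j. L j *\<^sub>v x" and ?z2 = "\<lambda>j. - 1 \<cdot>\<^sub>v (L j *\<^sub>v (A *\<^sub>v x))"
    have neg: "\<beta> Y u (- 1 \<cdot>\<^sub>v v) = - \<beta> Y u v" "\<beta> Y (- 1 \<cdot>\<^sub>v v) u = - \<beta> Y v u"
      if "Y \<in> carrier_mat k k" "u \<in> carrier_vec m" "v \<in> carrier_vec m" for Y u v
      using that by (simp_all add: b sum_negf)
    have "(\<Sum>j\<in>I. g (?z1 j) (?z2 j)) = (\<Sum>j\<in>I. \<beta> (mat_adjoint A * A) (L j *\<^sub>v x) (L j *\<^sub>v x)
        - \<beta> A (L j *\<^sub>v x) (L j *\<^sub>v (A *\<^sub>v x)) - \<beta> (mat_adjoint A) (L j *\<^sub>v (A *\<^sub>v x)) (L j *\<^sub>v x)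
        + \<beta> (1\<^sub>m k) (L j *\<^sub>v (A *\<^sub>v x)) (L j *\<^sub>v (A *\<^sub>v x)))"
    proof (intro sum.cong refl)
      fix j assume j: "j \<in> I"
      have c: "L j *\<^sub>v x \<in> carrier_vec m" "L j *\<^sub>v (A *\<^sub>v x) \<in> carrier_vec m" using L[OF j] x Ax by auto
      have "\<beta> (1\<^sub>m k) (L j *\<^sub>v (A *\<^sub>v x)) (L j *\<^sub>v (A *\<^sub>v x)) = (L j *\<^sub>v (A *\<^sub>v x)) \<bullet>c (L j *\<^sub>v (A *\<^sub>v x))"
        using c cl[of "dyad (L j *\<^sub>v (A *\<^sub>v x)) (L j *\<^sub>v (A *\<^sub>v x))"]
        by (simp add: \<beta>_def tp mat_trace_dyad_self)
      then show "g (?z1 j) (?z2 j) = \<beta> (mat_adjoint A * A) (L j *\<^sub>v x) (L j *\<^sub>v x)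
        - \<beta> A (L j *\<^sub>v x) (L j *\<^sub>v (A *\<^sub>v x)) - \<beta> (mat_adjoint A) (L j *\<^sub>v (A *\<^sub>v x)) (L j *\<^sub>v x)
        + \<beta> (1\<^sub>m k) (L j *\<^sub>v (A *\<^sub>v x)) (L j *\<^sub>v (A *\<^sub>v x))"
        using c Ac by (simp add: g_def neg cscalar_smult_left[of _ m] cscalar_smult_right[of _ m])
    qed
    also have "\<dots> = (mat_adjoint A * A *\<^sub>v x) \<bullet>c x - (A *\<^sub>v x) \<bullet>c (A *\<^sub>v x)
        - (mat_adjoint A *\<^sub>v (A *\<^sub>v x)) \<bullet>c x + (1\<^sub>m k *\<^sub>v (A *\<^sub>v x)) \<bullet>c (A *\<^sub>v x)"
      using A X x Ax by (auto simp: sum.distrib sum_subtractf b_sum)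
    also have "\<dots> = 0"
      using Ac x Ax cscalar_adjoint[of "mat_adjoint A" k k "A *\<^sub>v x" x] by (simp add: assoc_mult_mat_vec[of _ k k])
    finally have "(\<Sum>j\<in>I. g (?z1 j) (?z2 j)) = 0" .
    moreover have "g (?z1 j) (?z2 j) \<ge> 0" if "j \<in> I" for j
      using L[OF that] x Ax by (intro g) auto
    ultimately have g0: "g (?z1 i) (?z2 i) = 0"
      using sum_nonneg_eq_0_iff[OF I, of "\<lambda>j. g (?z1 j) (?z2 j)"] i by auto
    have c: "?z1 i \<in> carrier_vec m" "?z2 i \<in> carrier_vec m" "L i *\<^sub>v (A *\<^sub>v x) \<in> carrier_vec m"
      using L[OF i] x Ax by auto
    \<comment> \<open>The second component of the null vector is moved by \<open>t\<close> times an
      arbitrary \<open>w\<close>. The constant term is zero by \<open>g0\<close>, so nonnegativity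
      for every \<open>t\<close> forces both linear coefficients to vanish.\<close>
    have "cnj t * (\<beta> A (?z1 i) w + ?z2 i \<bullet>c w) + t * (\<beta> (mat_adjoint A) w (?z1 i) + w \<bullet>c ?z2 i) + t * cnj t * (w \<bullet>c w) \<ge> 0" for t
    proof -
      have "0 \<le> g (?z1 i) (?z2 i + t \<cdot>\<^sub>v w)" using c w by (intro g) auto
      also have "\<dots> = g (?z1 i) (?z2 i) + (cnj t * (\<beta> A (?z1 i) w + ?z2 i \<bullet>c w) + t * (\<beta> (mat_adjoint A) w (?z1 i) + w \<bullet>c ?z2 i) + t * cnj t * (w \<bullet>c w))"
      proof -
        have "\<beta> Y u (v + t \<cdot>\<^sub>v w) = \<beta> Y u v + cnj t * \<beta> Y u w" "\<beta> Y (v + t \<cdot>\<^sub>v w) u = \<beta> Y v u + t * \<beta> Y w u"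
          if "Y \<in> carrier_mat k k" "u \<in> carrier_vec m" "v \<in> carrier_vec m" for Y u v
          using that w by (simp_all add: b sum.distrib sum_distrib_left algebra_simps)
        moreover have "(v + t \<cdot>\<^sub>v w) \<bullet>c (v + t \<cdot>\<^sub>v w) = v \<bullet>c v + cnj t * (v \<bullet>c w) + t * (w \<bullet>c v) + t * cnj t * (w \<bullet>c w)"
          if "v \<in> carrier_vec m" for v
          using that w by (simp add: cscalar_add_left[of _ m] cscalar_add_right[of _ m] cscalar_smult_left[of _ m] cscalar_smult_right[of _ m] algebra_simps)
        ultimately show ?thesis using c Ac by (simp add: g_def algebra_simps)
      qed
      finally show ?thesis using g0 by simp
    qed
    from complex_quadratic_nonneg_imp_zero[OF this]
    have "\<beta> A (?z1 i) w + ?z2 i \<bullet>c w = 0" "\<beta> (mat_adjoint A) w (?z1 i) + w \<bullet>c ?z2 i = 0" by blast+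
    then show "\<beta> A (L i *\<^sub>v x) w = (L i *\<^sub>v (A *\<^sub>v x)) \<bullet>c w"
      "\<beta> (mat_adjoint A) w (L i *\<^sub>v x) = w \<bullet>c (L i *\<^sub>v (A *\<^sub>v x))"
      using c w by (auto simp: cscalar_smult_left[of _ m] cscalar_smult_right[of _ m])
  qed
  have c: "L i *\<^sub>v \<psi> \<in> carrier_vec m" "L i *\<^sub>v \<phi> \<in> carrier_vec m" using L[OF i] \<psi> \<phi> by auto
  \<comment> \<open>The form \<open>\<beta> X\<close> at these two vectors is evaluated twice, by
    \<open>null\<close> for \<open>X\<close> and by \<open>null\<close> for
    \<open>mat_adjoint X\<close> with the vectors exchanged. The second use is the reason why
    \<open>X * mat_adjoint X\<close> is among the fixed elements.\<close>
  have "(L i *\<^sub>v (X *\<^sub>v \<psi>)) \<bullet>c (L i *\<^sub>v \<phi>) = \<beta> X (L i *\<^sub>v \<psi>) (L i *\<^sub>v \<phi>)"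
    using null(1)[of X, OF _ \<psi> c(2)] by simp
  also have "\<dots> = (L i *\<^sub>v \<psi>) \<bullet>c (L i *\<^sub>v (mat_adjoint X *\<^sub>v \<phi>))"
    using null(2)[of "mat_adjoint X", OF _ \<phi> c(1)] by simp
  finally show ?thesis .
qed

lemma adjoint_map_cong:
  assumes "\<And>X. X \<in> carrier_mat n n \<Longrightarrow> \<Phi> X = \<Psi> X"
  shows "adjoint_map n \<Phi> Y = adjoint_map n \<Psi> Y"
  using assms unfolding adjoint_map_def by (intro arg_cong[of _ _ The] ext) auto

lemma linear_op_map_comp:
  "linear_op_map m k D \<Longrightarrow> linear_op_map n m \<Phi> \<Longrightarrow> linear_op_map n k (D \<circ> \<Phi>)"
  by (auto simp: linear_op_map_def)

text \<open>Entry \<open>(i, j)\<close> of a matrix is its trace pairing with the matrix unit at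
  \<open>(j, i)\<close>, so being fixed by the adjoint means agreement of two trace functionals.
  Both the use and the construction of decoders go through this form instead of the definite
  description in \<open>adjoint_map\<close>.\<close>

lemma adjoint_map_fixed_iff:
  assumes E: "linear_op_map k k E" and Y: "Y \<in> carrier_mat k k"
  shows "adjoint_map k E Y = Y \<longleftrightarrow> (\<forall>Z\<in>carrier_mat k k. mat_trace (Y * E Z) = mat_trace (Y * Z))"
proof
  assume fixed: "adjoint_map k E Y = Y"
  have unit: "mat_trace (Y * E (mat_unit k j i)) = Y $$ (i, j)" if "i < k" "j < k" for i j
  proof -
    have "Y $$ (i, j) = adjoint_map k E Y $$ (i, j)" using fixed by simp
    then show ?thesis using that by (simp add: adjoint_map_eq[OF E Y])
  qed
  show "\<forall>Z\<in>carrier_mat k k. mat_trace (Y * E Z) = mat_trace (Y * Z)"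
  proof
    fix Z :: "complex mat" assume Z: "Z \<in> carrier_mat k k"
    have "mat_trace (Y * E Z) = (\<Sum>p<k. \<Sum>q<k. Z $$ (p, q) * Y $$ (q, p))"
      by (subst mat_trace_linear_map[OF E Y Z]) (auto simp: unit intro!: sum.cong)
    also have "\<dots> = mat_trace (Y * Z)"
      by (subst mat_trace_mult[OF Y Z], subst sum.swap) (simp add: mult.commute)
    finally show "mat_trace (Y * E Z) = mat_trace (Y * Z)" .
  qed
next
  assume tr: "\<forall>Z\<in>carrier_mat k k. mat_trace (Y * E Z) = mat_trace (Y * Z)"
  have "mat_trace (Y * mat_unit k j i) = Y $$ (i, j)" if "i < k" "j < k" for i j
    using Y that by (subst mat_trace_mult[of _ k k], simp, simp, subst sum2_eq_single[of i _ j])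
      (auto simp: mat_unit_def)
  then show "adjoint_map k E Y = Y"
    using Y tr by (intro eq_matI) (auto simp: adjoint_map_eq[OF E Y])
qed

lemma sum_mult_sum:
  fixes f :: "'a \<Rightarrow> complex"
  shows "(\<Sum>a\<in>A. f a) * y * (\<Sum>b\<in>B. g b) = (\<Sum>a\<in>A. \<Sum>b\<in>B. f a * y * g b)"
  unfolding sum_distrib_right[of f A y] by (rule sum_product)

lemma kraus_map_compress:
  assumes V: "V \<in> carrier_mat n k" and K: "\<And>i. i \<in> I \<Longrightarrow> K i \<in> carrier_mat m n" and Y: "Y \<in> carrier_mat k k"
  shows "kraus_map n m I K (V * Y * mat_adjoint V) = kraus_map k m I (\<lambda>i. K i * V) Y"
proof (rule eq_matI)
  fix p q assume "p < dim_row (kraus_map k m I (\<lambda>i. K i * V) Y)" "q < dim_col (kraus_map k m I (\<lambda>i. K i * V) Y)"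
  then have pq: "p < m" "q < m" by (auto simp: kraus_map_def)
  have VY: "(V * Y * mat_adjoint V) $$ (a, b) = (\<Sum>c<k. \<Sum>d<k. V $$ (a, c) * Y $$ (c, d) * cnj (V $$ (b, d)))"
    if "a < n" "b < n" for a b
    using that V Y
    by (simp add: scalar_prod_def atLeast0LessThan sum_distrib_right) (rule sum.swap)
  have KV: "(K i * V) $$ (p, c) = (\<Sum>a<n. K i $$ (p, a) * V $$ (a, c))" if "i \<in> I" "p < m" "c < k" for i p c
    using that V K[OF that(1)] by (simp add: scalar_prod_def atLeast0LessThan)
  have "(\<Sum>a<n. \<Sum>b<n. K i $$ (p, a) * (V * Y * mat_adjoint V) $$ (a, b) * cnj (K i $$ (q, b))) =
     (\<Sum>c<k. \<Sum>d<k. (K i * V) $$ (p, c) * Y $$ (c, d) * cnj ((K i * V) $$ (q, d)))" if "i \<in> I" for i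
  proof -
    have "(\<Sum>a<n. \<Sum>b<n. K i $$ (p, a) * (V * Y * mat_adjoint V) $$ (a, b) * cnj (K i $$ (q, b))) =
      (\<Sum>a<n. \<Sum>b<n. \<Sum>c<k. \<Sum>d<k. K i $$ (p, a) * V $$ (a, c) * Y $$ (c, d) * (cnj (K i $$ (q, b)) * cnj (V $$ (b, d))))"
      by (auto simp: VY sum_distrib_left sum_distrib_right mult_ac intro!: sum.cong)
    also have "\<dots> = (\<Sum>a<n. \<Sum>c<k. \<Sum>d<k. \<Sum>b<n. K i $$ (p, a) * V $$ (a, c) * Y $$ (c, d) * (cnj (K i $$ (q, b)) * cnj (V $$ (b, d))))"
      by (intro sum.cong refl sum_swap3)
    also have "\<dots> = (\<Sum>c<k. \<Sum>d<k. \<Sum>a<n. \<Sum>b<n. K i $$ (p, a) * V $$ (a, c) * Y $$ (c, d) * (cnj (K i $$ (q, b)) * cnj (V $$ (b, d))))"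
      by (rule sum_swap3)
    also have "\<dots> = (\<Sum>c<k. \<Sum>d<k. (K i * V) $$ (p, c) * Y $$ (c, d) * cnj ((K i * V) $$ (q, d)))"
      using pq by (auto simp: KV[OF that] sum_mult_sum intro!: sum.cong)
    finally show ?thesis .
  qed
  then show "kraus_map n m I K (V * Y * mat_adjoint V) $$ (p, q) = kraus_map k m I (\<lambda>i. K i * V) Y $$ (p, q)"
    using pq by (simp add: kraus_map_def)
qed (auto simp: kraus_map_def)

text \<open>The product \<open>V V^* = P\<close> acts as a unit on \<open>Y\<close>, so it can be
  erased next to \<open>Y\<close>. Compression is therefore multiplicative on the algebra and is
  undone by conjugation with \<open>V\<close>.\<close>

lemma isometry_compress:
  assumes V: "V \<in> carrier_mat n k" "mat_adjoint V * V = 1\<^sub>m k" "V * mat_adjoint V = P"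
    and X: "X \<in> carrier_mat n n" and Y: "Y \<in> carrier_mat n n" "P * Y = Y" "Y * P = Y"
  shows "mat_adjoint V * X * V * (mat_adjoint V * Y * V) = mat_adjoint V * (X * Y) * V"
    and "V * (mat_adjoint V * Y * V) * mat_adjoint V = Y"
proof -
  have Va: "mat_adjoint V \<in> carrier_mat k n" using V by simp
  have P: "P \<in> carrier_mat n n" using V Va by auto
  have YV: "Y * V \<in> carrier_mat n k" using Y V by simp
  have "V * (mat_adjoint V * Y * V) = V * (mat_adjoint V * (Y * V))"
    by (simp add: assoc_mult_mat[OF Va Y(1) V(1)])
  also have "\<dots> = P * (Y * V)"
    unfolding V(3)[symmetric] by (rule assoc_mult_mat[OF V(1) Va YV, symmetric])
  also have "\<dots> = Y * V"
    by (simp add: assoc_mult_mat[OF P Y(1) V(1), symmetric] Y)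
  finally have VY: "V * (mat_adjoint V * Y * V) = Y * V" .
  have "mat_adjoint V * X * V * (mat_adjoint V * Y * V) = mat_adjoint V * X * (V * (mat_adjoint V * Y * V))"
    using Va X Y V(1) by (intro assoc_mult_mat[of _ k n _ k _ k]) auto
  also have "\<dots> = mat_adjoint V * (X * (Y * V))"
    unfolding VY by (rule assoc_mult_mat[OF Va X YV])
  also have "X * (Y * V) = X * Y * V" by (rule assoc_mult_mat[OF X Y(1) V(1), symmetric])
  also have "mat_adjoint V * (X * Y * V) = mat_adjoint V * (X * Y) * V"
    using X Y by (intro assoc_mult_mat[OF Va _ V(1), symmetric]) auto
  finally show "mat_adjoint V * X * V * (mat_adjoint V * Y * V) = mat_adjoint V * (X * Y) * V" .
  show "V * (mat_adjoint V * Y * V) * mat_adjoint V = Y"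
    unfolding VY by (simp add: assoc_mult_mat[OF Y(1) V(1) Va] V(3) Y)
qed

text \<open>Moves a correctable algebra onto its code space, where its unit becomes
  \<open>1\<^sub>m k\<close>. The last conclusion says that each effect
  \<open>V^* K_i^* K_i V\<close> commutes with the compressed algebra; this is all that later
  arguments retain of the decoder.\<close>

lemma correctable_kraus_map_obtain:
  assumes corr: "correctable n m (kraus_map n m I K) S" and I: "finite I"
    and K: "\<And>i. i \<in> I \<Longrightarrow> K i \<in> carrier_mat m n"
  obtains k V where "V \<in> carrier_mat n k" "mat_adjoint V * V = 1\<^sub>m k"
    "star_subalgebra k ((\<lambda>X. mat_adjoint V * X * V) ` S)"
    "1\<^sub>m k \<in> (\<lambda>X. mat_adjoint V * X * V) ` S"
    "(\<lambda>X. mat_adjoint V * X * V) \<in> star_hom ((op_algebra n)\<lparr>carrier := S\<rparr>) (op_algebra k)"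
    "inj_on (\<lambda>X. mat_adjoint V * X * V) S"
    "\<And>X i \<psi> \<phi>. X \<in> (\<lambda>X. mat_adjoint V * X * V) ` S \<Longrightarrow> i \<in> I \<Longrightarrow> \<psi> \<in> carrier_vec k \<Longrightarrow> \<phi> \<in> carrier_vec k \<Longrightarrow>
      (K i *\<^sub>v (V *\<^sub>v (X *\<^sub>v \<psi>))) \<bullet>c (K i *\<^sub>v (V *\<^sub>v \<phi>)) = (K i *\<^sub>v (V *\<^sub>v \<psi>)) \<bullet>c (K i *\<^sub>v (V *\<^sub>v (mat_adjoint X *\<^sub>v \<phi>)))"
proof -
  from corr obtain P k V D where S: "star_subalgebra n S" and P: "P \<in> S" "\<And>X. X \<in> S \<Longrightarrow> P * X = X \<and> X * P = X"
    and V: "V \<in> carrier_mat n k" "mat_adjoint V * V = 1\<^sub>m k" "V * mat_adjoint V = P"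
    and D: "quantum_channel m k D" and fixed: "\<And>X. X \<in> (\<lambda>X. mat_adjoint V * X * V) ` S \<Longrightarrow>
        adjoint_map k (D \<circ> (\<lambda>Y. kraus_map n m I K (V * Y * mat_adjoint V))) X = X"
    unfolding correctable_def by blast
  let ?c = "\<lambda>X. mat_adjoint V * X * V"
  have Va: "mat_adjoint V \<in> carrier_mat k n" using V by simp
  have Sc: "X \<in> carrier_mat n n" if "X \<in> S" for X using S that by (auto simp: star_subalgebra_def)
  have expand: "V * ?c X * mat_adjoint V = X" if "X \<in> S" for X
    using isometry_compress(2)[OF V Sc Sc] that P by blast
  have mult: "?c X * ?c Y = ?c (X * Y)" if "X \<in> S" "Y \<in> S" for X Y
    using isometry_compress(1)[OF V Sc Sc] that P by blast
  have one: "?c P = 1\<^sub>m k"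
  proof -
    have "?c P = mat_adjoint V * (P * V)" by (rule assoc_mult_mat[OF Va Sc[OF P(1)] V(1)])
    also have "P * V = V * (mat_adjoint V * V)" unfolding V(3)[symmetric] by (rule assoc_mult_mat[OF V(1) Va V(1)])
    finally show ?thesis using V(1,2) by simp
  qed
  have add: "?c X + ?c Y = ?c (X + Y)" if "X \<in> S" "Y \<in> S" for X Y
  proof -
    have "?c (X + Y) = (mat_adjoint V * X + mat_adjoint V * Y) * V"
      using Sc[OF that(1)] Sc[OF that(2)] by (simp add: mult_add_distrib_mat[OF Va])
    also have "\<dots> = ?c X + ?c Y"
      using Sc[OF that(1)] Sc[OF that(2)] Va by (intro add_mult_distrib_mat[OF _ _ V(1)]) auto
    finally show ?thesis by simp
  qed
  have smult: "c \<cdot>\<^sub>m ?c X = ?c (c \<cdot>\<^sub>m X)" if "X \<in> S" for X c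
  proof -
    have "?c (c \<cdot>\<^sub>m X) = (c \<cdot>\<^sub>m (mat_adjoint V * X)) * V"
      using Sc[OF that] by (simp add: mult_smult_distrib[OF Va])
    also have "\<dots> = c \<cdot>\<^sub>m ?c X"
      using Sc[OF that] Va by (intro mult_smult_assoc_mat[OF _ V(1)]) auto
    finally show ?thesis by simp
  qed
  have star: "mat_adjoint (?c X) = ?c (mat_adjoint X)" if "X \<in> S" for X
  proof -
    have "mat_adjoint (?c X) = mat_adjoint V * mat_adjoint (mat_adjoint V * X)"
      using Sc[OF that] V(1) Va by (intro adjoint_mult) auto
    also have "mat_adjoint (mat_adjoint V * X) = mat_adjoint X * V"
      using Sc[OF that] V(1) Va by (subst adjoint_mult[of _ k n _ n]) auto
    also have "mat_adjoint V * (mat_adjoint X * V) = ?c (mat_adjoint X)"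
      using Sc[OF that] by (intro assoc_mult_mat[OF Va _ V(1), symmetric]) auto
    finally show ?thesis .
  qed
  have zero: "?c (0\<^sub>m n n) = 0\<^sub>m k k" using V(1) Va by simp
  have ne: "?c ` S \<noteq> {0\<^sub>m k k}"
  proof
    assume "?c ` S = {0\<^sub>m k k}"
    then have "X = 0\<^sub>m n n" if "X \<in> S" for X
    proof -
      have "?c X = 0\<^sub>m k k" using that \<open>?c ` S = {0\<^sub>m k k}\<close> by blast
      then show ?thesis using expand[OF that] V(1) Va by simp
    qed
    then show False using S by (auto simp: star_subalgebra_def)
  qed
  have A: "star_subalgebra k (?c ` S)"
    unfolding star_subalgebra_def
  proof (intro conjI ballI allI)
    show "?c ` S \<subseteq> carrier_mat k k" using Sc V(1) Va by auto
    show "0\<^sub>m k k \<in> ?c ` S" using S by (force simp: star_subalgebra_def simp flip: zero)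
    fix X assume "X \<in> ?c ` S"
    then obtain X' where X: "X' \<in> S" "X = ?c X'" by blast
    show "mat_adjoint X \<in> ?c ` S" "c \<cdot>\<^sub>m X \<in> ?c ` S" for c
      using S X(1) unfolding X(2) star[OF X(1)] smult[OF X(1)] by (auto simp: star_subalgebra_def)
    fix Y assume "Y \<in> ?c ` S"
    then obtain Y' where Y: "Y' \<in> S" "Y = ?c Y'" by blast
    show "X + Y \<in> ?c ` S" "X * Y \<in> ?c ` S"
      using S X(1) Y(1) unfolding X(2) Y(2) add[OF X(1) Y(1)] mult[OF X(1) Y(1)]
      by (auto simp: star_subalgebra_def)
  qed (rule ne)
  let ?L = "\<lambda>i. K i * V"
  have fixed': "mat_trace (Y * D (kraus_map k m I ?L Z)) = mat_trace (Y * Z)"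
    if "Y \<in> ?c ` S" "Z \<in> carrier_mat k k" for Y Z
  proof -
    have "adjoint_map k (D \<circ> kraus_map k m I ?L) Y = adjoint_map k (D \<circ> (\<lambda>Y. kraus_map n m I K (V * Y * mat_adjoint V))) Y"
      using kraus_map_compress[of V n k I K m, OF V(1) K] by (intro adjoint_map_cong) auto
    then have "adjoint_map k (D \<circ> kraus_map k m I ?L) Y = Y" using fixed[OF that(1)] by simp
    moreover have "linear_op_map k k (D \<circ> kraus_map k m I ?L)"
      using D by (intro linear_op_map_comp[OF _ linear_kraus_map]) (simp add: quantum_channel_def)
    moreover have "Y \<in> carrier_mat k k" using that A by (auto simp: star_subalgebra_def)
    ultimately show ?thesis using adjoint_map_fixed_iff that(2) by fastforce
  qed
  have comm: "(K i *\<^sub>v (V *\<^sub>v (X *\<^sub>v \<psi>))) \<bullet>c (K i *\<^sub>v (V *\<^sub>v \<phi>)) = (K i *\<^sub>v (V *\<^sub>v \<psi>)) \<bullet>c (K i *\<^sub>v (V *\<^sub>v (mat_adjoint X *\<^sub>v \<phi>)))"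
    if X: "X \<in> ?c ` S" and i: "i \<in> I" and v: "\<psi> \<in> carrier_vec k" "\<phi> \<in> carrier_vec k" for X i \<psi> \<phi>
  proof -
    have Xc: "X \<in> carrier_mat k k" using X A by (auto simp: star_subalgebra_def)
    have L: "?L i \<in> carrier_mat m k" if "i \<in> I" for i using K[OF that] V(1) by simp
    have KV: "?L i *\<^sub>v x = K i *\<^sub>v (V *\<^sub>v x)" if "x \<in> carrier_vec k" for x
      using K[OF i] V(1) that by (intro assoc_mult_mat_vec) auto
    have mem: "Y \<in> ?c ` S" if "Y \<in> {1\<^sub>m k, X, mat_adjoint X, mat_adjoint X * X, X * mat_adjoint X}" for Y
    proof -
      have "1\<^sub>m k \<in> ?c ` S" using P(1) by (force simp flip: one)
      then show ?thesis using that X A unfolding star_subalgebra_def by blast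
    qed
    have "(?L i *\<^sub>v (X *\<^sub>v \<psi>)) \<bullet>c (?L i *\<^sub>v \<phi>) = (?L i *\<^sub>v \<psi>) \<bullet>c (?L i *\<^sub>v (mat_adjoint X *\<^sub>v \<phi>))"
      using correctable_commute[of m k D I ?L X i \<psi> \<phi>, OF D L I Xc fixed'[OF mem] i v] by blast
    moreover have "X *\<^sub>v \<psi> \<in> carrier_vec k" "mat_adjoint X *\<^sub>v \<phi> \<in> carrier_vec k"
      using mult_mat_vec_carrier[OF Xc v(1)] mult_mat_vec_carrier[OF adjoint_carrier[OF Xc] v(2)] by blast+
    ultimately show ?thesis using v by (simp add: KV)
  qed
  have hom: "?c \<in> star_hom ((op_algebra n)\<lparr>carrier := S\<rparr>) (op_algebra k)"
    using Sc V(1) Va by (auto simp: star_hom_def op_algebra_def add mult smult star)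
  have inj: "inj_on ?c S" by (rule inj_on_inverseI) (rule expand)
  show ?thesis
    by (rule that[OF V(1,2) A _ hom inj comm]) (use P(1) one in \<open>auto intro!: image_eqI[of _ _ P]\<close>)
qed

section \<open>Matrix algebras containing \<open>M\<^sub>2\<close> and \<open>\<complex>\<^sup>3\<close>\<close>

lemma nonzero_mat_imp_vec:
  fixes A :: "complex mat"
  assumes A: "A \<in> carrier_mat n m" "A \<noteq> 0\<^sub>m n m"
  obtains v where "v \<in> carrier_vec m" "A *\<^sub>v v \<noteq> 0\<^sub>v n"
proof -
  obtain i j where ij: "i < n" "j < m" "A $$ (i, j) \<noteq> 0"
    using A by (metis carrier_matD(1) carrier_matD(2) eq_matI index_zero_mat)
  have "(A *\<^sub>v unit_vec m j) $ i = A $$ (i, j)"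
    using A(1) ij by (simp add: scalar_prod_right_unit)
  then have "A *\<^sub>v unit_vec m j \<noteq> 0\<^sub>v n" using ij by force
  then show ?thesis using that[of "unit_vec m j"] by simp
qed

lemma smult_mat_mult_vec:
  fixes A :: "complex mat"
  shows "A \<in> carrier_mat n m \<Longrightarrow> v \<in> carrier_vec m \<Longrightarrow> (c \<cdot>\<^sub>m A) *\<^sub>v v = c \<cdot>\<^sub>v (A *\<^sub>v v)"
  by (rule eq_vecI) auto

lemma zero_mat_mult_vec: "v \<in> carrier_vec m \<Longrightarrow> 0\<^sub>m n m *\<^sub>v v = (0\<^sub>v n :: complex vec)"
  by (rule eq_vecI) auto

lemma zero_smult_vec: "v \<in> carrier_vec n \<Longrightarrow> 0 \<cdot>\<^sub>v v = (0\<^sub>v n :: complex vec)"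
  by (rule eq_vecI) auto

lemma shifted_mat_mult_vec:
  fixes A :: "complex mat"
  assumes "A \<in> carrier_mat k k" "v \<in> carrier_vec k"
  shows "(A + c \<cdot>\<^sub>m 1\<^sub>m k) *\<^sub>v v = A *\<^sub>v v + c \<cdot>\<^sub>v v"
  using assms by (subst add_mult_distrib_mat_vec[of _ k k]) (auto simp: smult_mat_mult_vec[of _ k k])

lemma shifted_mat_eq_zero:
  fixes A :: "complex mat"
  assumes A: "A \<in> carrier_mat k k" and 0: "A + c \<cdot>\<^sub>m 1\<^sub>m k = 0\<^sub>m k k"
  shows "A = (- c) \<cdot>\<^sub>m 1\<^sub>m k"
proof (rule eq_matI)
  fix i j assume "i < dim_row ((- c) \<cdot>\<^sub>m 1\<^sub>m k)" "j < dim_col ((- c) \<cdot>\<^sub>m 1\<^sub>m k)"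
  then have ij: "i < k" "j < k" by auto
  then have "(A + c \<cdot>\<^sub>m 1\<^sub>m k) $$ (i, j) = 0" using 0 by simp
  then show "A $$ (i, j) = ((- c) \<cdot>\<^sub>m 1\<^sub>m k) $$ (i, j)"
    using ij A by (auto simp: add_eq_0_iff2)
qed (use A in auto)

lemma eigenvector_exists:
  fixes A :: "complex mat"
  assumes A: "A \<in> carrier_mat k k" and k: "k \<noteq> 0"
  obtains c v where "v \<in> carrier_vec k" "v \<noteq> 0\<^sub>v k" "(A + c \<cdot>\<^sub>m 1\<^sub>m k) *\<^sub>v v = 0\<^sub>v k"
proof -
  from spectrum_non_empty[OF A] k obtain l where "eigenvalue A l" by (auto simp: spectrum_def)
  then obtain v where v: "v \<in> carrier_vec k" "v \<noteq> 0\<^sub>v k" "A *\<^sub>v v = l \<cdot>\<^sub>v v"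
    using A by (auto simp: eigenvalue_def eigenvector_def)
  have "(A + (- l) \<cdot>\<^sub>m 1\<^sub>m k) *\<^sub>v v = A *\<^sub>v v + (- l) \<cdot>\<^sub>v v"
    by (rule shifted_mat_mult_vec[OF A v(1)])
  also have "\<dots> = 0\<^sub>v k" using v by (intro eq_vecI) auto
  finally show ?thesis using that v by blast
qed

lemma star_subalgebraD:
  assumes "star_subalgebra k A"
  shows "X \<in> A \<Longrightarrow> X \<in> carrier_mat k k" "X \<in> A \<Longrightarrow> Y \<in> A \<Longrightarrow> X + Y \<in> A"
    "X \<in> A \<Longrightarrow> Y \<in> A \<Longrightarrow> X * Y \<in> A" "X \<in> A \<Longrightarrow> c \<cdot>\<^sub>m X \<in> A" "X \<in> A \<Longrightarrow> mat_adjoint X \<in> A" "k \<noteq> 0"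
proof -
  show "k \<noteq> 0"
  proof
    assume "k = 0"
    have "X = 0\<^sub>m k k" if "X \<in> A" for X
    proof -
      have "X \<in> carrier_mat k k" using assms that by (auto simp: star_subalgebra_def)
      then show ?thesis using \<open>k = 0\<close> by (intro eq_matI) auto
    qed
    then show False using assms by (auto simp: star_subalgebra_def)
  qed
qed (use assms in \<open>auto simp: star_subalgebra_def\<close>)

text \<open>\<open>X\<close> has an eigenvector over the complex numbers; shifted by the eigenvalue
  it becomes singular but stays nonzero, and the adjoint of the shift is \<open>B\<close>. For an
  effect that commutes with \<open>A\<close>, the vectors \<open>\<psi>\<close> and
  \<open>B *\<^sub>v \<chi>\<close> then have orthogonal outputs, which is how a nonscalar element
  conflicts with a confusing measurement.\<close>

lemma star_subalgebra_nonscalar: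
  assumes A: "star_subalgebra k A" "1\<^sub>m k \<in> A" and X: "X \<in> A" "\<And>c. X \<noteq> c \<cdot>\<^sub>m 1\<^sub>m k"
  obtains B \<psi> \<chi> where "B \<in> A" "\<psi> \<in> carrier_vec k" "\<chi> \<in> carrier_vec k" "\<psi> \<noteq> 0\<^sub>v k"
    "B *\<^sub>v \<chi> \<noteq> 0\<^sub>v k" "mat_adjoint B *\<^sub>v \<psi> = 0\<^sub>v k"
proof -
  note D = star_subalgebraD[OF A(1)]
  from eigenvector_exists[OF D(1)[OF X(1)] D(6)] obtain c \<psi> where
    \<psi>: "\<psi> \<in> carrier_vec k" "\<psi> \<noteq> 0\<^sub>v k" "(X + c \<cdot>\<^sub>m 1\<^sub>m k) *\<^sub>v \<psi> = 0\<^sub>v k" by blast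
  define N where "N = X + c \<cdot>\<^sub>m 1\<^sub>m k"
  have N: "N \<in> A" using A X D by (simp add: N_def)
  have "mat_adjoint N \<noteq> 0\<^sub>m k k"
  proof
    assume "mat_adjoint N = 0\<^sub>m k k"
    then have "mat_adjoint (mat_adjoint N) = mat_adjoint (0\<^sub>m k k)" by simp
    then have "N = 0\<^sub>m k k" by (auto intro!: eq_matI)
    then show False using shifted_mat_eq_zero[OF D(1)[OF X(1)]] X(2) by (auto simp: N_def)
  qed
  then obtain \<chi> where "\<chi> \<in> carrier_vec k" "mat_adjoint N *\<^sub>v \<chi> \<noteq> 0\<^sub>v k"
    using nonzero_mat_imp_vec[OF D(1)[OF D(5)[OF N]]] by blast
  then show ?thesis using that[of "mat_adjoint N" \<psi> \<chi>] N D \<psi> by (simp add: N_def)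
qed

text \<open>Each \<open>v a\<close> is fixed by \<open>Q a\<close> and killed by the other two
  matrices, so the three vectors are pairwise independent. Three vectors of a plane are dependent,
  and \<open>Q 0\<close> applied to the dependence leaves only its \<open>v 0\<close> term.\<close>

lemma no_three_orthogonal_idempotents:
  fixes Q :: "nat \<Rightarrow> nat \<Rightarrow> nat \<Rightarrow> complex" and v :: "nat \<Rightarrow> nat \<Rightarrow> complex"
  assumes Q: "\<And>a b i. a < 3 \<Longrightarrow> b < 3 \<Longrightarrow> i < 2 \<Longrightarrow> Q a i 0 * v b 0 + Q a i 1 * v b 1 = (if a = b then v a i else 0)"
    and v: "\<And>a. a < 3 \<Longrightarrow> v a 0 \<noteq> 0 \<or> v a 1 \<noteq> 0"
  shows False
proof -
  define d where "d a b = v a 0 * v b 1 - v a 1 * v b 0" for a b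
  have d: "d a b \<noteq> 0" if ab: "a < 3" "b < 3" "a \<noteq> b" for a b
  proof
    assume 0: "d a b = 0"
    have "v b j * v a i = 0" if ij: "i < 2" "j < 2" for i j
    proof -
      have par: "v b j * v a l = v a j * v b l" if "l < 2" for l
        using 0 that ij by (auto simp: d_def less_2_cases_iff algebra_simps)
      have "v b j * v a i = v b j * (Q a i 0 * v a 0 + Q a i 1 * v a 1)"
        using Q[of a a i] ab ij by simp
      also have "\<dots> = Q a i 0 * (v b j * v a 0) + Q a i 1 * (v b j * v a 1)" by (simp add: algebra_simps)
      also have "\<dots> = Q a i 0 * (v a j * v b 0) + Q a i 1 * (v a j * v b 1)"
        using par[of 0] par[of 1] by simp
      also have "\<dots> = v a j * (Q a i 0 * v b 0 + Q a i 1 * v b 1)" by (simp add: algebra_simps)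
      also have "\<dots> = 0" using Q[of a b i] ab ij by simp
      finally show ?thesis .
    qed
    from this[of 0 0] this[of 0 1] this[of 1 0] this[of 1 1] v[OF ab(1)] v[OF ab(2)] show False by auto
  qed
  have "d 1 2 * v 0 i = 0" if i: "i < 2" for i
  proof -
    \<comment> \<open>Cramer's identity for three vectors of the plane:
      \<open>d 1 2 v_0 + d 2 0 v_1 + d 0 1 v_2 = 0\<close>.\<close>
    have cr: "d 1 2 * v 0 l = - d 2 0 * v 1 l - d 0 1 * v 2 l" if "l < 2" for l
      using that by (auto simp: d_def less_2_cases_iff algebra_simps)
    have "d 1 2 * v 0 i = d 1 2 * (Q 0 i 0 * v 0 0 + Q 0 i 1 * v 0 1)" using Q[of 0 0 i] i by simp
    also have "\<dots> = Q 0 i 0 * (d 1 2 * v 0 0) + Q 0 i 1 * (d 1 2 * v 0 1)" by (simp add: algebra_simps)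
    also have "\<dots> = Q 0 i 0 * (- d 2 0 * v 1 0 - d 0 1 * v 2 0) + Q 0 i 1 * (- d 2 0 * v 1 1 - d 0 1 * v 2 1)"
      using cr[of 0] cr[of 1] by simp
    also have "\<dots> = - d 2 0 * (Q 0 i 0 * v 1 0 + Q 0 i 1 * v 1 1) - d 0 1 * (Q 0 i 0 * v 2 0 + Q 0 i 1 * v 2 1)"
      by (simp add: algebra_simps)
    also have "\<dots> = 0" using Q[of 0 1 i] Q[of 0 2 i] i by simp
    finally show ?thesis .
  qed
  from this[of 0] this[of 1] v[of 0] d[of 1 2] show False by auto
qed

text \<open>If the commutant of the copy of \<open>M\<^sub>2\<close> in \<open>A\<close> is trivial, then \<open>A\<close> is that copy, which is too small for three
  orthogonal idempotents. Otherwise an element of the commutant, shifted by an eigenvalue, gives \<open>B\<^sup>*\<close>.\<close>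

lemma matrix_units_and_three_idempotents:
  fixes e :: "nat \<Rightarrow> nat \<Rightarrow> complex mat" and q :: "nat \<Rightarrow> complex mat"
  assumes A: "star_subalgebra k A" "1\<^sub>m k \<in> A"
    and e: "\<And>i j. i < 2 \<Longrightarrow> j < 2 \<Longrightarrow> e i j \<in> A"
      "\<And>i j l m. i < 2 \<Longrightarrow> j < 2 \<Longrightarrow> l < 2 \<Longrightarrow> m < 2 \<Longrightarrow> e i j * e l m = (if j = l then e i m else 0\<^sub>m k k)"
      "\<And>i j. i < 2 \<Longrightarrow> j < 2 \<Longrightarrow> mat_adjoint (e i j) = e j i" "e 0 0 \<noteq> 0\<^sub>m k k"
    and q: "\<And>a. a < 3 \<Longrightarrow> q a \<in> A" "\<And>a. a < 3 \<Longrightarrow> q a \<noteq> 0\<^sub>m k k"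
      "\<And>a b. a < 3 \<Longrightarrow> b < 3 \<Longrightarrow> q a * q b = (if a = b then q a else 0\<^sub>m k k)"
  obtains B \<psi> \<chi> where "B \<in> A" "\<psi> \<in> carrier_vec k" "\<chi> \<in> carrier_vec k" "\<psi> \<noteq> 0\<^sub>v k"
    "e 0 0 *\<^sub>v \<psi> = \<psi>" "B *\<^sub>v \<chi> \<noteq> 0\<^sub>v k" "mat_adjoint B *\<^sub>v \<psi> = 0\<^sub>v k"
    "mat_adjoint B *\<^sub>v (e 1 0 *\<^sub>v \<psi>) = 0\<^sub>v k"
proof -
  note D = star_subalgebraD[OF A(1)]
  have ec: "e i j \<in> carrier_mat k k" if "i < 2" "j < 2" for i j using e(1)[OF that] D(1) by blast
  \<comment> \<open>Matrix units are handled through their action on vectors, so that their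
    relations become rewrite rules which collapse every composite.\<close>
  define E where "E i j v = e i j *\<^sub>v v" for i j v
  have Ec: "E i j v \<in> carrier_vec k" if "i < 2" "j < 2" "v \<in> carrier_vec k" for i j v
    unfolding E_def using mult_mat_vec_carrier[OF ec that(3)] that by blast
  have EE: "E i j (E l m v) = (if j = l then E i m v else 0\<^sub>v k)"
    if "i < 2" "j < 2" "l < 2" "m < 2" "v \<in> carrier_vec k" for i j l m v
    unfolding E_def using assoc_mult_mat_vec[OF ec ec that(5), of i j l m] e(2)[OF that(1-4)] that by (auto simp: zero_mat_mult_vec)
  have Eadd: "E i j (u + v) = E i j u + E i j v"
    if "i < 2" "j < 2" "u \<in> carrier_vec k" "v \<in> carrier_vec k" for i j u v
    unfolding E_def using mult_add_distrib_mat_vec[OF ec that(3,4)] that by blast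
  have Esm: "E i j (c \<cdot>\<^sub>v v) = c \<cdot>\<^sub>v E i j v" if "i < 2" "j < 2" "v \<in> carrier_vec k" for i j c v
    unfolding E_def using mult_mat_vec[OF ec that(3)] that by blast
  have E0: "E i j (0\<^sub>v k) = 0\<^sub>v k" if "i < 2" "j < 2" for i j
    unfolding E_def using ec[OF that] by (intro eq_vecI) auto
  have xc: "x *\<^sub>v v \<in> carrier_vec k" if "x \<in> A" "v \<in> carrier_vec k" for x v
    using mult_mat_vec_carrier[OF D(1) that(2)] that by blast
  have xadd: "x *\<^sub>v (u + v) = x *\<^sub>v u + x *\<^sub>v v" if "x \<in> A" "u \<in> carrier_vec k" "v \<in> carrier_vec k" for x u v
    using mult_add_distrib_mat_vec[OF D(1) that(2,3)] that by blast
  have xsm: "x *\<^sub>v (c \<cdot>\<^sub>v v) = c \<cdot>\<^sub>v (x *\<^sub>v v)" if "x \<in> A" "v \<in> carrier_vec k" for x c v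
    using mult_mat_vec[OF D(1) that(2)] that by blast
  have x0: "x *\<^sub>v 0\<^sub>v k = 0\<^sub>v k" if "x \<in> A" for x
    using D(1)[OF that] by (intro eq_vecI) auto
  have xy: "(x * y) *\<^sub>v v = x *\<^sub>v (y *\<^sub>v v)" if "x \<in> A" "y \<in> A" "v \<in> carrier_vec k" for x y v
    using assoc_mult_mat_vec[OF D(1) D(1) that(3)] that by blast
  note [simp] = Ec EE Eadd Esm E0 xc xadd xsm x0 xy
  show ?thesis
  proof (cases "e 0 0 + e 1 1 = 1\<^sub>m k")
    case False
    \<comment> \<open>If the copy of \<open>M\<^sub>2\<close> has a smaller unit \<open>p\<close>,
      then \<open>1 - p\<close> serves directly: it is nonzero, self-adjoint, and kills the vectors
      fixed by \<open>p\<close>, among them \<open>\<psi>\<close> and its partner.\<close>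
    define p where "p = e 0 0 + e 1 1"
    have p: "p \<in> A" "p \<in> carrier_mat k k" using e(1) D by (auto simp: p_def)
    have pv: "p *\<^sub>v v = E 0 0 v + E 1 1 v" if "v \<in> carrier_vec k" for v
      unfolding p_def E_def using that by (intro add_mult_distrib_mat_vec[of _ k k] ec) auto
    define B where "B = (- 1) \<cdot>\<^sub>m p + 1 \<cdot>\<^sub>m 1\<^sub>m k"
    have B: "B \<in> A" unfolding B_def by (intro D p A)
    have Bv: "B *\<^sub>v v = (- 1) \<cdot>\<^sub>v (p *\<^sub>v v) + 1 \<cdot>\<^sub>v v" if "v \<in> carrier_vec k" for v
      unfolding B_def using that p by (subst shifted_mat_mult_vec) (auto simp: smult_mat_mult_vec[of _ k k])
    have "mat_adjoint p = p"
      unfolding p_def using ec[of 0 0] ec[of 1 1] e(3)[of 0 0] e(3)[of 1 1] by (simp add: adjoint_add[of _ k k])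
    then have Badj: "mat_adjoint B = B"
      unfolding B_def using p by (simp add: adjoint_add[of _ k k] adjoint_smult)
    have "B \<noteq> 0\<^sub>m k k"
    proof
      assume "B = 0\<^sub>m k k"
      then have "(- 1) \<cdot>\<^sub>m p = (- 1) \<cdot>\<^sub>m 1\<^sub>m k" unfolding B_def using p by (intro shifted_mat_eq_zero) auto
      then have "(- 1) \<cdot>\<^sub>m ((- 1) \<cdot>\<^sub>m p) = (- 1) \<cdot>\<^sub>m ((- 1) \<cdot>\<^sub>m 1\<^sub>m k)" by (rule arg_cong)
      moreover have "(- 1) \<cdot>\<^sub>m ((- 1) \<cdot>\<^sub>m X) = X" for X :: "complex mat" by (rule eq_matI) auto
      ultimately have "p = 1\<^sub>m k" by metis
      then show False using False by (simp add: p_def)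
    qed
    then obtain \<chi> where \<chi>: "\<chi> \<in> carrier_vec k" "B *\<^sub>v \<chi> \<noteq> 0\<^sub>v k"
      using nonzero_mat_imp_vec[OF D(1)[OF B]] by blast
    obtain v where v: "v \<in> carrier_vec k" "E 0 0 v \<noteq> 0\<^sub>v k"
      using nonzero_mat_imp_vec[OF ec e(4)] unfolding E_def by (metis zero_less_numeral)
    define \<psi> where "\<psi> = E 0 0 v"
    have \<psi>: "\<psi> \<in> carrier_vec k" "\<psi> \<noteq> 0\<^sub>v k" "E 0 0 \<psi> = \<psi>" "p *\<^sub>v \<psi> = \<psi>" "p *\<^sub>v E 1 0 \<psi> = E 1 0 \<psi>"
      "E 1 0 \<psi> \<in> carrier_vec k"
      using v by (auto simp: \<psi>_def pv)
    have neg: "(- 1) \<cdot>\<^sub>v u + 1 \<cdot>\<^sub>v u = 0\<^sub>v k" if "u \<in> carrier_vec k" for u :: "complex vec"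
      using that by (intro eq_vecI) auto
    have "mat_adjoint B *\<^sub>v \<psi> = 0\<^sub>v k" "mat_adjoint B *\<^sub>v E 1 0 \<psi> = 0\<^sub>v k"
      unfolding Badj using \<psi> neg by (simp_all add: Bv del: one_smult_vec)
    then show ?thesis using that[OF B \<psi>(1) \<chi>(1) \<psi>(2) _ \<chi>(2)] \<psi>(3) unfolding E_def by blast
  next
    case True
    have split: "E 0 0 v + E 1 1 v = v" if "v \<in> carrier_vec k" for v
    proof -
      have "E 0 0 v + E 1 1 v = (e 0 0 + e 1 1) *\<^sub>v v"
        unfolding E_def using that by (intro add_mult_distrib_mat_vec[of _ k k, symmetric] ec) auto
      then show ?thesis using that True by simp
    qed
    \<comment> \<open>The sum of \<open>e i 0 * x * e 0 i\<close> over \<open>i\<close>, the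
      standard way to push an element into the commutant of the matrix units.\<close>
    define T where "T x = e 0 0 * (x * e 0 0) + e 1 0 * (x * e 0 1)" for x
    have TA: "T x \<in> A" if "x \<in> A" for x unfolding T_def using that by (intro D e) auto
    have Tv: "T x *\<^sub>v v = E 0 0 (x *\<^sub>v E 0 0 v) + E 1 0 (x *\<^sub>v E 0 1 v)" if "x \<in> A" "v \<in> carrier_vec k" for x v
    proof -
      have m: "x * e l m \<in> A" if "l < 2" "m < 2" for l m
        using that \<open>x \<in> A\<close> by (auto intro!: D e)
      have m': "e i j * (x * e l m) \<in> A" if "i < 2" "j < 2" "l < 2" "m < 2" for i j l m
        using D(3)[OF e(1)[OF that(1,2)] m[OF that(3,4)]] .
      have ev: "e i j *\<^sub>v v = E i j v" for i j v by (simp add: E_def)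
      have "T x *\<^sub>v v = (e 0 0 * (x * e 0 0)) *\<^sub>v v + (e 1 0 * (x * e 0 1)) *\<^sub>v v"
        unfolding T_def using that by (intro add_mult_distrib_mat_vec[of _ k k] D(1) m') auto
      then show ?thesis using that m e(1) by (simp add: ev)
    qed
    show ?thesis
    proof (cases "\<exists>x\<in>A. \<forall>c. T x \<noteq> c \<cdot>\<^sub>m 1\<^sub>m k")
      case True
      then obtain x where x: "x \<in> A" "\<And>c. T x \<noteq> c \<cdot>\<^sub>m 1\<^sub>m k" by blast
      obtain c \<psi>' where \<psi>': "\<psi>' \<in> carrier_vec k" "\<psi>' \<noteq> 0\<^sub>v k" "(T x + c \<cdot>\<^sub>m 1\<^sub>m k) *\<^sub>v \<psi>' = 0\<^sub>v k"
        using eigenvector_exists[OF D(1)[OF TA[OF x(1)]] D(6)] by blast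
      define N where "N = T x + c \<cdot>\<^sub>m 1\<^sub>m k"
      have N: "N \<in> A" unfolding N_def by (intro D TA x A)
      have Nv: "N *\<^sub>v v = T x *\<^sub>v v + c \<cdot>\<^sub>v v" if "v \<in> carrier_vec k" for v
        unfolding N_def by (rule shifted_mat_mult_vec[OF D(1)[OF TA[OF x(1)]] that])
      have comm: "N *\<^sub>v E i j v = E i j (N *\<^sub>v v)" if ij: "(i, j) \<in> {(0, 0), (0, 1), (1, 0)}" and v: "v \<in> carrier_vec k" for i j v
        using ij v x(1) by (auto simp: Nv Tv)
      \<comment> \<open>By \<open>comm\<close> both candidates lie in the kernel of
        \<open>N\<close>, and both are fixed by \<open>e 0 0\<close>. They cannot vanish together,
        because \<open>\<psi>'\<close> is the sum of \<open>E 0 0 \<psi>'\<close> and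
        \<open>E 1 0 (E 0 1 \<psi>')\<close>.\<close>
      define \<psi> where "\<psi> = (if E 0 0 \<psi>' = 0\<^sub>v k then E 0 1 \<psi>' else E 0 0 \<psi>')"
      have "E 0 0 \<psi>' \<noteq> 0\<^sub>v k \<or> E 0 1 \<psi>' \<noteq> 0\<^sub>v k"
      proof (rule ccontr)
        assume "\<not> (E 0 0 \<psi>' \<noteq> 0\<^sub>v k \<or> E 0 1 \<psi>' \<noteq> 0\<^sub>v k)"
        moreover have "E 1 1 \<psi>' = E 1 0 (E 0 1 \<psi>')" using \<psi>' by simp
        ultimately show False using split[OF \<psi>'(1)] \<psi>' by simp
      qed
      then have \<psi>: "\<psi> \<in> carrier_vec k" "\<psi> \<noteq> 0\<^sub>v k" "E 0 0 \<psi> = \<psi>" using \<psi>' by (auto simp: \<psi>_def)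
      have N\<psi>: "N *\<^sub>v \<psi> = 0\<^sub>v k" using comm[of 0 0 \<psi>'] comm[of 0 1 \<psi>'] \<psi>' by (auto simp: \<psi>_def N_def[symmetric])
      then have "N *\<^sub>v E 1 0 \<psi> = 0\<^sub>v k" using comm[of 1 0 \<psi>] \<psi> by simp
      have "mat_adjoint N \<noteq> 0\<^sub>m k k"
      proof
        assume "mat_adjoint N = 0\<^sub>m k k"
        then have "mat_adjoint (mat_adjoint N) = mat_adjoint (0\<^sub>m k k)" by simp
        then have "N = 0\<^sub>m k k" by (auto intro!: eq_matI)
        then show False using shifted_mat_eq_zero[OF D(1)[OF TA[OF x(1)]]] x(2) by (auto simp: N_def)
      qed
      then obtain \<chi> where "\<chi> \<in> carrier_vec k" "mat_adjoint N *\<^sub>v \<chi> \<noteq> 0\<^sub>v k"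
        using nonzero_mat_imp_vec[OF D(1)[OF D(5)[OF N]]] by blast
      then show ?thesis
        using that[of "mat_adjoint N" \<psi> \<chi>] D(5)[OF N] \<psi> N\<psi> \<open>N *\<^sub>v E 1 0 \<psi> = 0\<^sub>v k\<close> unfolding E_def by simp
    next
      case False
      then obtain \<tau> where \<tau>: "\<And>x. x \<in> A \<Longrightarrow> T x = \<tau> x \<cdot>\<^sub>m 1\<^sub>m k" by metis
      have scalar: "E 0 0 (x *\<^sub>v E 0 0 v) = \<tau> x \<cdot>\<^sub>v E 0 0 v" if "x \<in> A" "v \<in> carrier_vec k" for x v
      proof -
        have "E 0 0 (x *\<^sub>v E 0 0 v) = T x *\<^sub>v E 0 0 v" using that by (simp add: Tv)
        then show ?thesis using that by (simp add: \<tau> smult_mat_mult_vec[of _ k k])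
      qed
      \<comment> \<open>With every \<open>T x\<close> scalar, \<open>e 0 i * x * e j 0\<close> acts
        as a multiple of \<open>e 0 0\<close>; the factor is entry \<open>(i, j)\<close> of the
        image of \<open>x\<close> in \<open>M\<^sub>2\<close>. In \<open>c_mult\<close> the identity
        \<open>e 0 0 + e 1 1 = 1\<close> supplies the middle index of the matrix product.\<close>
      define c where "c x i j = \<tau> (e 0 i * (x * e j 0))" for x i j
      have c: "E 0 i (x *\<^sub>v E j 0 v) = c x i j \<cdot>\<^sub>v E 0 0 v" if "x \<in> A" "i < 2" "j < 2" "v \<in> carrier_vec k" for x i j v
      proof -
        have m: "e 0 i * (x * e j 0) \<in> A" "x * e j 0 \<in> A" "e 0 i \<in> A" "e j 0 \<in> A" using that by (auto intro!: D e)
        have ev: "e i j *\<^sub>v v = E i j v" for i j v by (simp add: E_def)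
        have "E 0 0 ((e 0 i * (x * e j 0)) *\<^sub>v E 0 0 v) = E 0 i (x *\<^sub>v E j 0 v)"
          using m that by (simp add: ev)
        then show ?thesis using scalar[OF m(1) that(4)] by (simp add: c_def)
      qed
      obtain w' where w': "w' \<in> carrier_vec k" "E 0 0 w' \<noteq> 0\<^sub>v k"
        using nonzero_mat_imp_vec[OF ec e(4)] unfolding E_def by (metis zero_less_numeral)
      define w where "w = E 0 0 w'"
      have w: "w \<in> carrier_vec k" "E 0 0 w = w" "w \<noteq> 0\<^sub>v k" using w' by (auto simp: w_def)
      have inj: "a = b" if "a \<cdot>\<^sub>v w = b \<cdot>\<^sub>v w" for a b
      proof -
        obtain i where i: "i < k" "w $ i \<noteq> 0" using w by (metis carrier_vecD eq_vecI index_zero_vec)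
        have "(a \<cdot>\<^sub>v w) $ i = (b \<cdot>\<^sub>v w) $ i" using that by simp
        then show ?thesis using i w by simp
      qed
      have c_mult: "c (x * y) i j = c x i 0 * c y 0 j + c x i 1 * c y 1 j" if xy': "x \<in> A" "y \<in> A" and ij: "i < 2" "j < 2" for x y i j
      proof (rule inj)
        have yw: "y *\<^sub>v E j 0 w \<in> carrier_vec k" using xy' ij w by simp
        have "c (x * y) i j \<cdot>\<^sub>v w = E 0 i (x *\<^sub>v (y *\<^sub>v E j 0 w))"
          using c[of "x * y" i j w] xy' ij w D(3) by simp
        also have "y *\<^sub>v E j 0 w = E 0 0 (y *\<^sub>v E j 0 w) + E 1 1 (y *\<^sub>v E j 0 w)"
          using split[OF yw] by simp
        also have "E 0 0 (y *\<^sub>v E j 0 w) = E 0 0 (E 0 0 (y *\<^sub>v E j 0 w))" using yw by simp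
        also have "E 1 1 (y *\<^sub>v E j 0 w) = E 1 0 (E 0 1 (y *\<^sub>v E j 0 w))" using yw by simp
        also have "E 0 i (x *\<^sub>v (E 0 0 (E 0 0 (y *\<^sub>v E j 0 w)) + E 1 0 (E 0 1 (y *\<^sub>v E j 0 w)))) =
            c y 0 j \<cdot>\<^sub>v E 0 i (x *\<^sub>v E 0 0 w) + c y 1 j \<cdot>\<^sub>v E 0 i (x *\<^sub>v E 1 0 w)"
          using xy' ij w by (simp add: c del: EE)
        also have "\<dots> = (c x i 0 * c y 0 j + c x i 1 * c y 1 j) \<cdot>\<^sub>v w"
          using xy' ij w c[of x i 0 w] c[of x i 1 w]
          by (simp add: smult_smult_assoc add_smult_distrib_vec mult.commute)
        finally show "c (x * y) i j \<cdot>\<^sub>v w = (c x i 0 * c y 0 j + c x i 1 * c y 1 j) \<cdot>\<^sub>v w" .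
      qed
      have zA: "0\<^sub>m k k \<in> A" using A(1) by (simp add: star_subalgebra_def)
      have c0: "c (0\<^sub>m k k) i j = 0" if "i < 2" "j < 2" for i j
      proof (rule inj)
        have "0\<^sub>m k k *\<^sub>v E j 0 w = 0\<^sub>v k" using that w Ec[of j 0 w] by (intro eq_vecI) auto
        then show "c (0\<^sub>m k k) i j \<cdot>\<^sub>v w = 0 \<cdot>\<^sub>v w"
          using c[OF zA that w(1)] that w by (auto simp: zero_smult_vec)
      qed
      \<comment> \<open>If the image of \<open>q a\<close> were zero, all four corners
        \<open>e i i * q a * e j j\<close> would vanish, and they add up to \<open>q a\<close>. A
        nonzero column of the image then plays the part of \<open>v a\<close> in
        \<open>no_three_orthogonal_idempotents\<close>.\<close>
      have "\<exists>j<2. c (q a) 0 j \<noteq> 0 \<or> c (q a) 1 j \<noteq> 0" if a: "a < 3" for a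
      proof (rule ccontr)
        assume "\<not> ?thesis"
        then have 0: "c (q a) i j = 0" if "i < 2" "j < 2" for i j
          using that by (auto simp: less_2_cases_iff)
        have qe: "E i i (q a *\<^sub>v E j j v) = 0\<^sub>v k" if "i < 2" "j < 2" "v \<in> carrier_vec k" for i j v
        proof -
          have "E i i (q a *\<^sub>v E j j v) = E i 0 (E 0 i (q a *\<^sub>v E j 0 (E 0 j v)))"
            using that q(1)[OF a] by simp
          also have "E 0 i (q a *\<^sub>v E j 0 (E 0 j v)) = 0 \<cdot>\<^sub>v E 0 0 (E 0 j v)"
            using c[of "q a" i j "E 0 j v"] that q(1)[OF a] 0 by (simp del: EE)
          finally show ?thesis using that by (auto simp: zero_smult_vec)
        qed
        obtain v where v: "v \<in> carrier_vec k" "q a *\<^sub>v v \<noteq> 0\<^sub>v k"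
          using nonzero_mat_imp_vec[OF D(1)[OF q(1)[OF a]] q(2)[OF a]] by blast
        have "q a *\<^sub>v v = E 0 0 (q a *\<^sub>v v) + E 1 1 (q a *\<^sub>v v)" using v q(1)[OF a] by (intro split[symmetric]) auto
        also have "\<dots> = E 0 0 (q a *\<^sub>v (E 0 0 v + E 1 1 v)) + E 1 1 (q a *\<^sub>v (E 0 0 v + E 1 1 v))"
          using split[OF v(1)] by simp
        also have "\<dots> = 0\<^sub>v k" using v q(1)[OF a] by (simp add: qe)
        finally show False using v by simp
      qed
      then obtain j where j: "\<And>a. a < 3 \<Longrightarrow> j a < 2 \<and> (c (q a) 0 (j a) \<noteq> 0 \<or> c (q a) 1 (j a) \<noteq> 0)" by metis
      have False
      proof (rule no_three_orthogonal_idempotents[of "\<lambda>a i l. c (q a) i l" "\<lambda>a i. c (q a) i (j a)"])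
        fix a b i :: nat assume abi: "a < 3" "b < 3" "i < 2"
        have "c (q a) i 0 * c (q b) 0 (j b) + c (q a) i 1 * c (q b) 1 (j b) = c (q a * q b) i (j b)"
          using c_mult[OF q(1) q(1)] abi j by simp
        also have "\<dots> = (if a = b then c (q a) i (j a) else 0)"
          using q(3)[OF abi(1,2)] c0 abi j by auto
        finally show "c (q a) i 0 * c (q b) 0 (j b) + c (q a) i 1 * c (q b) 1 (j b) = (if a = b then c (q a) i (j a) else 0)" .
      qed (use j in blast)
      then show ?thesis by blast
    qed
  qed
qed

section \<open>Full and diagonal matrix algebras as \<open>C\<^sup>*\<close>-algebras\<close>

definition vnorm :: "complex vec \<Rightarrow> real" where
  "vnorm v = L2_set (\<lambda>i. cmod (v $ i)) {..<dim_vec v}"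

lemma vnorm_nonneg [simp]: "vnorm v \<ge> 0"
  by (simp add: vnorm_def L2_set_nonneg)

lemma vnorm_eq_0: "v \<in> carrier_vec n \<Longrightarrow> vnorm v = 0 \<longleftrightarrow> v = 0\<^sub>v n"
  by (auto simp: vnorm_def L2_set_eq_0_iff intro!: eq_vecI)

lemma vnorm_zero [simp]: "vnorm (0\<^sub>v n) = 0"
  by (simp add: vnorm_eq_0[of _ n])

lemma vnorm_smult: "vnorm (c \<cdot>\<^sub>v v) = cmod c * vnorm v"
  by (auto simp: vnorm_def norm_mult L2_set_right_distrib intro!: L2_set_cong)

lemma vnorm_add:
  assumes "v \<in> carrier_vec n" "w \<in> carrier_vec n"
  shows "vnorm (v + w) \<le> vnorm v + vnorm w"
proof -
  have "vnorm (v + w) \<le> L2_set (\<lambda>i. cmod (v $ i) + cmod (w $ i)) {..<n}"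
    using assms by (auto simp: vnorm_def intro!: L2_set_mono norm_triangle_ineq)
  also have "\<dots> \<le> vnorm v + vnorm w"
    using assms by (auto simp: vnorm_def intro: L2_set_triangle_ineq)
  finally show ?thesis .
qed

lemma vnorm_square: "(vnorm v)\<^sup>2 = Re (v \<bullet>c v)"
  by (simp add: vnorm_def L2_set_def sum_nonneg scalar_prod_def atLeast0LessThan cmod_def
      power2_eq_square flip: complex_mult_cnj)

lemma cauchy_schwarz_vec:
  assumes "v \<in> carrier_vec n" "w \<in> carrier_vec n"
  shows "cmod (v \<bullet>c w) \<le> vnorm v * vnorm w"
proof -
  have "cmod (v \<bullet>c w) \<le> (\<Sum>i<n. \<bar>cmod (v $ i)\<bar> * \<bar>cmod (w $ i)\<bar>)"
    using assms by (auto simp: cscalar_sum norm_mult intro!: sum_norm_le)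
  also have "\<dots> \<le> vnorm v * vnorm w"
    using L2_set_mult_ineq[of "\<lambda>i. cmod (v $ i)" "\<lambda>i. cmod (w $ i)" "{..<n}"] assms
    by (simp add: vnorm_def)
  finally show ?thesis .
qed

text \<open>The closed unit ball is used rather than the sphere because it is nonempty for
  \<open>n = 0\<close> too: it always contains the zero vector.\<close>

definition opnorm :: "nat \<Rightarrow> complex mat \<Rightarrow> real" where
  "opnorm n X = (SUP v\<in>{v \<in> carrier_vec n. vnorm v \<le> 1}. vnorm (X *\<^sub>v v))"

lemma opnorm_bdd:
  assumes "X \<in> carrier_mat n n"
  shows "bdd_above ((\<lambda>v. vnorm (X *\<^sub>v v)) ` {v \<in> carrier_vec n. vnorm v \<le> 1})"
proof (rule bdd_aboveI2)
  fix v :: "complex vec" assume "v \<in> {v \<in> carrier_vec n. vnorm v \<le> 1}"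
  then have v: "v \<in> carrier_vec n" "vnorm v \<le> 1" by auto
  have vi: "cmod (v $ i) \<le> 1" if "i < n" for i
    using member_le_L2_set[of "{..<n}" i "\<lambda>i. cmod (v $ i)"] that v by (auto simp: vnorm_def)
  have "vnorm (X *\<^sub>v v) \<le> (\<Sum>i<n. cmod ((X *\<^sub>v v) $ i))"
    using L2_set_le_sum[of "{..<n}" "\<lambda>i. cmod ((X *\<^sub>v v) $ i)"] carrier_matD[OF assms] by (simp add: vnorm_def)
  also have "\<dots> \<le> (\<Sum>i<n. \<Sum>j<n. cmod (X $$ (i, j)))"
  proof (intro sum_mono)
    fix i assume "i \<in> {..<n}"
    then have "cmod ((X *\<^sub>v v) $ i) = cmod (\<Sum>j<n. X $$ (i, j) * v $ j)"
      using assms v by (simp add: scalar_prod_def atLeast0LessThan)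
    also have "\<dots> \<le> (\<Sum>j<n. cmod (X $$ (i, j)))"
      using vi by (auto simp: norm_mult intro!: sum_norm_le mult_left_le)
    finally show "cmod ((X *\<^sub>v v) $ i) \<le> (\<Sum>j<n. cmod (X $$ (i, j)))" .
  qed
  finally show "vnorm (X *\<^sub>v v) \<le> (\<Sum>i<n. \<Sum>j<n. cmod (X $$ (i, j)))" .
qed

lemma vnorm_mult_le:
  assumes X: "X \<in> carrier_mat n n" and v: "v \<in> carrier_vec n"
  shows "vnorm (X *\<^sub>v v) \<le> opnorm n X * vnorm v"
proof (cases "vnorm v = 0")
  case True
  then have "v = 0\<^sub>v n" using v by (simp add: vnorm_eq_0)
  moreover have "X *\<^sub>v 0\<^sub>v n = 0\<^sub>v n" using X by (intro eq_vecI) auto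
  ultimately show ?thesis by simp
next
  case False
  define c where "c = complex_of_real (1 / vnorm v)"
  have c: "cmod c = 1 / vnorm v" by (simp add: c_def norm_divide)
  have "vnorm (X *\<^sub>v (c \<cdot>\<^sub>v v)) \<le> opnorm n X"
    unfolding opnorm_def using opnorm_bdd[OF X] v False by (intro cSUP_upper) (auto simp: vnorm_smult c)
  then have "vnorm (X *\<^sub>v v) / vnorm v \<le> opnorm n X"
    using mult_mat_vec[OF X v] by (simp add: vnorm_smult c)
  then show ?thesis using False by (simp add: field_simps less_le)
qed

lemma opnorm_le:
  assumes X: "X \<in> carrier_mat n n" and C: "C \<ge> 0" "\<And>v. v \<in> carrier_vec n \<Longrightarrow> vnorm (X *\<^sub>v v) \<le> C * vnorm v"
  shows "opnorm n X \<le> C"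
  unfolding opnorm_def
proof (rule cSUP_least)
  show "{v \<in> carrier_vec n. vnorm v \<le> 1} \<noteq> {}" by (auto intro!: exI[of _ "0\<^sub>v n"])
  fix v assume "v \<in> {v \<in> carrier_vec n. vnorm v \<le> 1}"
  then show "vnorm (X *\<^sub>v v) \<le> C"
    using C(2)[of v] mult_left_mono[of "vnorm v" 1 C] C(1) by auto
qed

lemma opnorm_nonneg:
  assumes X: "X \<in> carrier_mat n n"
  shows "opnorm n X \<ge> 0"
proof -
  have "vnorm (X *\<^sub>v 0\<^sub>v n) \<le> opnorm n X"
    unfolding opnorm_def using opnorm_bdd[OF X] by (intro cSUP_upper) auto
  then show ?thesis using vnorm_nonneg order_trans by blast
qed

lemma opnorm_eq_0:
  assumes X: "X \<in> carrier_mat n n"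
  shows "opnorm n X = 0 \<longleftrightarrow> X = 0\<^sub>m n n"
proof
  assume 0: "opnorm n X = 0"
  show "X = 0\<^sub>m n n"
  proof (rule ccontr)
    assume "X \<noteq> 0\<^sub>m n n"
    then obtain v where v: "v \<in> carrier_vec n" "X *\<^sub>v v \<noteq> 0\<^sub>v n" using nonzero_mat_imp_vec[OF X] by blast
    have "vnorm (X *\<^sub>v v) \<le> 0" using vnorm_mult_le[OF X v(1)] 0 by simp
    then have "vnorm (X *\<^sub>v v) = 0" using vnorm_nonneg[of "X *\<^sub>v v"] by linarith
    then show False using v mult_mat_vec_carrier[OF X v(1)] by (simp add: vnorm_eq_0)
  qed
next
  assume "X = 0\<^sub>m n n"
  then have "opnorm n X \<le> 0" by (intro opnorm_le) (auto simp: zero_mat_mult_vec)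
  then show "opnorm n X = 0" using opnorm_nonneg[OF X] by simp
qed

lemma opnorm_smult_le:
  assumes X: "X \<in> carrier_mat n n"
  shows "opnorm n (c \<cdot>\<^sub>m X) \<le> cmod c * opnorm n X"
  using X vnorm_mult_le[OF X] opnorm_nonneg[OF X]
  by (intro opnorm_le) (auto simp: smult_mat_mult_vec[OF X] vnorm_smult mult.assoc intro!: mult_left_mono)

lemma opnorm_smult:
  assumes X: "X \<in> carrier_mat n n"
  shows "opnorm n (c \<cdot>\<^sub>m X) = cmod c * opnorm n X"
proof (cases "c = 0")
  case True
  then show ?thesis
    using X opnorm_smult_le[OF X, of c] opnorm_nonneg[of "c \<cdot>\<^sub>m X" n] by auto
next
  case False
  have "inverse c \<cdot>\<^sub>m (c \<cdot>\<^sub>m X) = X" using False by (intro eq_matI) auto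
  then have "opnorm n X \<le> inverse (cmod c) * opnorm n (c \<cdot>\<^sub>m X)"
    using opnorm_smult_le[of "c \<cdot>\<^sub>m X" n "inverse c"] X by (simp add: norm_inverse)
  then show ?thesis using opnorm_smult_le[OF X, of c] False by (simp add: field_simps)
qed

lemma opnorm_add:
  assumes X: "X \<in> carrier_mat n n" and Y: "Y \<in> carrier_mat n n"
  shows "opnorm n (X + Y) \<le> opnorm n X + opnorm n Y"
proof (rule opnorm_le)
  fix v :: "complex vec" assume v: "v \<in> carrier_vec n"
  have "vnorm ((X + Y) *\<^sub>v v) = vnorm (X *\<^sub>v v + Y *\<^sub>v v)" by (simp add: add_mult_distrib_mat_vec[OF X Y v])
  also have "\<dots> \<le> vnorm (X *\<^sub>v v) + vnorm (Y *\<^sub>v v)" using X Y v by (intro vnorm_add[of _ n]) auto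
  also have "\<dots> \<le> (opnorm n X + opnorm n Y) * vnorm v"
    using vnorm_mult_le[OF X v] vnorm_mult_le[OF Y v] by (simp add: algebra_simps)
  finally show "vnorm ((X + Y) *\<^sub>v v) \<le> (opnorm n X + opnorm n Y) * vnorm v" .
qed (use assms opnorm_nonneg in auto)

lemma opnorm_mult:
  assumes X: "X \<in> carrier_mat n n" and Y: "Y \<in> carrier_mat n n"
  shows "opnorm n (X * Y) \<le> opnorm n X * opnorm n Y"
proof (rule opnorm_le)
  fix v :: "complex vec" assume v: "v \<in> carrier_vec n"
  have "vnorm ((X * Y) *\<^sub>v v) = vnorm (X *\<^sub>v (Y *\<^sub>v v))" by (simp add: assoc_mult_mat_vec[OF X Y v])
  also have "\<dots> \<le> opnorm n X * vnorm (Y *\<^sub>v v)" using Y v by (intro vnorm_mult_le[OF X]) auto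
  also have "\<dots> \<le> opnorm n X * (opnorm n Y * vnorm v)"
    using vnorm_mult_le[OF Y v] opnorm_nonneg[OF X] by (intro mult_left_mono)
  finally show "vnorm ((X * Y) *\<^sub>v v) \<le> opnorm n X * opnorm n Y * vnorm v" by (simp add: mult.assoc)
qed (use assms opnorm_nonneg in auto)

text \<open>Cauchy-Schwarz for \<open><v, X^* X v>\<close> bounds the square of the norm of
  \<open>X\<close> by the norm of \<open>X^* X\<close>. With submultiplicativity this yields that
  \<open>X\<close> and \<open>X^*\<close> have the same norm, and then the opposite
  inequality.\<close>

lemma opnorm_cstar:
  assumes X: "X \<in> carrier_mat n n"
  shows "opnorm n (mat_adjoint X * X) = (opnorm n X)\<^sup>2"
proof -
  have le: "(opnorm n X)\<^sup>2 \<le> opnorm n (mat_adjoint X * X)" if X: "X \<in> carrier_mat n n" for X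
  proof -
    have XX: "mat_adjoint X * X \<in> carrier_mat n n" by (rule mult_carrier_mat[OF adjoint_carrier[OF X] X])
    have "opnorm n X \<le> sqrt (opnorm n (mat_adjoint X * X))"
    proof (rule opnorm_le[OF X])
      fix v :: "complex vec" assume v: "v \<in> carrier_vec n"
      have Xv: "X *\<^sub>v v \<in> carrier_vec n" using X v by simp
      have "(vnorm (X *\<^sub>v v))\<^sup>2 = Re (v \<bullet>c (mat_adjoint X * X *\<^sub>v v))"
        using cscalar_adjoint[OF X v Xv] assoc_mult_mat_vec[OF adjoint_carrier[OF X] X v] by (simp add: vnorm_square)
      also have "\<dots> \<le> vnorm v * vnorm (mat_adjoint X * X *\<^sub>v v)"
        using cauchy_schwarz_vec[OF v mult_mat_vec_carrier[OF XX v]] complex_Re_le_cmod order_trans by blast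
      also have "\<dots> \<le> vnorm v * (opnorm n (mat_adjoint X * X) * vnorm v)"
        by (intro mult_left_mono vnorm_mult_le[OF XX v]) simp
      also have "\<dots> = (sqrt (opnorm n (mat_adjoint X * X)) * vnorm v)\<^sup>2"
        using opnorm_nonneg[OF XX] by (simp add: power_mult_distrib power2_eq_square[of "vnorm v"])
      finally show "vnorm (X *\<^sub>v v) \<le> sqrt (opnorm n (mat_adjoint X * X)) * vnorm v"
        by (rule power2_le_imp_le) (simp add: opnorm_nonneg[OF XX])
    qed (simp add: opnorm_nonneg[OF XX])
    then show ?thesis
      using opnorm_nonneg[OF X] opnorm_nonneg[OF XX] power_mono[of "opnorm n X" _ 2] by fastforce
  qed
  have le': "opnorm n X \<le> opnorm n (mat_adjoint X)" if X: "X \<in> carrier_mat n n" for X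
  proof (cases "opnorm n X = 0")
    case True
    then show ?thesis using opnorm_nonneg[OF adjoint_carrier[OF X]] by simp
  next
    case False
    have "opnorm n X * opnorm n X \<le> opnorm n (mat_adjoint X) * opnorm n X"
      using le[OF X] opnorm_mult[OF adjoint_carrier[OF X] X] by (simp add: power2_eq_square)
    then show ?thesis using False opnorm_nonneg[OF X] by (simp add: less_le)
  qed
  have "opnorm n (mat_adjoint X) = opnorm n X"
    using le'[OF X] le'[OF adjoint_carrier[OF X]] by simp
  then show ?thesis
    using le[OF X] opnorm_mult[OF adjoint_carrier[OF X] X] by (simp add: power2_eq_square)
qed

text \<open>Block structures: \<open>R = UNIV\<close> gives the full matrix algebra, and \<open>R = Id\<close> the diagonal matrices.\<close>

definition pattern_algebra :: "nat \<Rightarrow> (nat \<times> nat) set \<Rightarrow> complex mat star_algebra" where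
  "pattern_algebra n R = (op_algebra n)\<lparr>carrier :=
     {X \<in> carrier_mat n n. \<forall>i<n. \<forall>j<n. (i, j) \<notin> R \<longrightarrow> X $$ (i, j) = 0}\<rparr>"

lemma pattern_algebra_simps [simp]:
  "carrier (pattern_algebra n R) = {X \<in> carrier_mat n n. \<forall>i<n. \<forall>j<n. (i, j) \<notin> R \<longrightarrow> X $$ (i, j) = 0}"
  "monoid.mult (pattern_algebra n R) = (*)" "one (pattern_algebra n R) = 1\<^sub>m n"
  "zero (pattern_algebra n R) = 0\<^sub>m n n" "add (pattern_algebra n R) = (+)"
  "module.smult (pattern_algebra n R) = (\<cdot>\<^sub>m)" "adj (pattern_algebra n R) = mat_adjoint"
  by (simp_all add: pattern_algebra_def op_algebra_def)

lemma op_algebra_simps [simp]: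
  "carrier (op_algebra n) = carrier_mat n n"
  "monoid.mult (op_algebra n) = (*)" "one (op_algebra n) = 1\<^sub>m n"
  "zero (op_algebra n) = 0\<^sub>m n n" "add (op_algebra n) = (+)"
  "module.smult (op_algebra n) = (\<cdot>\<^sub>m)" "adj (op_algebra n) = mat_adjoint"
  by (simp_all add: op_algebra_def)

lemma op_algebra_pattern: "op_algebra n = pattern_algebra n UNIV"
  by (simp add: pattern_algebra_def op_algebra_def)

text \<open>A nonzero summand needs a path from \<open>i\<close> through \<open>l\<close> to
  \<open>j\<close> inside \<open>R\<close>, which transitivity closes up. Reflexivity plays the same
  role for the unit and symmetry for the adjoint.\<close>

lemma pattern_mult:
  assumes R: "trans R" and X: "X \<in> carrier (pattern_algebra n R)" and Y: "Y \<in> carrier (pattern_algebra n R)"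
  shows "X * Y \<in> carrier (pattern_algebra n R)"
proof -
  have XY: "X \<in> carrier_mat n n" "Y \<in> carrier_mat n n" using X Y by auto
  have "(X * Y) $$ (i, j) = 0" if ij: "i < n" "j < n" "(i, j) \<notin> R" for i j
  proof -
    have "X $$ (i, l) * Y $$ (l, j) = 0" if "l < n" for l
    proof -
      have "(i, l) \<notin> R \<or> (l, j) \<notin> R" using transD[OF R] ij(3) by blast
      then show ?thesis using X Y ij that by auto
    qed
    then show ?thesis using XY ij by (auto simp: scalar_prod_def intro!: sum.neutral)
  qed
  then show ?thesis using XY by auto
qed

lemma ring_pattern_algebra:
  assumes "refl R" "trans R"
  shows "ring (pattern_algebra n R)"
proof (rule ringI)
  show "abelian_group (pattern_algebra n R)"
  proof (rule abelian_groupI)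
    fix X assume X: "X \<in> carrier (pattern_algebra n R)"
    show "\<exists>Y\<in>carrier (pattern_algebra n R). Y \<oplus>\<^bsub>pattern_algebra n R\<^esub> X = \<zero>\<^bsub>pattern_algebra n R\<^esub>"
      using X by (intro bexI[of _ "- X"]) (auto intro!: eq_matI)
  qed (auto intro: assoc_add_mat comm_add_mat)
  show "monoid (pattern_algebra n R)"
    using assms pattern_mult[OF assms(2)] by (intro monoidI) (auto simp: refl_on_def)
qed (auto intro: add_mult_distrib_mat mult_add_distrib_mat)

lemma vectorspace_pattern_algebra:
  assumes "refl R" "trans R"
  shows "vectorspace class_ring (pattern_algebra n R)"
proof -
  interpret abelian_group "pattern_algebra n R"
    using ring_pattern_algebra[OF assms] by (rule ring.is_abelian_group)
  show ?thesis unfolding class_field_def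
    by unfold_locales (auto simp: class_ring_simps add_smult_distrib_left_mat add_smult_distrib_right_mat)
qed

lemma fin_dim_pattern_algebra:
  assumes R: "refl R" "trans R"
  shows "vectorspace.fin_dim class_ring (pattern_algebra n R)"
proof -
  interpret V: vectorspace class_ring "pattern_algebra n R"
    by (rule vectorspace_pattern_algebra[OF R])
  let ?U = "(\<lambda>(i, j). mat_unit n i j) ` (R \<inter> {..<n} \<times> {..<n})"
  have U: "?U \<subseteq> carrier (pattern_algebra n R)" by (auto simp: mat_unit_def)
  have sub: "submodule class_ring (V.span ?U) (pattern_algebra n R)" by (rule V.span_is_submodule[OF U])
  have "X \<in> V.span ?U" if X: "X \<in> carrier (pattern_algebra n R)" for X
  proof -
    define P where "P S = mat n n (\<lambda>ij. if ij \<in> S then X $$ ij else 0)" for S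
    have "P S \<in> V.span ?U" if "finite S" "S \<subseteq> R \<inter> {..<n} \<times> {..<n}" for S
      using that
    proof (induction S rule: finite_induct)
      case empty
      have "P {} = 0\<^sub>m n n" by (auto simp: P_def)
      then show ?case using submodule.zero_closed[OF sub] by simp
    next
      case (insert s S)
      obtain i j where s: "s = (i, j)" by force
      have eq: "P (insert s S) = X $$ (i, j) \<cdot>\<^sub>m mat_unit n i j + P S"
        using insert by (intro eq_matI) (auto simp: P_def mat_unit_def s)
      have "mat_unit n i j \<in> ?U" using insert.prems by (auto simp: s)
      then have u: "mat_unit n i j \<in> V.span ?U" using V.in_own_span[OF U] by blast
      have p: "P S \<in> V.span ?U" using insert.IH insert.prems by blast
      have "X $$ (i, j) \<cdot>\<^sub>m mat_unit n i j \<in> V.span ?U"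
        using submodule.smult_closed[OF sub _ u, of "X $$ (i, j)"] by simp
      from submodule.m_closed[OF sub this p] show ?case
        by (simp add: eq)
    qed
    then have "P (R \<inter> {..<n} \<times> {..<n}) \<in> V.span ?U" by (simp add: finite_Int)
    moreover have "P (R \<inter> {..<n} \<times> {..<n}) = X"
      using X by (intro eq_matI) (auto simp: P_def)
    ultimately show ?thesis by simp
  qed
  then have "V.gen_set ?U" by (intro subset_antisym subsetI V.span_is_subset2[OF U])
  moreover have "finite ?U" by (simp add: finite_Int)
  ultimately show ?thesis unfolding V.fin_dim_def using U by (intro exI[of _ ?U] conjI)
qed

lemma fd_cstar_pattern_algebra:
  assumes R: "refl R" "trans R" "sym R" and n: "n \<noteq> 0"
  shows "fd_cstar_algebra (pattern_algebra n R)"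
  unfolding fd_cstar_algebra_def
proof (intro conjI)
  have "(1\<^sub>m n :: complex mat) $$ (0, 0) \<noteq> 0\<^sub>m n n $$ (0, 0)" using n by simp
  then have "1\<^sub>m n \<noteq> (0\<^sub>m n n :: complex mat)" by metis
  moreover have "1\<^sub>m n \<in> carrier (pattern_algebra n R)" using R by (auto simp: refl_on_def)
  ultimately show "carrier (pattern_algebra n R) \<noteq> {\<zero>\<^bsub>pattern_algebra n R\<^esub>}" by auto
  show "\<exists>N. cstar_norm (pattern_algebra n R) N"
    by (rule exI[of _ "opnorm n"])
      (auto simp: cstar_norm_def opnorm_nonneg opnorm_eq_0 opnorm_smult opnorm_add opnorm_mult opnorm_cstar)
  show "\<forall>x\<in>carrier (pattern_algebra n R). adj (pattern_algebra n R) x \<in> carrier (pattern_algebra n R) \<and>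
      adj (pattern_algebra n R) (adj (pattern_algebra n R) x) = x"
  proof -
    have "(j, i) \<notin> R" if "(i, j) \<notin> R" for i j using symD[OF R(3)] that by blast
    then show ?thesis by auto
  qed
  show "ring (pattern_algebra n R)" "vectorspace class_ring (pattern_algebra n R)"
    "vectorspace.fin_dim class_ring (pattern_algebra n R)"
    using R by (simp_all add: ring_pattern_algebra vectorspace_pattern_algebra fin_dim_pattern_algebra)
  have C: "X \<in> carrier_mat n n" if "X \<in> carrier (pattern_algebra n R)" for X using that by simp
  show "\<forall>c. \<forall>x\<in>carrier (pattern_algebra n R). \<forall>y\<in>carrier (pattern_algebra n R).
      (c \<odot>\<^bsub>pattern_algebra n R\<^esub> x) \<otimes>\<^bsub>pattern_algebra n R\<^esub> y = c \<odot>\<^bsub>pattern_algebra n R\<^esub> (x \<otimes>\<^bsub>pattern_algebra n R\<^esub> y) \<and>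
      x \<otimes>\<^bsub>pattern_algebra n R\<^esub> (c \<odot>\<^bsub>pattern_algebra n R\<^esub> y) = c \<odot>\<^bsub>pattern_algebra n R\<^esub> (x \<otimes>\<^bsub>pattern_algebra n R\<^esub> y)"
    unfolding pattern_algebra_simps(2,6)
    using mult_smult_assoc_mat[OF C C] mult_smult_distrib[OF C C] by blast
  show "\<forall>x\<in>carrier (pattern_algebra n R). \<forall>y\<in>carrier (pattern_algebra n R).
        adj (pattern_algebra n R) (x \<oplus>\<^bsub>pattern_algebra n R\<^esub> y) = adj (pattern_algebra n R) x \<oplus>\<^bsub>pattern_algebra n R\<^esub> adj (pattern_algebra n R) y \<and>
        adj (pattern_algebra n R) (x \<otimes>\<^bsub>pattern_algebra n R\<^esub> y) = adj (pattern_algebra n R) y \<otimes>\<^bsub>pattern_algebra n R\<^esub> adj (pattern_algebra n R) x"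
    unfolding pattern_algebra_simps(2,5,7)
    using adjoint_add[OF C C] adjoint_mult[OF C C] by blast
  show "\<forall>c. \<forall>x\<in>carrier (pattern_algebra n R). adj (pattern_algebra n R) (c \<odot>\<^bsub>pattern_algebra n R\<^esub> x) =
      cnj c \<odot>\<^bsub>pattern_algebra n R\<^esub> adj (pattern_algebra n R) x"
    by (simp add: adjoint_smult)
qed

section \<open>Transmittable algebras of Kraus maps\<close>

lemma star_hom_comp: "f \<in> star_hom A B \<Longrightarrow> g \<in> star_hom B C \<Longrightarrow> g \<circ> f \<in> star_hom A C"
  by (auto simp: star_hom_def Pi_iff)

lemma star_hom_restrict: "f \<in> star_hom A B \<Longrightarrow> f \<in> star_hom A (B\<lparr>carrier := f ` carrier A\<rparr>)"
  by (auto simp: star_hom_def)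

lemma star_homD:
  assumes "f \<in> star_hom A B"
  shows "x \<in> carrier A \<Longrightarrow> f x \<in> carrier B"
    "x \<in> carrier A \<Longrightarrow> y \<in> carrier A \<Longrightarrow> f (x \<oplus>\<^bsub>A\<^esub> y) = f x \<oplus>\<^bsub>B\<^esub> f y"
    "x \<in> carrier A \<Longrightarrow> y \<in> carrier A \<Longrightarrow> f (x \<otimes>\<^bsub>A\<^esub> y) = f x \<otimes>\<^bsub>B\<^esub> f y"
    "x \<in> carrier A \<Longrightarrow> f (c \<odot>\<^bsub>A\<^esub> x) = c \<odot>\<^bsub>B\<^esub> f x"
    "x \<in> carrier A \<Longrightarrow> f (adj A x) = adj B (f x)"
  using assms unfolding star_hom_def by blast+

lemma star_hom_zero:
  assumes h: "h \<in> star_hom (pattern_algebra n R) (op_algebra k)"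
  shows "h (0\<^sub>m n n) = 0\<^sub>m k k"
proof -
  have z: "0\<^sub>m n n \<in> carrier (pattern_algebra n R)" by simp
  have hz: "h (0\<^sub>m n n) \<in> carrier_mat k k" using star_homD(1)[OF h z] by simp
  have "h (0\<^sub>m n n) = h (0 \<cdot>\<^sub>m 0\<^sub>m n n)" by simp
  also have "\<dots> = 0 \<cdot>\<^sub>m h (0\<^sub>m n n)" using star_homD(4)[OF h z] by (simp only: pattern_algebra_simps op_algebra_simps)
  also have "\<dots> = 0\<^sub>m k k" by (rule eq_matI) (use hz in auto)
  finally show ?thesis .
qed

text \<open>The representation \<open>\<rho>\<close> is the given embedding followed by compression
  to the code space. In this form transmittability becomes a statement about a concrete matrix
  algebra containing \<open>1\<^sub>m k\<close> and commuting with the effects.\<close>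

lemma transmittable_kraus_map_obtain:
  assumes B: "B \<in> transmittable_algebras n m (kraus_map n m I K)" and I: "finite I"
    and K: "\<And>i. i \<in> I \<Longrightarrow> K i \<in> carrier_mat m n"
  obtains k V \<rho> where "V \<in> carrier_mat n k" "mat_adjoint V * V = 1\<^sub>m k"
    "\<rho> \<in> star_hom B (op_algebra k)" "inj_on \<rho> (carrier B)"
    "star_subalgebra k (\<rho> ` carrier B)" "1\<^sub>m k \<in> \<rho> ` carrier B"
    "\<And>X i \<psi> \<phi>. X \<in> \<rho> ` carrier B \<Longrightarrow> i \<in> I \<Longrightarrow> \<psi> \<in> carrier_vec k \<Longrightarrow> \<phi> \<in> carrier_vec k \<Longrightarrow>
      (K i *\<^sub>v (V *\<^sub>v (X *\<^sub>v \<psi>))) \<bullet>c (K i *\<^sub>v (V *\<^sub>v \<phi>)) = (K i *\<^sub>v (V *\<^sub>v \<psi>)) \<bullet>c (K i *\<^sub>v (V *\<^sub>v (mat_adjoint X *\<^sub>v \<phi>)))"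
proof -
  obtain \<pi> where \<pi>: "\<pi> \<in> star_hom B (op_algebra n)" "inj_on \<pi> (carrier B)"
    and corr: "correctable n m (kraus_map n m I K) (\<pi> ` carrier B)"
    using B by (auto simp: transmittable_algebras_def)
  show ?thesis
  proof (rule correctable_kraus_map_obtain[OF corr I K])
    fix k V assume V: "V \<in> carrier_mat n k" "mat_adjoint V * V = 1\<^sub>m k"
    "star_subalgebra k ((\<lambda>X. mat_adjoint V * X * V) ` \<pi> ` carrier B)"
    "1\<^sub>m k \<in> (\<lambda>X. mat_adjoint V * X * V) ` \<pi> ` carrier B"
    "(\<lambda>X. mat_adjoint V * X * V) \<in> star_hom ((op_algebra n)\<lparr>carrier := \<pi> ` carrier B\<rparr>) (op_algebra k)"
    "inj_on (\<lambda>X. mat_adjoint V * X * V) (\<pi> ` carrier B)"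
    "\<And>X i \<psi> \<phi>. X \<in> (\<lambda>X. mat_adjoint V * X * V) ` \<pi> ` carrier B \<Longrightarrow> i \<in> I \<Longrightarrow> \<psi> \<in> carrier_vec k \<Longrightarrow> \<phi> \<in> carrier_vec k \<Longrightarrow>
      (K i *\<^sub>v (V *\<^sub>v (X *\<^sub>v \<psi>))) \<bullet>c (K i *\<^sub>v (V *\<^sub>v \<phi>)) = (K i *\<^sub>v (V *\<^sub>v \<psi>)) \<bullet>c (K i *\<^sub>v (V *\<^sub>v (mat_adjoint X *\<^sub>v \<phi>)))"
    show ?thesis
    proof (rule that[OF V(1,2) star_hom_comp[OF star_hom_restrict[OF \<pi>(1)] V(5)] comp_inj_on[OF \<pi>(2) V(6)]],
        unfold image_comp[symmetric])
    qed (rule V(3), rule V(4), rule V(7))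
  qed
qed

lemma kraus_map_index:
  assumes X: "X \<in> carrier_mat n n" and K: "\<And>i. i \<in> I \<Longrightarrow> K i \<in> carrier_mat m n" and pq: "p < m" "q < m"
  shows "kraus_map n m I K X $$ (p, q) = (\<Sum>i\<in>I. (K i * X * mat_adjoint (K i)) $$ (p, q))"
  unfolding kraus_map_def using pq
proof (simp, intro sum.cong refl)
  fix i assume i: "i \<in> I"
  show "(\<Sum>a<n. \<Sum>b<n. K i $$ (p, a) * X $$ (a, b) * cnj (K i $$ (q, b))) = (K i * X * mat_adjoint (K i)) $$ (p, q)"
    using K[OF i] X pq by (simp add: scalar_prod_def atLeast0LessThan sum_distrib_right) (rule sum.swap)
qed

lemma kraus_map_comp:
  assumes K: "\<And>i. i \<in> I \<Longrightarrow> K i \<in> carrier_mat m n" and F: "\<And>j. j \<in> J \<Longrightarrow> F j \<in> carrier_mat k m"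
    and X: "X \<in> carrier_mat n n"
  shows "kraus_map m k J F (kraus_map n m I K X) = kraus_map n k (J \<times> I) (\<lambda>(j, i). F j * K i) X"
proof (rule eq_matI)
  fix p q assume "p < dim_row (kraus_map n k (J \<times> I) (\<lambda>(j, i). F j * K i) X)"
    "q < dim_col (kraus_map n k (J \<times> I) (\<lambda>(j, i). F j * K i) X)"
  then have pq: "p < k" "q < k" by (auto simp: kraus_map_def)
  have FK: "(F j * K i) $$ (r, a) = (\<Sum>c<m. F j $$ (r, c) * K i $$ (c, a))" if "j \<in> J" "i \<in> I" "r < k" "a < n" for j i r a
    using that K[OF that(2)] F[OF that(1)] by (simp add: scalar_prod_def atLeast0LessThan)
  let ?f = "\<lambda>j i a b c d. F j $$ (p, c) * K i $$ (c, a) * X $$ (a, b) * (cnj (F j $$ (q, d)) * cnj (K i $$ (d, b)))"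
  have "kraus_map m k J F (kraus_map n m I K X) $$ (p, q) = (\<Sum>j\<in>J. \<Sum>c<m. \<Sum>d<m. \<Sum>i\<in>I. \<Sum>a<n. \<Sum>b<n. ?f j i a b c d)"
    using pq by (auto simp: kraus_map_def sum_distrib_left sum_distrib_right mult_ac intro!: sum.cong)
  also have "\<dots> = (\<Sum>j\<in>J. \<Sum>i\<in>I. \<Sum>a<n. \<Sum>b<n. \<Sum>c<m. \<Sum>d<m. ?f j i a b c d)"
    by (intro sum.cong refl sum_swap_2_3)
  also have "\<dots> = kraus_map n k (J \<times> I) (\<lambda>(j, i). F j * K i) X $$ (p, q)"
    using pq by (auto simp: kraus_map_def sum_Times FK sum_mult_sum intro!: sum.cong)
  finally show "kraus_map m k J F (kraus_map n m I K X) $$ (p, q) = kraus_map n k (J \<times> I) (\<lambda>(j, i). F j * K i) X $$ (p, q)" .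
qed (auto simp: kraus_map_def)

lemma mat_trace_comm:
  assumes "A \<in> carrier_mat n m" "B \<in> carrier_mat m n"
  shows "mat_trace (A * B) = mat_trace (B * A)"
  using assms by (simp add: mat_trace_mult[of _ n m] mat_trace_mult[of _ m n] mult.commute) (rule sum.swap)

text \<open>The factor \<open>V^* V = 1\<close> cancels between neighbours, which makes conjugation
  by \<open>V\<close> multiplicative, and it also gives the left inverse. This is the encoding step
  of every code constructed below.\<close>

lemma isometry_star_subalgebra:
  assumes V: "V \<in> carrier_mat n k" "mat_adjoint V * V = 1\<^sub>m k" and k: "k \<noteq> 0"
    and R: "refl R" "trans R" "sym R"
  defines "\<pi> \<equiv> \<lambda>X. V * X * mat_adjoint V"
  shows "\<pi> \<in> star_hom (pattern_algebra k R) (op_algebra n)"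
    and "X \<in> carrier_mat k k \<Longrightarrow> mat_adjoint V * \<pi> X * V = X"
    and "inj_on \<pi> (carrier (pattern_algebra k R))"
    and "star_subalgebra n (\<pi> ` carrier (pattern_algebra k R))"
proof -
  have Va: "mat_adjoint V \<in> carrier_mat k n" using V by simp
  have VX: "V * X \<in> carrier_mat n k" if "X \<in> carrier_mat k k" for X using V that by simp
  have \<pi>c: "\<pi> X \<in> carrier_mat n n" if "X \<in> carrier_mat k k" for X
    unfolding \<pi>_def by (rule mult_carrier_mat[OF VX[OF that] Va])
  have VV: "mat_adjoint V * (V * X) = X" if X: "X \<in> carrier_mat k m" for X m
    using assoc_mult_mat[OF Va V(1) X] V(2) X by simp
  have expand: "mat_adjoint V * \<pi> X * V = X" if X: "X \<in> carrier_mat k k" for X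
  proof -
    have "mat_adjoint V * \<pi> X = X * mat_adjoint V"
      unfolding \<pi>_def assoc_mult_mat[OF V(1) X Va] using X Va by (intro VV) auto
    then show ?thesis using assoc_mult_mat[OF X Va V(1)] V(2) X by simp
  qed
  have mult: "\<pi> (X * Y) = \<pi> X * \<pi> Y" if X: "X \<in> carrier_mat k k" and Y: "Y \<in> carrier_mat k k" for X Y
  proof -
    have XV: "X * mat_adjoint V \<in> carrier_mat k n" "Y * mat_adjoint V \<in> carrier_mat k n" using X Y Va by auto
    have "\<pi> X * \<pi> Y = V * (X * mat_adjoint V) * \<pi> Y" unfolding \<pi>_def assoc_mult_mat[OF V(1) X Va] ..
    also have "\<dots> = V * (X * mat_adjoint V * \<pi> Y)" by (rule assoc_mult_mat[OF V(1) XV(1) \<pi>c[OF Y]])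
    also have "X * mat_adjoint V * \<pi> Y = X * (mat_adjoint V * \<pi> Y)" by (rule assoc_mult_mat[OF X Va \<pi>c[OF Y]])
    also have "mat_adjoint V * \<pi> Y = Y * mat_adjoint V"
      unfolding \<pi>_def assoc_mult_mat[OF V(1) Y Va] using XV(2) by (intro VV)
    also have "X * (Y * mat_adjoint V) = X * Y * mat_adjoint V" by (rule assoc_mult_mat[OF X Y Va, symmetric])
    also have "V * (X * Y * mat_adjoint V) = \<pi> (X * Y)"
      unfolding \<pi>_def using X Y by (intro assoc_mult_mat[OF V(1) _ Va, symmetric]) simp
    finally show ?thesis by simp
  qed
  have add: "\<pi> (X + Y) = \<pi> X + \<pi> Y" if X: "X \<in> carrier_mat k k" and Y: "Y \<in> carrier_mat k k" for X Y
    unfolding \<pi>_def mult_add_distrib_mat[OF V(1) X Y] by (rule add_mult_distrib_mat[OF VX[OF X] VX[OF Y] Va])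
  have smult: "\<pi> (c \<cdot>\<^sub>m X) = c \<cdot>\<^sub>m \<pi> X" if X: "X \<in> carrier_mat k k" for X c
    unfolding \<pi>_def mult_smult_distrib[OF V(1) X] by (rule mult_smult_assoc_mat[OF VX[OF X] Va])
  have star: "\<pi> (mat_adjoint X) = mat_adjoint (\<pi> X)" if X: "X \<in> carrier_mat k k" for X
    unfolding \<pi>_def adjoint_mult[OF VX[OF X] Va] adjoint_mult[OF V(1) X] adjoint_adjoint
    by (rule assoc_mult_mat[OF V(1) adjoint_carrier[OF X] Va])
  show hom: "\<pi> \<in> star_hom (pattern_algebra k R) (op_algebra n)"
  proof -
    have C: "X \<in> carrier_mat k k" if "X \<in> carrier (pattern_algebra k R)" for X using that by simp
    show ?thesis
      unfolding star_hom_def Pi_iff pattern_algebra_simps(2-) op_algebra_simps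
      by (intro CollectI conjI ballI allI \<pi>c[OF C] add[OF C C] mult[OF C C] smult[OF C] star[OF C])
  qed
  show "X \<in> carrier_mat k k \<Longrightarrow> mat_adjoint V * \<pi> X * V = X" by (rule expand)
  show inj: "inj_on \<pi> (carrier (pattern_algebra k R))"
    by (rule inj_on_inverseI[of _ "\<lambda>X. mat_adjoint V * X * V"]) (auto intro: expand)
  let ?S = "\<pi> ` carrier (pattern_algebra k R)"
  have z: "\<pi> (0\<^sub>m k k) = 0\<^sub>m n n" using star_hom_zero[OF hom] .
  show "star_subalgebra n ?S"
    unfolding star_subalgebra_def
  proof (intro conjI ballI allI)
    show "?S \<subseteq> carrier_mat n n" using \<pi>c by auto
    show "0\<^sub>m n n \<in> ?S" using z by (intro image_eqI[of _ _ "0\<^sub>m k k"]) auto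
    show "?S \<noteq> {0\<^sub>m n n}"
    proof
      assume S: "?S = {0\<^sub>m n n}"
      have "1\<^sub>m k \<in> carrier (pattern_algebra k R)" using R by (auto simp: refl_on_def)
      then have "\<pi> (1\<^sub>m k) \<in> {0\<^sub>m n n}" unfolding S[symmetric] by (rule imageI)
      then have "\<pi> (1\<^sub>m k) = \<pi> (0\<^sub>m k k)" unfolding z by (rule singletonD)
      then have "mat_adjoint V * \<pi> (1\<^sub>m k) * V = mat_adjoint V * \<pi> (0\<^sub>m k k) * V" by (rule arg_cong)
      then have "(1\<^sub>m k :: complex mat) = 0\<^sub>m k k"
        unfolding expand[OF one_carrier_mat] expand[OF zero_carrier_mat] .
      then have "(1\<^sub>m k :: complex mat) $$ (0, 0) = 0\<^sub>m k k $$ (0, 0)" by simp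
      then show False using k by simp
    qed
    fix X assume "X \<in> ?S"
    then obtain X' where X: "X' \<in> carrier (pattern_algebra k R)" "X = \<pi> X'" by blast
    have X': "X' \<in> carrier_mat k k" using X(1) by simp
    have Rs: "(j, i) \<notin> R" if "(i, j) \<notin> R" for i j
      using that by (rule contrapos_nn) (rule symD[OF R(3)])
    have "mat_adjoint X' \<in> carrier (pattern_algebra k R)" "c \<cdot>\<^sub>m X' \<in> carrier (pattern_algebra k R)" for c
      using X(1) Rs by auto
    from this[THEN imageI, of \<pi>] show "mat_adjoint X \<in> ?S" "c \<cdot>\<^sub>m X \<in> ?S" for c
      unfolding X(2) star[OF X', symmetric] smult[OF X', symmetric] .
    fix Y assume "Y \<in> ?S"
    then obtain Y' where Y: "Y' \<in> carrier (pattern_algebra k R)" "Y = \<pi> Y'" by blast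
    have Y': "Y' \<in> carrier_mat k k" using Y(1) by simp
    have "X' + Y' \<in> carrier (pattern_algebra k R)"
      using ring.ring_simprules(1)[OF ring_pattern_algebra[OF R(1,2)] X(1) Y(1)]
      unfolding pattern_algebra_simps(5) .
    then show "X + Y \<in> ?S"
      unfolding X(2) Y(2) add[OF X' Y', symmetric] by (rule imageI)
    show "X * Y \<in> ?S"
      using pattern_mult[OF R(2) X(1) Y(1)] unfolding X(2) Y(2) mult[OF X' Y', symmetric] by (intro imageI)
  qed
qed

text \<open>The Kraus operators of \<open>D \<circ> \<Phi>|\<^sub>C\<close> lie in the commutant of \<open>A\<close>, hence \<open>(D \<circ> \<Phi>|\<^sub>C)\<^sup>*\<close> fixes \<open>A\<close> pointwise.\<close>

lemma pattern_algebra_transmittable: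
  assumes ch: "quantum_channel n m (kraus_map n m I K)" "quantum_channel m k (kraus_map m k J F)"
    and K: "\<And>i. i \<in> I \<Longrightarrow> K i \<in> carrier_mat m n" and F: "\<And>j. j \<in> J \<Longrightarrow> F j \<in> carrier_mat k m"
    and V: "V \<in> carrier_mat n k" "mat_adjoint V * V = 1\<^sub>m k" and k: "k \<noteq> 0"
    and R: "refl R" "trans R" "sym R"
    and comm: "\<And>i j X. i \<in> I \<Longrightarrow> j \<in> J \<Longrightarrow> X \<in> carrier (pattern_algebra k R) \<Longrightarrow>
      X * (F j * (K i * V)) = F j * (K i * V) * X"
  shows "pattern_algebra k R \<in> transmittable_algebras n m (kraus_map n m I K)"
proof -
  define \<pi> where "\<pi> = (\<lambda>X. V * X * mat_adjoint V)"
  note iso = isometry_star_subalgebra[OF V k R, folded \<pi>_def]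
  have Va: "mat_adjoint V \<in> carrier_mat k n" using V by simp
  let ?D = "kraus_map m k J F"
  let ?\<Phi> = "\<lambda>Y. kraus_map n m I K (V * Y * mat_adjoint V)"
  have \<pi>c: "\<pi> X \<in> carrier_mat n n" if "X \<in> carrier_mat k k" for X
    unfolding \<pi>_def by (rule mult_carrier_mat[OF mult_carrier_mat[OF V(1) that] Va])
  have KV: "K i * V \<in> carrier_mat m k" if "i \<in> I" for i by (rule mult_carrier_mat[OF K[OF that] V(1)])
  define M where "M = (\<lambda>(j, i). F j * (K i * V))"
  have Mc: "M x \<in> carrier_mat k k" if "x \<in> J \<times> I" for x
    using that mult_carrier_mat[OF F KV] by (auto simp: M_def)
  have E: "(?D \<circ> ?\<Phi>) Y = kraus_map k k (J \<times> I) M Y" if "Y \<in> carrier_mat k k" for Y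
    using kraus_map_compress[of V n k I K m Y, OF V(1) K that]
      kraus_map_comp[of I "\<lambda>i. K i * V" m k J F k Y, OF KV F that]
    by (simp add: M_def)
  have tr: "mat_trace ((?D \<circ> ?\<Phi>) Y) = mat_trace Y" if Y: "Y \<in> carrier_mat k k" for Y
  proof -
    have "mat_trace ((?D \<circ> ?\<Phi>) Y) = mat_trace (V * Y * mat_adjoint V)"
      using ch \<pi>c[OF Y] by (simp add: quantum_channel_def \<pi>_def)
    also have "\<dots> = mat_trace (mat_adjoint V * (V * Y))"
      using V Y by (intro mat_trace_comm[OF _ Va]) auto
    also have "mat_adjoint V * (V * Y) = Y"
      using assoc_mult_mat[OF Va V(1) Y] V(2) Y by simp
    finally show ?thesis .
  qed
  have fixed: "adjoint_map k (?D \<circ> ?\<Phi>) X = X" if X: "X \<in> carrier (pattern_algebra k R)" for X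
  proof -
    have Xc: "X \<in> carrier_mat k k" using X by simp
    \<comment> \<open>Writing \<open>E\<close> for the composite, \<open>X\<close> passes through
      the left factor of each Kraus term, so \<open>X * E Z\<close> and \<open>E (X * Z)\<close>
      have the same diagonal. Trace preservation of \<open>E\<close> then removes
      \<open>E\<close>.\<close>
    have "mat_trace (X * kraus_map k k (J \<times> I) M Z) = mat_trace (X * Z)" if Z: "Z \<in> carrier_mat k k" for Z
    proof -
      have XZ: "X * Z \<in> carrier_mat k k" using Xc Z by simp
      have MM: "X * (M x * Z * mat_adjoint (M x)) = M x * (X * Z) * mat_adjoint (M x)" if x: "x \<in> J \<times> I" for x
      proof -
        note Mx = Mc[OF x] adjoint_carrier[OF Mc[OF x]]
        have MZ: "M x * Z \<in> carrier_mat k k" using Mx Z by simp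
        have "X * (M x * Z * mat_adjoint (M x)) = X * (M x * Z) * mat_adjoint (M x)"
          by (rule assoc_mult_mat[OF Xc MZ Mx(2), symmetric])
        also have "X * (M x * Z) = X * M x * Z" by (rule assoc_mult_mat[OF Xc Mx(1) Z, symmetric])
        also have "X * M x = M x * X" using x comm X by (auto simp: M_def)
        also have "M x * X * Z = M x * (X * Z)" by (rule assoc_mult_mat[OF Mx(1) Xc Z])
        finally show ?thesis .
      qed
      have "(X * kraus_map k k (J \<times> I) M Z) $$ (p, p) = kraus_map k k (J \<times> I) M (X * Z) $$ (p, p)" if p: "p < k" for p
      proof -
        have "(X * kraus_map k k (J \<times> I) M Z) $$ (p, p) = (\<Sum>q<k. X $$ (p, q) * (\<Sum>x\<in>J \<times> I. (M x * Z * mat_adjoint (M x)) $$ (q, p)))"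
          using Xc p carrier_matD[OF kraus_map_carrier[of k k "J \<times> I" M Z]]
          by (simp add: scalar_prod_def atLeast0LessThan kraus_map_index[OF Z Mc])
        also have "\<dots> = (\<Sum>x\<in>J \<times> I. \<Sum>q<k. X $$ (p, q) * (M x * Z * mat_adjoint (M x)) $$ (q, p))"
          unfolding sum_distrib_left by (rule sum.swap)
        also have "\<dots> = (\<Sum>x\<in>J \<times> I. (X * (M x * Z * mat_adjoint (M x))) $$ (p, p))"
          using Xc Z p carrier_matD[OF Mc]
          by (intro sum.cong refl) (simp add: scalar_prod_def[of "row X p"] atLeast0LessThan)
        also have "\<dots> = kraus_map k k (J \<times> I) M (X * Z) $$ (p, p)"
          using kraus_map_index[of "X * Z" k "J \<times> I" M k p p, OF XZ Mc p p] by (simp only: MM cong: sum.cong)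
        finally show ?thesis .
      qed
      then have "mat_trace (X * kraus_map k k (J \<times> I) M Z) = mat_trace (kraus_map k k (J \<times> I) M (X * Z))"
        using Xc carrier_matD[OF kraus_map_carrier[of k k "J \<times> I" M]] by (simp add: mat_trace_def)
      then show ?thesis using tr[OF XZ] E[OF XZ] by simp
    qed
    then have "adjoint_map k (kraus_map k k (J \<times> I) M) X = X"
      using adjoint_map_fixed_iff[OF linear_kraus_map Xc] by blast
    then show ?thesis using adjoint_map_cong[of k "?D \<circ> ?\<Phi>" "kraus_map k k (J \<times> I) M" X, OF E] by simp
  qed
  let ?S = "\<pi> ` carrier (pattern_algebra k R)"
  have one: "1\<^sub>m k \<in> carrier (pattern_algebra k R)" using R by (auto simp: refl_on_def)
  have unit: "\<pi> (1\<^sub>m k) * X = X \<and> X * \<pi> (1\<^sub>m k) = X" if XS: "X \<in> ?S" for X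
  proof -
    obtain X' where X: "X' \<in> carrier (pattern_algebra k R)" "X = \<pi> X'" using XS by blast
    have "1\<^sub>m k * X' = X'" "X' * 1\<^sub>m k = X'" using X(1) by auto
    then show ?thesis
      using star_homD(3)[OF iso(1) one X(1)] star_homD(3)[OF iso(1) X(1) one]
      unfolding X(2) pattern_algebra_simps(2) op_algebra_simps(2) by simp
  qed
  have "correctable n m (kraus_map n m I K) ?S"
    unfolding correctable_def
  proof (rule conjI[OF iso(4)], rule bexI[of _ "\<pi> (1\<^sub>m k)"], rule conjI)
    show "\<forall>X\<in>?S. \<pi> (1\<^sub>m k) * X = X \<and> X * \<pi> (1\<^sub>m k) = X" using unit by blast
    have "V * mat_adjoint V = \<pi> (1\<^sub>m k)" using V(1) by (simp add: \<pi>_def)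
    moreover have "\<forall>X\<in>(\<lambda>X. mat_adjoint V * X * V) ` ?S. adjoint_map k (?D \<circ> ?\<Phi>) X = X"
    proof
      fix X assume "X \<in> (\<lambda>X. mat_adjoint V * X * V) ` ?S"
      then obtain X' where X: "X' \<in> carrier (pattern_algebra k R)" "X = mat_adjoint V * \<pi> X' * V" by blast
      then have "X = X'" using iso(2)[of X'] by (simp add: \<pi>_def)
      then show "adjoint_map k (?D \<circ> ?\<Phi>) X = X" using fixed[OF X(1)] by simp
    qed
    ultimately show "\<exists>l. \<exists>V\<in>carrier_mat n l. mat_adjoint V * V = 1\<^sub>m l \<and> V * mat_adjoint V = \<pi> (1\<^sub>m k) \<and>
       (\<exists>D. quantum_channel m l D \<and> (\<forall>X\<in>(\<lambda>X. mat_adjoint V * X * V) ` ?S.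
          adjoint_map l (D \<circ> (\<lambda>Y. kraus_map n m I K (V * Y * mat_adjoint V))) X = X))"
      using V ch(2) by blast
    show "\<pi> (1\<^sub>m k) \<in> ?S" using one by (rule imageI)
  qed
  then show ?thesis
    unfolding transmittable_algebras_def using fd_cstar_pattern_algebra[OF R k] iso(1,3) by blast
qed

lemma transmittable_algebras_cong:
  assumes "\<And>X. X \<in> carrier_mat n n \<Longrightarrow> \<Phi> X = \<Psi> X"
  shows "transmittable_algebras n m \<Phi> = transmittable_algebras n m \<Psi>"
proof -
  have "adjoint_map k (D \<circ> (\<lambda>Y. \<Phi> (V * Y * mat_adjoint V))) = adjoint_map k (D \<circ> (\<lambda>Y. \<Psi> (V * Y * mat_adjoint V)))"
    if "V \<in> carrier_mat n k" for k D V
    using assms[OF mult_carrier_mat[OF mult_carrier_mat[OF that] adjoint_carrier[OF that]]]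
    by (intro ext adjoint_map_cong) simp
  then have "correctable n m \<Phi> = correctable n m \<Psi>"
    by (intro ext) (simp add: correctable_def cong: bex_cong conj_cong)
  then show ?thesis by (simp add: transmittable_algebras_def)
qed

section \<open>Measurement channels\<close>

text \<open>The rank-one operator \<open>e_l a_l^*\<close>, with \<open>a_l^*\<close> the row
  \<open>l\<close> of \<open>A\<close>: the outcome is recorded in a basis vector of the output
  space.\<close>

definition measure_op :: "nat \<Rightarrow> nat \<Rightarrow> complex mat \<Rightarrow> nat \<Rightarrow> complex mat" where
  "measure_op N d A l = mat N d (\<lambda>(p, a). if p = l then A $$ (l, a) else 0)"

lemma measure_op_carrier [simp]: "measure_op N d A l \<in> carrier_mat N d"
  by (simp add: measure_op_def)

lemma quantum_channel_measure:
  assumes "\<And>a b. a < d \<Longrightarrow> b < d \<Longrightarrow> (\<Sum>l<N. cnj (A $$ (l, a)) * A $$ (l, b)) = (if a = b then 1 else 0)"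
  shows "quantum_channel d N (kraus_map d N {..<N} (measure_op N d A))"
proof (rule quantum_channel_kraus_map)
  fix a b assume ab: "a < d" "b < d"
  have "(\<Sum>p<N. cnj (measure_op N d A l $$ (p, a)) * measure_op N d A l $$ (p, b)) = cnj (A $$ (l, a)) * A $$ (l, b)"
    if "l < N" for l
    using that ab by (subst sum_eq_single[of l]) (auto simp: measure_op_def)
  then show "(\<Sum>l<N. \<Sum>p<N. cnj (measure_op N d A l $$ (p, a)) * measure_op N d A l $$ (p, b)) = (if a = b then 1 else 0)"
    using assms[OF ab] by simp
qed simp

text \<open>
  The unnormalised state of \<open>\<complex>\<^sup>f\<close> that outcome \<open>l\<close> of the measurement of the first factor of \<open>\<complex>\<^sup>d \<otimes> \<complex>\<^sup>f\<close> leaves; the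
  rows of \<open>A\<close> are the \<open>a\<^sub>l\<^sup>*\<close>. For \<open>f = 1\<close> this is the amplitude of the outcome.
\<close>

definition residual :: "nat \<Rightarrow> nat \<Rightarrow> complex mat \<Rightarrow> complex vec \<Rightarrow> nat \<Rightarrow> nat \<Rightarrow> complex" where
  "residual d f A u l t = (\<Sum>a<d. A $$ (l, a) * u $ (a * f + t))"

lemma measure_op_kron_vec:
  assumes u: "u \<in> carrier_vec (d * f)" and p: "p < N" "t < f"
  shows "(kron (measure_op N d A l) (1\<^sub>m f) *\<^sub>v u) $ (p * f + t) = (if p = l then residual d f A u l t else 0)"
proof -
  have lt: "p * f + t < N * f" using index_product_less p by blast
  have k: "kron (measure_op N d A l) (1\<^sub>m f) $$ (p * f + t, a * f + s) = (if p = l \<and> t = s then A $$ (l, a) else 0)"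
    if "a < d" "s < f" for a s
    using p that lt index_product_less[OF that] by (simp add: kron_def measure_op_def)
  have "(kron (measure_op N d A l) (1\<^sub>m f) *\<^sub>v u) $ (p * f + t) =
     (\<Sum>b<d * f. kron (measure_op N d A l) (1\<^sub>m f) $$ (p * f + t, b) * u $ b)"
    using lt u by (simp add: kron_def measure_op_def scalar_prod_def atLeast0LessThan)
  also have "\<dots> = (\<Sum>a<d. \<Sum>s<f. kron (measure_op N d A l) (1\<^sub>m f) $$ (p * f + t, a * f + s) * u $ (a * f + s))"
    by (rule sum_product_index)
  also have "\<dots> = (\<Sum>a<d. if p = l then A $$ (l, a) * u $ (a * f + t) else 0)"
    by (intro sum.cong refl, subst sum_eq_single[of t]) (use p in \<open>auto simp: k\<close>)
  finally show ?thesis by (simp add: residual_def)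
qed

lemma measure_op_kron_cscalar:
  assumes u: "u \<in> carrier_vec (d * f)" and v: "v \<in> carrier_vec (d * f)" and l: "l < N"
  shows "(kron (measure_op N d A l) (1\<^sub>m f) *\<^sub>v u) \<bullet>c (kron (measure_op N d A l) (1\<^sub>m f) *\<^sub>v v) =
    (\<Sum>t<f. residual d f A u l t * cnj (residual d f A v l t))"
proof -
  have K: "kron (measure_op N d A l) (1\<^sub>m f) \<in> carrier_mat (N * f) (d * f)"
    by (simp add: kron_def measure_op_def)
  have "(kron (measure_op N d A l) (1\<^sub>m f) *\<^sub>v u) \<bullet>c (kron (measure_op N d A l) (1\<^sub>m f) *\<^sub>v v) =
     (\<Sum>p<N. \<Sum>t<f. (kron (measure_op N d A l) (1\<^sub>m f) *\<^sub>v u) $ (p * f + t) *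
        cnj ((kron (measure_op N d A l) (1\<^sub>m f) *\<^sub>v v) $ (p * f + t)))"
    by (subst cscalar_sum[OF mult_mat_vec_carrier[OF K u] mult_mat_vec_carrier[OF K v]]) (rule sum_product_index)
  also have "\<dots> = (\<Sum>t<f. residual d f A u l t * cnj (residual d f A v l t))"
    using l by (subst sum_eq_single[of l]) (auto simp: measure_op_kron_vec u v)
  finally show ?thesis .
qed

lemma measure_op_cscalar:
  assumes "u \<in> carrier_vec d" "v \<in> carrier_vec d" "l < N"
  shows "(measure_op N d A l *\<^sub>v u) \<bullet>c (measure_op N d A l *\<^sub>v v) = residual d 1 A u l 0 * cnj (residual d 1 A v l 0)"
proof -
  have "(measure_op N d A l *\<^sub>v x) $ p = (if p = l then residual d 1 A x l 0 else 0)" if "p < N" "x \<in> carrier_vec d" for p x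
    using that by (auto simp: measure_op_def residual_def scalar_prod_def atLeast0LessThan)
  moreover have "measure_op N d A l *\<^sub>v x \<in> carrier_vec N" if "x \<in> carrier_vec d" for x
    using mult_mat_vec_carrier[OF measure_op_carrier that] .
  ultimately show ?thesis
    using assms by (subst cscalar_sum[of _ N], simp, simp, subst sum_eq_single[of l]) auto
qed

text \<open>Indistinguishability in contrapositive form. This is the shape in which commutation with
  the effects supplies it, as a product of two amplitudes that vanishes at every outcome.\<close>

definition confusing :: "nat \<Rightarrow> nat \<Rightarrow> complex mat \<Rightarrow> bool" where
  "confusing N d A \<longleftrightarrow> (\<forall>\<phi>\<in>carrier_vec d. \<forall>\<psi>\<in>carrier_vec d.
     (\<forall>l<N. residual d 1 A \<phi> l 0 = 0 \<or> residual d 1 A \<psi> l 0 = 0) \<longrightarrow> \<phi> = 0\<^sub>v d \<or> \<psi> = 0\<^sub>v d)"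

lemma isometry_vec_nonzero:
  fixes V :: "complex mat"
  assumes V: "V \<in> carrier_mat n k" "mat_adjoint V * V = 1\<^sub>m k" and v: "v \<in> carrier_vec k" "v \<noteq> 0\<^sub>v k"
  shows "V *\<^sub>v v \<noteq> 0\<^sub>v n"
proof
  assume "V *\<^sub>v v = 0\<^sub>v n"
  then have "mat_adjoint V *\<^sub>v (V *\<^sub>v v) = 0\<^sub>v k" using V(1) by (auto intro!: eq_vecI)
  then show False
    using assoc_mult_mat_vec[OF adjoint_carrier[OF V(1)] V(1) v(1)] V(2) v by simp
qed

lemma confusing_imp_trivial:
  assumes A: "confusing N d A" and B: "B \<in> transmittable_algebras d N (kraus_map d N {..<N} (measure_op N d A))"
  shows "embeds B (op_algebra 1)"
proof (rule transmittable_kraus_map_obtain[OF B])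
  fix k V \<rho> assume V: "V \<in> carrier_mat d k" "mat_adjoint V * V = 1\<^sub>m k"
    and \<rho>: "\<rho> \<in> star_hom B (op_algebra k)" "inj_on \<rho> (carrier B)"
    and S: "star_subalgebra k (\<rho> ` carrier B)" "1\<^sub>m k \<in> \<rho> ` carrier B"
    and comm: "\<And>X i \<psi> \<phi>. X \<in> \<rho> ` carrier B \<Longrightarrow> i \<in> {..<N} \<Longrightarrow> \<psi> \<in> carrier_vec k \<Longrightarrow> \<phi> \<in> carrier_vec k \<Longrightarrow>
      (measure_op N d A i *\<^sub>v (V *\<^sub>v (X *\<^sub>v \<psi>))) \<bullet>c (measure_op N d A i *\<^sub>v (V *\<^sub>v \<phi>)) =
      (measure_op N d A i *\<^sub>v (V *\<^sub>v \<psi>)) \<bullet>c (measure_op N d A i *\<^sub>v (V *\<^sub>v (mat_adjoint X *\<^sub>v \<phi>)))"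
  note D = star_subalgebraD[OF S(1)]
  have Vc: "V *\<^sub>v x \<in> carrier_vec d" if "x \<in> carrier_vec k" for x by (rule mult_mat_vec_carrier[OF V(1) that])
  have scalar: "\<exists>c. X = c \<cdot>\<^sub>m 1\<^sub>m k" if X: "X \<in> \<rho> ` carrier B" for X
  proof (rule ccontr)
    assume "\<nexists>c. X = c \<cdot>\<^sub>m 1\<^sub>m k"
    then obtain Y \<psi> \<chi> where Y: "Y \<in> \<rho> ` carrier B" and c: "\<psi> \<in> carrier_vec k" "\<chi> \<in> carrier_vec k"
      and nz: "\<psi> \<noteq> 0\<^sub>v k" "Y *\<^sub>v \<chi> \<noteq> 0\<^sub>v k" and z: "mat_adjoint Y *\<^sub>v \<psi> = 0\<^sub>v k"
      using star_subalgebra_nonscalar[OF S X] by metis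
    have Yc: "Y *\<^sub>v \<chi> \<in> carrier_vec k" by (rule mult_mat_vec_carrier[OF D(1)[OF Y] c(2)])
    have V0: "V *\<^sub>v 0\<^sub>v k = 0\<^sub>v d" using V(1) by (intro eq_vecI) auto
    have "residual d 1 A (V *\<^sub>v \<psi>) l 0 = 0 \<or> residual d 1 A (V *\<^sub>v (Y *\<^sub>v \<chi>)) l 0 = 0" if l: "l < N" for l
    proof -
      \<comment> \<open>Moving \<open>mat_adjoint Y\<close> across the inner product of the two
        outputs makes an amplitude of \<open>mat_adjoint Y *\<^sub>v \<psi>\<close>, the zero
        vector, appear.\<close>
      have "residual d 1 A (V *\<^sub>v \<psi>) l 0 * cnj (residual d 1 A (V *\<^sub>v (Y *\<^sub>v \<chi>)) l 0) =
        residual d 1 A (V *\<^sub>v (mat_adjoint Y *\<^sub>v \<psi>)) l 0 * cnj (residual d 1 A (V *\<^sub>v \<chi>) l 0)"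
        using comm[OF D(5)[OF Y], of l \<psi> \<chi>] l c Yc
        by (simp add: measure_op_cscalar[OF _ _ l] Vc z)
      also have "\<dots> = 0" unfolding z V0 by (simp add: residual_def)
      finally show ?thesis by simp
    qed
    then have "V *\<^sub>v \<psi> = 0\<^sub>v d \<or> V *\<^sub>v (Y *\<^sub>v \<chi>) = 0\<^sub>v d"
      using A Vc[OF c(1)] Vc[OF Yc] unfolding confusing_def by blast
    then show False using isometry_vec_nonzero[OF V c(1) nz(1)] isometry_vec_nonzero[OF V Yc nz(2)] by blast
  qed
  \<comment> \<open>All elements are now scalar matrices, and entry \<open>(0, 0)\<close>, which
    exists because \<open>k\<close> is nonzero, reads off the scalar.\<close>
  define s where "s X = X $$ (0, 0)" for X :: "complex mat"
  have sX: "X = s X \<cdot>\<^sub>m 1\<^sub>m k" if "X \<in> \<rho> ` carrier B" for X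
    using scalar[OF that] D(6) by (auto simp: s_def)
  define \<sigma> where "\<sigma> X = mat 1 1 (\<lambda>_. s X)" for X
  have \<sigma>: "\<sigma> \<in> star_hom ((op_algebra k)\<lparr>carrier := \<rho> ` carrier B\<rparr>) (op_algebra 1)"
    unfolding star_hom_def
  proof (intro CollectI conjI ballI allI funcsetI)
    fix X assume "X \<in> carrier ((op_algebra k)\<lparr>carrier := \<rho> ` carrier B\<rparr>)"
    then have X: "X \<in> \<rho> ` carrier B" by simp
    have Xc: "X \<in> carrier_mat k k" by (rule D(1)[OF X])
    show "\<sigma> X \<in> carrier (op_algebra 1)" by (simp add: \<sigma>_def)
    show "\<sigma> (c \<odot>\<^bsub>(op_algebra k)\<lparr>carrier := \<rho> ` carrier B\<rparr>\<^esub> X) = c \<odot>\<^bsub>op_algebra 1\<^esub> \<sigma> X" for c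
      using Xc D(6) by (auto simp: op_algebra_def \<sigma>_def s_def intro!: eq_matI)
    show "\<sigma> (adj ((op_algebra k)\<lparr>carrier := \<rho> ` carrier B\<rparr>) X) = adj (op_algebra 1) (\<sigma> X)"
      using Xc D(6) by (auto simp: op_algebra_def \<sigma>_def s_def intro!: eq_matI)
    fix Y assume "Y \<in> carrier ((op_algebra k)\<lparr>carrier := \<rho> ` carrier B\<rparr>)"
    then have Y: "Y \<in> \<rho> ` carrier B" by simp
    have Yc: "Y \<in> carrier_mat k k" by (rule D(1)[OF Y])
    show "\<sigma> (X \<oplus>\<^bsub>(op_algebra k)\<lparr>carrier := \<rho> ` carrier B\<rparr>\<^esub> Y) = \<sigma> X \<oplus>\<^bsub>op_algebra 1\<^esub> \<sigma> Y"
      using Xc Yc D(6) by (auto simp: op_algebra_def \<sigma>_def s_def intro!: eq_matI)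
    have "X * Y = (s X \<cdot>\<^sub>m 1\<^sub>m k) * (s Y \<cdot>\<^sub>m 1\<^sub>m k)" using sX[OF X] sX[OF Y] by simp
    also have "\<dots> = s X \<cdot>\<^sub>m (s Y \<cdot>\<^sub>m 1\<^sub>m k)"
      by (subst mult_smult_assoc_mat[of _ k k _ k]) auto
    finally have "s (X * Y) = s X * s Y" using D(6) by (simp add: s_def)
    then show "\<sigma> (X \<otimes>\<^bsub>(op_algebra k)\<lparr>carrier := \<rho> ` carrier B\<rparr>\<^esub> Y) = \<sigma> X \<otimes>\<^bsub>op_algebra 1\<^esub> \<sigma> Y"
      by (auto simp: op_algebra_def \<sigma>_def scalar_prod_def intro!: eq_matI)
  qed
  have "inj_on \<sigma> (\<rho> ` carrier B)"
  proof (rule inj_onI)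
    fix X Y assume XY: "X \<in> \<rho> ` carrier B" "Y \<in> \<rho> ` carrier B" "\<sigma> X = \<sigma> Y"
    have "s X = \<sigma> X $$ (0, 0)" "s Y = \<sigma> Y $$ (0, 0)" by (simp_all add: \<sigma>_def)
    then have "s X = s Y" using XY(3) by simp
    then show "X = Y" using sX[OF XY(1)] sX[OF XY(2)] by metis
  qed
  then show ?thesis
    unfolding embeds_def using star_hom_comp[OF star_hom_restrict[OF \<rho>(1)] \<sigma>] comp_inj_on[OF \<rho>(2)] by blast
qed simp_all

section \<open>The measurement and the code\<close>

text \<open>
  Outcomes \<open>4 k, \<dots>, 4 k + 3\<close> are given by \<open>w\<^sub>k \<otimes> b\<close>, where the \<open>w\<^sub>k\<close> are the columns of a \<open>2 \<times> 3\<close> matrix with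
  orthonormal rows and \<open>b\<close> runs through the eigenvectors of the two Pauli matrices other than \<open>\<sigma>\<^sub>k\<close>, scaled to norm
  \<open>1 / \<surd>2\<close>. Codeword \<open>k\<close> is \<open>w\<^sub>k\<^sup>\<bottom> \<otimes> \<sigma>\<^sub>k\<close>, up to normalisation: outcomes of type \<open>k\<close> never occur for it, and they send
  the other two codewords to the vector \<open>b\<close> and to the vector orthogonal to it, which \<open>decoder_vec\<close> measures.
  All coordinates are Gaussian rationals, at the cost of a few phases.
\<close>

definition povm_outer :: "nat \<Rightarrow> nat \<Rightarrow> complex" where
  "povm_outer k i = [[Complex (2/3) 0, Complex (2/3) 0], [Complex (2/3) 0, Complex (-1/3) 0],
     [Complex (1/3) 0, Complex (-2/3) 0]] ! k ! i"

definition povm_inner :: "nat \<Rightarrow> nat \<Rightarrow> complex" where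
  "povm_inner l j =
     [[Complex (1/2) 0, Complex 0 (1/2)], [Complex (1/2) 0, Complex 0 (-1/2)],
      [Complex (1/2) (1/2), 0], [0, Complex (1/2) (1/2)],
      [Complex (1/2) 0, Complex (1/2) 0], [Complex (1/2) 0, Complex (-1/2) 0],
      [Complex (1/2) (1/2), 0], [0, Complex (1/2) (1/2)],
      [Complex (1/2) 0, Complex (1/2) 0], [Complex (1/2) 0, Complex (-1/2) 0],
      [Complex (1/2) 0, Complex 0 (1/2)], [Complex (1/2) 0, Complex 0 (-1/2)]] ! l ! j"

definition povm :: "complex mat" where
  "povm = mat 12 4 (\<lambda>(l, a). povm_outer (l div 4) (a div 2) * povm_inner l (a mod 2))"

text \<open>The directions \<open>(1, -1)\<close>, \<open>(1, 2)\<close> and \<open>(2, 1)\<close>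
  annihilate the three \<open>povm_outer\<close> vectors. Each is scaled to norm
  \<open>1 / sqrt 2\<close>, because a Pauli matrix has Hilbert-Schmidt norm \<open>sqrt 2\<close>;
  the factor \<open>(3 - i) / 10\<close> has modulus \<open>1 / sqrt 10\<close> and normalises the
  directions of norm \<open>sqrt 5\<close> within the Gaussian rationals.\<close>

definition code_outer :: "nat \<Rightarrow> nat \<Rightarrow> complex" where
  "code_outer a i = [[Complex (1/2) 0, Complex (-1/2) 0], [Complex (3/10) (-1/10), Complex (3/5) (-1/5)],
     [Complex (3/5) (-1/5), Complex (3/10) (-1/10)]] ! a ! i"

definition pauli :: "nat \<Rightarrow> nat \<Rightarrow> nat \<Rightarrow> complex" where
  "pauli a i j = [[[0, 1], [1, 0]], [[0, Complex 0 (-1)], [Complex 0 1, 0]], [[1, 0], [0, -1]]] ! a ! i ! j"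

definition code :: "complex mat" where
  "code = mat 8 3 (\<lambda>(b, a). code_outer a (b div 4) * pauli a (b div 2 mod 2) (b mod 2))"

text \<open>The two eigenvectors of one Pauli matrix stand at neighbouring indices, so changing the
  parity of \<open>l\<close> gives the orthogonal partner. The factor \<open>1 + i\<close> has
  modulus \<open>sqrt 2\<close> and restores unit length.\<close>

definition decoder_vec :: "nat \<Rightarrow> nat \<Rightarrow> nat \<Rightarrow> complex" where
  "decoder_vec l c t = Complex 1 1 * povm_inner (if c = 0 then l else if even l then l + 1 else l - 1) t"

text \<open>For \<open>c = 0\<close> the label is the Pauli matrix whose eigenvector outcome
  \<open>l\<close> uses; for \<open>c = 1\<close> it is the remaining one, neither that matrix nor
  the type \<open>l div 4\<close> of the outcome.\<close>

definition decoder_label :: "nat \<Rightarrow> nat \<Rightarrow> nat" where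
  "decoder_label l c = [[1, 2], [1, 2], [2, 1], [2, 1], [0, 2], [0, 2], [2, 0], [2, 0],
     [0, 1], [0, 1], [1, 0], [1, 0]] ! l ! c"

text \<open>The outer rows \<open>(2, 2, 1) / 3\<close> and \<open>(2, -1, -2) / 3\<close> are
  orthonormal. In each type the two inner bases, with vectors of norm \<open>1 / sqrt 2\<close>,
  contribute half the identity each. With finitely many Gaussian rational entries the identity is
  checked by evaluation.\<close>

lemma povm_isometry:
  assumes "a < 4" "b < 4"
  shows "(\<Sum>l<12. cnj (povm $$ (l, a)) * povm $$ (l, b)) = (if a = b then 1 else 0)"
proof -
  have "\<forall>a\<in>{..<4}. \<forall>b\<in>{..<4}. (\<Sum>l<12. cnj (povm $$ (l, a)) * povm $$ (l, b)) = (if a = b then 1 else 0)"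
    by (simp add: lessThan_nat_numeral lessThan_Suc povm_def povm_outer_def povm_inner_def
        complex_mult complex_cnj complex_add Complex_eq_0 Complex_eq_1)
  then show ?thesis using assms by blast
qed

text \<open>Distinct Pauli matrices are orthogonal for the Hilbert-Schmidt product, so the codewords
  are orthogonal whatever their outer factors are.\<close>

lemma code_isometry: "mat_adjoint code * code = 1\<^sub>m 3"
proof -
  have "\<forall>a\<in>{..<3}. \<forall>b\<in>{..<3}. (\<Sum>l<8. cnj (code $$ (l, a)) * code $$ (l, b)) = (if a = b then 1 else 0)"
    by (simp add: lessThan_nat_numeral lessThan_Suc code_def code_outer_def pauli_def complex_mult complex_cnj complex_add Complex_eq_0 Complex_eq_1)
  then show ?thesis
    by (intro eq_matI) (auto simp: scalar_prod_def atLeast0LessThan code_def)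
qed

lemma decoder_vec_orthonormal:
  "\<forall>l\<in>{..<12}. \<forall>t\<in>{..<2}. \<forall>s\<in>{..<2}. (\<Sum>c<2. decoder_vec l c t * cnj (decoder_vec l c s)) = (if t = s then 1 else 0)"
  by (simp add: lessThan_nat_numeral lessThan_Suc decoder_vec_def povm_inner_def complex_mult complex_cnj complex_add Complex_eq_0 Complex_eq_1)

lemma decoder_label_less: "\<forall>l\<in>{..<12}. \<forall>c\<in>{..<2}. decoder_label l c < 3"
  by (simp add: lessThan_nat_numeral lessThan_Suc decoder_label_def)

text \<open>Outcomes and codewords both split off the first qubit as a tensor factor, so the
  residual is an outer overlap times a vector of \<open>C^2\<close>. The factorisation separates the
  two reasons for which a residual can fail to disturb decoding.\<close>

lemma povm_code_residual:
  assumes "l < 12" "t < 2" "a < 3"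
  shows "(\<Sum>b<4. povm $$ (l, b) * code $$ (b * 2 + t, a)) =
    (\<Sum>i<2. povm_outer (l div 4) i * code_outer a i) * (\<Sum>j<2. povm_inner l j * pauli a j t)"
proof -
  have "(\<Sum>b<2 * 2. povm $$ (l, b) * code $$ (b * 2 + t, a)) =
      (\<Sum>i<2. \<Sum>j<2. povm $$ (l, i * 2 + j) * code $$ ((i * 2 + j) * 2 + t, a))"
    by (rule sum_product_index)
  also have "\<dots> = (\<Sum>i<2. \<Sum>j<2. (povm_outer (l div 4) i * code_outer a i) * (povm_inner l j * pauli a j t))"
  proof (intro sum.cong refl)
    fix i j :: nat assume ij: "i \<in> {..<2}" "j \<in> {..<2}"
    have lt: "i * 2 + j < 4" "(i * 2 + j) * 2 + t < 8" using ij assms(2) by auto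
    have "((i * 2 + j) * 2 + t) div 4 = i" "((i * 2 + j) * 2 + t) div 2 = i * 2 + j"
      "((i * 2 + j) * 2 + t) mod 2 = t" "(i * 2 + j) div 2 = i" "(i * 2 + j) mod 2 = j"
      using ij assms(2) by (auto simp: less_2_cases_iff)
    then show "povm $$ (l, i * 2 + j) * code $$ ((i * 2 + j) * 2 + t, a) =
        (povm_outer (l div 4) i * code_outer a i) * (povm_inner l j * pauli a j t)"
      using assms lt by (simp add: povm_def code_def del: mult_Suc_right)
  qed
  finally show ?thesis by (simp add: sum_product)
qed

lemma povm_outer_code_outer: "\<forall>k\<in>{..<3}. (\<Sum>i<2. povm_outer k i * code_outer k i) = 0"
  by (simp add: lessThan_nat_numeral lessThan_Suc povm_outer_def code_outer_def complex_mult complex_cnj complex_add Complex_eq_0 Complex_eq_1)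

lemma decoder_inner:
  "\<forall>l\<in>{..<12}. \<forall>c\<in>{..<2}. \<forall>a\<in>{..<3}. a \<noteq> decoder_label l c \<longrightarrow> a \<noteq> l div 4 \<longrightarrow>
    (\<Sum>t<2. cnj (decoder_vec l c t) * (\<Sum>j<2. povm_inner l j * pauli a j t)) = 0"
  by (simp add: lessThan_nat_numeral lessThan_Suc decoder_vec_def decoder_label_def povm_inner_def pauli_def
      complex_mult complex_cnj complex_add Complex_eq_0 Complex_eq_1)

text \<open>If \<open>a\<close> is the type \<open>l div 4\<close> of the outcome, the outer overlap
  is zero. Otherwise the inner vector is, up to phase, the eigenvector of the outcome or its
  orthogonal partner, and a wrong label means that it is orthogonal to
  \<open>decoder_vec l c\<close>.\<close>

lemma decoder_correct:
  assumes l: "l < 12" and c: "c < 2" and a: "a < 3" "a \<noteq> decoder_label l c"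
  shows "(\<Sum>t<2. cnj (decoder_vec l c t) * (\<Sum>b<4. povm $$ (l, b) * code $$ (b * 2 + t, a))) = 0"
proof -
  have "(\<Sum>t<2. cnj (decoder_vec l c t) * (\<Sum>b<4. povm $$ (l, b) * code $$ (b * 2 + t, a))) =
    (\<Sum>i<2. povm_outer (l div 4) i * code_outer a i) *
    (\<Sum>t<2. cnj (decoder_vec l c t) * (\<Sum>j<2. povm_inner l j * pauli a j t))"
    unfolding sum_distrib_left[of "\<Sum>i<2. povm_outer (l div 4) i * code_outer a i"]
    by (intro sum.cong refl) (simp add: povm_code_residual l a(1) mult_ac)
  then show ?thesis
    using decoder_inner povm_outer_code_outer l c a by (cases "a = l div 4") auto
qed

text \<open>Three pairwise independent functionals on the plane each kill one of two vectors, so one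
  of the vectors is killed by two of them and vanishes.\<close>

lemma kernel_pigeonhole:
  fixes p q :: "nat \<Rightarrow> complex"
  assumes det: "p 0 * q 1 \<noteq> p 1 * q 0" "p 0 * q 2 \<noteq> p 2 * q 0" "p 1 * q 2 \<noteq> p 2 * q 1"
    and 0: "\<And>i. i < 3 \<Longrightarrow> p i * x + q i * y = 0 \<or> p i * x' + q i * y' = 0"
  shows "(x = 0 \<and> y = 0) \<or> (x' = 0 \<and> y' = 0)"
proof -
  have two: "u = 0 \<and> v = 0" if "p i * u + q i * v = 0" "p j * u + q j * v = 0" "p i * q j \<noteq> p j * q i" for i j u v
  proof -
    have "(p i * q j - p j * q i) * u = q j * (p i * u + q i * v) - q i * (p j * u + q j * v)"
      "(p i * q j - p j * q i) * v = p i * (p j * u + q j * v) - p j * (p i * u + q i * v)"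
      by (simp_all add: algebra_simps)
    then have "(p i * q j - p j * q i) * u = 0" "(p i * q j - p j * q i) * v = 0"
      unfolding that(1,2) by simp_all
    then show ?thesis using that(3) by simp
  qed
  show ?thesis using 0[of 0] 0[of 1] 0[of 2] two[of 0 x y 1] two[of 0 x y 2] two[of 1 x y 2]
      two[of 0 x' y' 1] two[of 0 x' y' 2] two[of 1 x' y' 2] det by auto
qed

lemma povm_confusing: "confusing 12 4 povm"
  unfolding confusing_def
proof (intro ballI impI)
  fix \<phi> \<psi> :: "complex vec"
  assume c: "\<phi> \<in> carrier_vec 4" "\<psi> \<in> carrier_vec 4"
    and 0: "\<forall>l<12. residual 4 1 povm \<phi> l 0 = 0 \<or> residual 4 1 povm \<psi> l 0 = 0"
  \<comment> \<open>Contraction of \<open>x\<close> with the outer vector of type \<open>k\<close>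
    on the first qubit, leaving a vector of \<open>C^2\<close> that the inner functionals
    test.\<close>
  define w where "w x k j = povm_outer k 0 * x $ j + povm_outer k 1 * x $ (2 + j)" for x :: "complex vec" and k j
  have r: "residual 4 1 povm x l 0 = povm_inner l 0 * w x (l div 4) 0 + povm_inner l 1 * w x (l div 4) 1"
    if "l < 12" for x l
    using that by (simp add: residual_def povm_def w_def lessThan_nat_numeral lessThan_Suc algebra_simps,
      simp add: numeral_2_eq_2 numeral_3_eq_3)
  \<comment> \<open>Three of the four inner vectors of a type are enough: two eigenvectors of one
    Pauli matrix and one of another are pairwise independent.\<close>
  have inner: "(w \<phi> k 0 = 0 \<and> w \<phi> k 1 = 0) \<or> (w \<psi> k 0 = 0 \<and> w \<psi> k 1 = 0)" if k: "k < 3" for k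
  proof (rule kernel_pigeonhole[of "\<lambda>i. povm_inner (4 * k + i) 0" "\<lambda>i. povm_inner (4 * k + i) 1"])
    fix i :: nat assume i: "i < 3"
    have "4 * k + i < 12" "(4 * k + i) div 4 = k" using i k by auto
    then show "povm_inner (4 * k + i) 0 * w \<phi> k 0 + povm_inner (4 * k + i) 1 * w \<phi> k 1 = 0 \<or>
         povm_inner (4 * k + i) 0 * w \<psi> k 0 + povm_inner (4 * k + i) 1 * w \<psi> k 1 = 0"
      using 0 r[of "4 * k + i" \<phi>] r[of "4 * k + i" \<psi>] by auto
  qed (use k in \<open>auto simp: povm_inner_def numeral_3_eq_3 less_Suc_eq complex_eq_iff\<close>)
  \<comment> \<open>The second pigeonhole runs over the three types. Since \<open>inner\<close>
    kills a whole contraction, component \<open>j\<close> of \<open>\<phi>\<close> and component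
    \<open>j'\<close> of \<open>\<psi>\<close> may be chosen independently.\<close>
  have outer: "(\<phi> $ j = 0 \<and> \<phi> $ (2 + j) = 0) \<or> (\<psi> $ j' = 0 \<and> \<psi> $ (2 + j') = 0)" if "j < 2" "j' < 2" for j j'
  proof (rule kernel_pigeonhole[of "\<lambda>k. povm_outer k 0" "\<lambda>k. povm_outer k 1"])
    fix k :: nat assume "k < 3"
    from inner[OF this] show "povm_outer k 0 * \<phi> $ j + povm_outer k 1 * \<phi> $ (2 + j) = 0 \<or>
        povm_outer k 0 * \<psi> $ j' + povm_outer k 1 * \<psi> $ (2 + j') = 0"
      using less_2_cases[OF that(1)] less_2_cases[OF that(2)]
      by (auto simp: w_def numeral_2_eq_2 numeral_3_eq_3)
  qed (auto simp: povm_outer_def complex_eq_iff)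
  have vec0: "x = 0\<^sub>v 4" if x: "x \<in> carrier_vec 4" "\<And>j. j < 2 \<Longrightarrow> x $ j = 0 \<and> x $ (2 + j) = 0" for x :: "complex vec"
  proof (rule eq_vecI)
    fix i :: nat assume "i < dim_vec (0\<^sub>v 4 :: complex vec)"
    then have "i < 2 \<or> (\<exists>j<2. i = 2 + j)" by (auto intro!: exI[of _ "i - 2"])
    then show "x $ i = 0\<^sub>v 4 $ i" using x(2) \<open>i < dim_vec (0\<^sub>v 4)\<close> by auto
  qed (use x in auto)
  show "\<phi> = 0\<^sub>v 4 \<or> \<psi> = 0\<^sub>v 4" using vec0[OF c(1)] vec0[OF c(2)] outer by blast
qed

section \<open>Dominating algebras\<close>

lemma op_algebra_1_transmittable:
  assumes ch: "quantum_channel n m (kraus_map n m I K)" and K: "\<And>i. i \<in> I \<Longrightarrow> K i \<in> carrier_mat m n" and n: "0 < n"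
  shows "op_algebra 1 \<in> transmittable_algebras n m (kraus_map n m I K)"
  unfolding op_algebra_pattern
proof (rule pattern_algebra_transmittable[OF ch _ K])
  \<comment> \<open>The rows \<open>e_i^*\<close> are the Kraus operators of the trace, so the
    decoder forgets everything; the code space is the line through the first basis vector.\<close>
  define F :: "nat \<Rightarrow> complex mat" where "F i = mat 1 m (\<lambda>(_, a). if a = i then 1 else 0)" for i
  define V :: "complex mat" where "V = mat n 1 (\<lambda>(a, _). if a = 0 then 1 else 0)"
  show F: "F i \<in> carrier_mat 1 m" for i by (simp add: F_def)
  show "quantum_channel m 1 (kraus_map m 1 {..<m} F)"
  proof (rule quantum_channel_kraus_map)
    fix a b assume "a < m" "b < m"
    then show "(\<Sum>i<m. \<Sum>p<1. cnj (F i $$ (p, a)) * F i $$ (p, b)) = (if a = b then 1 else 0)"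
      by (subst sum2_eq_single[of a m 0 1]) (auto simp: F_def)
  qed (rule F)
  show V: "V \<in> carrier_mat n 1" by (simp add: V_def)
  have "(\<Sum>l<n. cnj (V $$ (l, 0)) * V $$ (l, 0)) = 1"
    using n by (subst sum_eq_single[of 0]) (auto simp: V_def)
  then show "mat_adjoint V * V = 1\<^sub>m 1"
    using carrier_matD[OF V] by (intro eq_matI) (auto simp: scalar_prod_def atLeast0LessThan)
  fix i j X assume "i \<in> I" "X \<in> carrier (pattern_algebra 1 UNIV)"
  then have "X \<in> carrier_mat 1 1" "F j * (K i * V) \<in> carrier_mat 1 1"
    using mult_carrier_mat[OF F mult_carrier_mat[OF K V]] by auto
  moreover have "Y * Z = Z * Y" if "Y \<in> carrier_mat 1 1" "Z \<in> carrier_mat 1 1" for Y Z :: "complex mat"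
    using that by (intro eq_matI) (auto simp: scalar_prod_def)
  ultimately show "X * (F j * (K i * V)) = F j * (K i * V) * X" by blast
qed (auto simp: refl_on_def trans_def sym_def)

lemma op_algebra_id_transmittable:
  assumes n: "0 < n"
  shows "op_algebra n \<in> transmittable_algebras n n (\<lambda>Y. Y)"
proof -
  have ch: "quantum_channel n n (kraus_map n n {()} (\<lambda>_. 1\<^sub>m n))"
  proof (rule quantum_channel_kraus_map)
    fix a b assume "a < n" "b < n"
    then have "(\<Sum>p<n. cnj (1\<^sub>m n $$ (p, a)) * 1\<^sub>m n $$ (p, b)) = (if a = b then 1 else 0 :: complex)"
      by (subst sum_eq_single[of a]) auto
    then show "(\<Sum>i\<in>{()}. \<Sum>p<n. cnj (1\<^sub>m n $$ (p, a)) * 1\<^sub>m n $$ (p, b)) = (if a = b then 1 else 0 :: complex)"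
      by simp
  qed simp
  have "pattern_algebra n UNIV \<in> transmittable_algebras n n (kraus_map n n {()} (\<lambda>_. 1\<^sub>m n))"
    by (rule pattern_algebra_transmittable[OF ch ch, of "1\<^sub>m n"]) (use n in \<open>auto simp: refl_on_def trans_def sym_def\<close>)
  then show ?thesis
    using transmittable_algebras_cong[of n "kraus_map n n {()} (\<lambda>_. 1\<^sub>m n)" "\<lambda>Y. Y"]
    by (simp add: kraus_map_one op_algebra_pattern)
qed

text \<open>The representation that makes an algebra transmittable is already an embedding into
  \<open>op_algebra n\<close>, so only transmittability of \<open>op_algebra n\<close> itself takes
  an argument.\<close>

lemma dominating_id:
  assumes "0 < n"
  shows "dominating_transmittable n n (\<lambda>Y. Y) (op_algebra n)"
  unfolding dominating_transmittable_def
proof (intro conjI ballI op_algebra_id_transmittable[OF assms])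
  fix B assume "B \<in> transmittable_algebras n n (\<lambda>Y. Y)"
  then show "embeds B (op_algebra n)" unfolding transmittable_algebras_def embeds_def by blast
qed

text \<open>The idle second index matches the index set of \<open>tensor_id_kraus_map\<close>, where
  the identity channel has one Kraus operator.\<close>

definition ampl_measure_op :: "nat \<Rightarrow> nat \<Rightarrow> complex mat \<Rightarrow> nat \<Rightarrow> nat \<times> unit \<Rightarrow> complex mat" where
  "ampl_measure_op N d A f = (\<lambda>(l, _). kron (measure_op N d A l) (1\<^sub>m f))"

lemma ampl_measure_op_carrier: "ampl_measure_op N d A f i \<in> carrier_mat (N * f) (d * f)"
  by (auto simp: ampl_measure_op_def kron_def measure_op_def split: prod.split)

lemma tensor_measure:
  "tensor_map d N f f (kraus_map d N {..<N} (measure_op N d A)) (\<lambda>Y. Y) =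
    kraus_map (d * f) (N * f) ({..<N} \<times> {()}) (ampl_measure_op N d A f)"
  unfolding ampl_measure_op_def by (rule tensor_id_kraus_map(2)) simp

lemma ampl_measure_mult_index:
  assumes V: "V \<in> carrier_mat (d * f) k" and p: "p < N" "t < f" and a: "a < k"
  shows "(ampl_measure_op N d A f (l, ()) * V) $$ (p * f + t, a) =
    (if p = l then \<Sum>b<d. A $$ (l, b) * V $$ (b * f + t, a) else 0)"
proof -
  have lt: "p * f + t < N * f" using index_product_less p by blast
  have cV: "col V a \<in> carrier_vec (d * f)" using V by (metis carrier_matD(1) col_dim)
  have "(ampl_measure_op N d A f (l, ()) * V) $$ (p * f + t, a) =
      (ampl_measure_op N d A f (l, ()) *\<^sub>v col V a) $ (p * f + t)"
    using lt a carrier_matD(2)[OF V] carrier_matD(1)[OF ampl_measure_op_carrier[of N d A f "(l, ())"]]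
    by (simp only: index_mult_mat(1) index_mult_mat_vec)
  also have "\<dots> = (if p = l then residual d f A (col V a) l t else 0)"
    unfolding ampl_measure_op_def split
    using cV p by (rule measure_op_kron_vec)
  also have "residual d f A (col V a) l t = (\<Sum>b<d. A $$ (l, b) * V $$ (b * f + t, a))"
    unfolding residual_def
  proof (intro sum.cong refl)
    fix b assume "b \<in> {..<d}"
    then have "b * f + t < dim_row V" using index_product_less[of b d t f] p carrier_matD(1)[OF V] by simp
    then show "A $$ (l, b) * col V a $ (b * f + t) = A $$ (l, b) * V $$ (b * f + t, a)"
      using a carrier_matD(2)[OF V] by (simp only: index_col)
  qed
  finally show ?thesis .
qed

lemma quantum_channel_ampl_measure:
  assumes "\<And>a b. a < d \<Longrightarrow> b < d \<Longrightarrow> (\<Sum>l<N. cnj (A $$ (l, a)) * A $$ (l, b)) = (if a = b then 1 else 0)"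
  shows "quantum_channel (d * f) (N * f) (kraus_map (d * f) (N * f) ({..<N} \<times> {()}) (ampl_measure_op N d A f))"
proof (rule quantum_channel_kraus_map)
  fix a b assume ab: "a < d * f" "b < d * f"
  then have f: "0 < f" by (cases f) auto
  then have dm: "a div f < d" "b div f < d" "a mod f < f" "b mod f < f" using ab by (auto simp: less_mult_imp_div_less)
  have e: "ampl_measure_op N d A f (l, ()) $$ (p * f + t, c) = (if p = l \<and> t = c mod f then A $$ (l, c div f) else 0)"
    if "p < N" "t < f" "c < d * f" for l p t c
    using that index_product_less[OF that(1,2)] f
    by (auto simp: ampl_measure_op_def kron_def measure_op_def less_mult_imp_div_less)
  have "(\<Sum>P<N * f. cnj (ampl_measure_op N d A f (l, ()) $$ (P, a)) * ampl_measure_op N d A f (l, ()) $$ (P, b)) =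
      (if a mod f = b mod f then cnj (A $$ (l, a div f)) * A $$ (l, b div f) else 0)" if l: "l < N" for l
    unfolding sum_product_index using l dm
    by (subst sum2_eq_single[of l N "a mod f" f]) (auto simp: e ab)
  then have "(\<Sum>i\<in>{..<N} \<times> {()}. \<Sum>P<N * f. cnj (ampl_measure_op N d A f i $$ (P, a)) * ampl_measure_op N d A f i $$ (P, b)) =
      (if a mod f = b mod f then if a div f = b div f then 1 else 0 else 0)"
    using assms[OF dm(1,2)] by (simp add: sum_Times)
  moreover have "a = b \<longleftrightarrow> a mod f = b mod f \<and> a div f = b div f"
    by (metis div_mult_mod_eq)
  ultimately show "(\<Sum>i\<in>{..<N} \<times> {()}. \<Sum>P<N * f. cnj (ampl_measure_op N d A f i $$ (P, a)) * ampl_measure_op N d A f i $$ (P, b)) =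
      (if a = b then 1 else 0)" by auto
qed (rule ampl_measure_op_carrier)

lemma op_algebra_ampl_transmittable:
  assumes A: "\<And>a b. a < d \<Longrightarrow> b < d \<Longrightarrow> (\<Sum>l<N. cnj (A $$ (l, a)) * A $$ (l, b)) = (if a = b then 1 else 0)"
    and d: "0 < d" and f: "0 < f"
  shows "op_algebra f \<in> transmittable_algebras (d * f) (N * f)
    (kraus_map (d * f) (N * f) ({..<N} \<times> {()}) (ampl_measure_op N d A f))"
  unfolding op_algebra_pattern
proof (rule pattern_algebra_transmittable[OF quantum_channel_ampl_measure[OF A] _ ampl_measure_op_carrier])
  \<comment> \<open>\<open>F i\<close> is \<open>e_i^* \<otimes> 1\<close>, so the decoder is the
    partial trace over the measurement record, and \<open>V\<close> encodes into
    \<open>e_0 \<otimes> C^f\<close>. The products of Kraus operators are then multiples of the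
    identity by amplitudes \<open>A $$ (l, 0)\<close>.\<close>
  define F :: "nat \<Rightarrow> complex mat" where "F i = mat f (N * f) (\<lambda>(t, P). if P = i * f + t then 1 else 0)" for i
  define V :: "complex mat" where "V = mat (d * f) f (\<lambda>(P, t). if P = t then 1 else 0)"
  show F: "F i \<in> carrier_mat f (N * f)" for i by (simp add: F_def)
  show V: "V \<in> carrier_mat (d * f) f" by (simp add: V_def)
  show "quantum_channel (N * f) f (kraus_map (N * f) f {..<N} F)"
  proof (rule quantum_channel_kraus_map)
    fix a b assume ab: "a < N * f" "b < N * f"
    then have dm: "a div f < N" "a mod f < f" using f by (auto simp: less_mult_imp_div_less)
    then show "(\<Sum>i<N. \<Sum>p<f. cnj (F i $$ (p, a)) * F i $$ (p, b)) = (if a = b then 1 else 0)"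
      using ab by (subst sum2_eq_single[of "a div f" N "a mod f" f]) (auto simp: F_def)
  qed (rule F)
  have "(\<Sum>P<d * f. cnj (V $$ (P, a)) * V $$ (P, b)) = (if a = b then 1 else 0)" if "a < f" "b < f" for a b
    using that index_product_less[of 0 d a f] d by (subst sum_eq_single[of a]) (auto simp: V_def)
  then show "mat_adjoint V * V = 1\<^sub>m f"
    using carrier_matD[OF V] by (intro eq_matI) (auto simp: scalar_prod_def atLeast0LessThan)
  fix i j X assume i: "i \<in> {..<N} \<times> {()}" and j: "j \<in> {..<N}" and X: "X \<in> carrier (pattern_algebra f UNIV)"
  obtain l where l: "i = (l, ())" "l < N" using i by auto
  define M where "M = F j * (ampl_measure_op N d A f i * V)"
  have Kc: "ampl_measure_op N d A f i * V \<in> carrier_mat (N * f) f"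
    by (rule mult_carrier_mat[OF ampl_measure_op_carrier V])
  have "M $$ (t, s) = ((if j = l then A $$ (l, 0) else 0) \<cdot>\<^sub>m 1\<^sub>m f) $$ (t, s)" if ts: "t < f" "s < f" for t s
  proof -
    have lt: "j * f + t < N * f" using index_product_less[of j N t f] j ts by simp
    have "M $$ (t, s) = (\<Sum>P<N * f. F j $$ (t, P) * (ampl_measure_op N d A f i * V) $$ (P, s))"
      unfolding M_def using carrier_matD[OF F] carrier_matD[OF Kc] ts by (simp add: scalar_prod_def atLeast0LessThan)
    also have "\<dots> = (ampl_measure_op N d A f i * V) $$ (j * f + t, s)"
      using lt ts by (subst sum_eq_single[of "j * f + t"]) (auto simp: F_def)
    also have "\<dots> = (if j = l then \<Sum>b<d. A $$ (l, b) * V $$ (b * f + t, s) else 0)"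
      unfolding l using j ts by (intro ampl_measure_mult_index[OF V]) auto
    also have "(\<Sum>b<d. A $$ (l, b) * V $$ (b * f + t, s)) = (if t = s then A $$ (l, 0) else 0)"
    proof (subst sum_eq_single[of 0])
      fix b assume b: "b < d" "b \<noteq> 0"
      have "b * f + t \<noteq> s" using b ts(2) by (cases b) auto
      then show "A $$ (l, b) * V $$ (b * f + t, s) = 0"
        using b ts index_product_less[of b d t f] by (simp add: V_def)
    qed (use d ts index_product_less[of 0 d t f] in \<open>auto simp: V_def\<close>)
    finally show ?thesis using ts by simp
  qed
  then have M: "M = (if j = l then A $$ (l, 0) else 0) \<cdot>\<^sub>m 1\<^sub>m f"
    using carrier_matD[OF F] carrier_matD[OF Kc] by (intro eq_matI) (auto simp: M_def)
  have "X \<in> carrier_mat f f" using X by simp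
  then show "X * (F j * (ampl_measure_op N d A f i * V)) = F j * (ampl_measure_op N d A f i * V) * X"
    unfolding M_def[symmetric] M
    by (simp add: mult_smult_distrib[of _ f f _ f] mult_smult_assoc_mat[of _ f f _ f])
qed (use f in \<open>auto simp: refl_on_def trans_def sym_def\<close>)

section \<open>Transmission of the diagonal algebra \<open>C^3\<close>\<close>

lemma diagonal_commute:
  assumes "X \<in> carrier (pattern_algebra k Id)" "Y \<in> carrier (pattern_algebra k Id)"
  shows "X * Y = Y * X"
proof -
  have diag: "Z $$ (i, l) = 0" if "Z \<in> carrier (pattern_algebra k Id)" "i < k" "l < k" "i \<noteq> l" for Z i l
    using that by simp
  have prod: "(X * Y) $$ (i, j) = X $$ (i, i) * Y $$ (i, j)"
    if X: "X \<in> carrier (pattern_algebra k Id)" and Y: "Y \<in> carrier (pattern_algebra k Id)" and ij: "i < k" "j < k" for X Y i j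
  proof -
    have "X \<in> carrier_mat k k" "Y \<in> carrier_mat k k" using X Y by simp_all
    then have "(X * Y) $$ (i, j) = (\<Sum>l<k. X $$ (i, l) * Y $$ (l, j))"
      using ij by (simp add: scalar_prod_def atLeast0LessThan)
    also have "\<dots> = X $$ (i, i) * Y $$ (i, j)" by (rule sum_eq_single) (use ij diag[OF X] in simp_all)
    finally show ?thesis .
  qed
  have XY: "X \<in> carrier_mat k k" "Y \<in> carrier_mat k k" using assms by simp_all
  show ?thesis
  proof (rule eq_matI)
    fix i j assume "i < dim_row (Y * X)" "j < dim_col (Y * X)"
    then have ij: "i < k" "j < k" using XY by auto
    show "(X * Y) $$ (i, j) = (Y * X) $$ (i, j)"
      unfolding prod[OF assms ij] prod[OF assms(2,1) ij]
      using diag[OF assms(1) ij] diag[OF assms(2) ij] by (cases "i = j") (simp_all add: mult.commute)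
  qed (use XY in simp_all)
qed

text \<open>The commutant of the diagonal algebra contains the diagonal matrices, so it is enough
  that each composite Kraus operator is diagonal, that is, that decoding never confuses two
  codewords.\<close>

lemma diagonal_transmittable:
  "pattern_algebra 3 Id \<in> transmittable_algebras (4 * 2) (12 * 2)
    (kraus_map (4 * 2) (12 * 2) ({..<12} \<times> {()}) (ampl_measure_op 12 4 povm 2))"
proof (rule pattern_algebra_transmittable[OF quantum_channel_ampl_measure[OF povm_isometry] _ ampl_measure_op_carrier])
  \<comment> \<open>The decoder reads the record \<open>l\<close>, measures the remaining qubit in
    the basis \<open>decoder_vec l\<close>, and prepares the basis state of the label obtained.
    Orthonormality of that basis gives trace preservation.\<close>
  define F :: "nat \<times> nat \<Rightarrow> complex mat" where "F = (\<lambda>(l, c). mat 3 (12 * 2) (\<lambda>(p, P).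
    if p = decoder_label l c \<and> P div 2 = l then cnj (decoder_vec l c (P mod 2)) else 0))"
  show F: "F j \<in> carrier_mat 3 (12 * 2)" for j by (simp add: F_def split: prod.split)
  have Fi: "F (l, c) $$ (p, m * 2 + t) = (if p = decoder_label l c \<and> m = l then cnj (decoder_vec l c t) else 0)"
    if "p < 3" "m < 12" "t < 2" for l c p m t
    using that index_product_less[of m 12 t 2] by (simp add: F_def)
  show "quantum_channel (12 * 2) 3 (kraus_map (12 * 2) 3 ({..<12} \<times> {..<2}) F)"
  proof (rule quantum_channel_kraus_map)
    fix a b :: nat assume ab: "a < 12 * 2" "b < 12 * 2"
    then have dm: "a div 2 < 12" "b div 2 < 12" "a mod 2 < 2" "b mod 2 < 2" by auto
    have Fd: "F (l, c) $$ (p, x) = (if p = decoder_label l c \<and> x div 2 = l then cnj (decoder_vec l c (x mod 2)) else 0)"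
      if "p < 3" "x < 12 * 2" for l c p x using that by (simp add: F_def)
    have "(\<Sum>p<3. cnj (F (l, c) $$ (p, a)) * F (l, c) $$ (p, b)) =
        (if l = a div 2 \<and> l = b div 2 then decoder_vec l c (a mod 2) * cnj (decoder_vec l c (b mod 2)) else 0)"
      if "l < 12" "c < 2" for l c
      using ab that decoder_label_less by (subst sum_eq_single[of "decoder_label l c"]) (auto simp: Fd)
    then have "(\<Sum>i\<in>{..<12} \<times> {..<2}. \<Sum>p<3. cnj (F i $$ (p, a)) * F i $$ (p, b)) =
        (\<Sum>l<12. \<Sum>c<2. if l = a div 2 \<and> l = b div 2 then decoder_vec l c (a mod 2) * cnj (decoder_vec l c (b mod 2)) else 0)"
      by (simp add: sum_Times)
    also have "\<dots> = (if a div 2 = b div 2 then \<Sum>c<2. decoder_vec (a div 2) c (a mod 2) * cnj (decoder_vec (a div 2) c (b mod 2)) else 0)"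
      using dm(1) by (subst sum_eq_single[of "a div 2"]) auto
    also have "\<dots> = (if a div 2 = b div 2 then if a mod 2 = b mod 2 then 1 else 0 else 0)"
      using decoder_vec_orthonormal dm by simp
    also have "\<dots> = (if a = b then 1 else 0)"
    proof -
      have "a = b \<longleftrightarrow> a mod 2 = b mod 2 \<and> a div 2 = b div 2" by (metis div_mult_mod_eq)
      then show ?thesis by auto
    qed
    finally show "(\<Sum>i\<in>{..<12} \<times> {..<2}. \<Sum>p<3. cnj (F i $$ (p, a)) * F i $$ (p, b)) = (if a = b then 1 else 0)" .
  qed (rule F)
  show V: "code \<in> carrier_mat (4 * 2) 3" by (simp add: code_def)
  fix i :: "nat \<times> unit" and j :: "nat \<times> nat" and X
  assume i: "i \<in> {..<12} \<times> {()}" and j: "j \<in> {..<12} \<times> {..<2}" and X: "X \<in> carrier (pattern_algebra 3 Id)"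
  obtain l' l c where l: "i = (l', ())" "j = (l, c)" "l < 12" "c < 2" using i j by auto
  have Kc: "ampl_measure_op 12 4 povm 2 i * code \<in> carrier_mat (12 * 2) 3"
    by (rule mult_carrier_mat[OF ampl_measure_op_carrier V])
  define M where "M = F j * (ampl_measure_op 12 4 povm 2 i * code)"
  \<comment> \<open>Only row \<open>decoder_label l c\<close> can be nonzero, and only when the
    decoder reads the actual record; in that row \<open>decoder_correct\<close> kills every other
    column.\<close>
  have "M $$ (p, a) = 0" if pa: "p < 3" "a < 3" "p \<noteq> a" for p a
  proof -
    have "M $$ (p, a) = (\<Sum>P<12 * 2. F j $$ (p, P) * (ampl_measure_op 12 4 povm 2 i * code) $$ (P, a))"
      unfolding M_def using carrier_matD[OF F] carrier_matD[OF Kc] pa by (simp add: scalar_prod_def atLeast0LessThan)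
    also have "\<dots> = (\<Sum>m<12. \<Sum>t<2. F j $$ (p, m * 2 + t) * (ampl_measure_op 12 4 povm 2 i * code) $$ (m * 2 + t, a))"
      by (rule sum_product_index)
    also have "\<dots> = (\<Sum>t<2. F j $$ (p, l * 2 + t) * (ampl_measure_op 12 4 povm 2 i * code) $$ (l * 2 + t, a))"
      using l pa by (intro sum_eq_single) (auto simp: Fi)
    also have "\<dots> = 0"
    proof (cases "p = decoder_label l c \<and> l = l'")
      case True
      then have "(\<Sum>t<2. F j $$ (p, l * 2 + t) * (ampl_measure_op 12 4 povm 2 i * code) $$ (l * 2 + t, a)) =
        (\<Sum>t<2. cnj (decoder_vec l c t) * (\<Sum>b<4. povm $$ (l, b) * code $$ (b * 2 + t, a)))"
        using l pa by (intro sum.cong refl) (simp add: Fi ampl_measure_mult_index[OF V])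
      then show ?thesis using decoder_correct[of l c a] True l pa by simp
    next
      case False
      then show ?thesis
        using l pa by (intro sum.neutral) (auto simp: Fi ampl_measure_mult_index[OF V])
    qed
    finally show ?thesis .
  qed
  moreover have "M \<in> carrier_mat 3 3" unfolding M_def by (rule mult_carrier_mat[OF F Kc])
  ultimately have Md: "M \<in> carrier (pattern_algebra 3 Id)" by auto
  show "X * (F j * (ampl_measure_op 12 4 povm 2 i * code)) = F j * (ampl_measure_op 12 4 povm 2 i * code) * X"
    unfolding M_def[symmetric] by (rule diagonal_commute[OF X Md])
qed (auto simp: code_isometry refl_on_def trans_def sym_def)

text \<open>If \<open>c\<close> is nonzero, \<open>a\<close> and \<open>b\<close> lie in the line
  orthogonal to it, so their determinant \<open>D\<close> vanishes. Being also orthogonal and of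
  equal norm, they must then be zero.\<close>

lemma orthogonal_in_plane:
  fixes a b c :: "nat \<Rightarrow> complex"
  assumes "(\<Sum>t<2. a t * cnj (b t)) = 0" "(\<Sum>t<2. a t * cnj (c t)) = 0" "(\<Sum>t<2. b t * cnj (c t)) = 0"
    and "(\<Sum>t<2. b t * cnj (b t)) = (\<Sum>t<2. a t * cnj (a t))"
  shows "(\<forall>t<2. c t = 0) \<or> (\<forall>t<2. a t = 0)"
proof (rule ccontr)
  assume n: "\<not> ?thesis"
  have s2: "(\<Sum>t<2. f t) = f 0 + f 1" for f :: "nat \<Rightarrow> complex" by (simp add: numeral_2_eq_2)
  note A = assms[unfolded s2]
  define D where "D = a 0 * b 1 - a 1 * b 0"
  have "cnj (c 0) * D = b 1 * (a 0 * cnj (c 0) + a 1 * cnj (c 1)) - a 1 * (b 0 * cnj (c 0) + b 1 * cnj (c 1))"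
    "cnj (c 1) * D = a 0 * (b 0 * cnj (c 0) + b 1 * cnj (c 1)) - b 0 * (a 0 * cnj (c 0) + a 1 * cnj (c 1))"
    by (simp_all add: D_def algebra_simps)
  then have "cnj (c 0) * D = 0" "cnj (c 1) * D = 0" unfolding A(2,3) by simp_all
  then have D: "D = 0" using n by (auto simp: less_2_cases_iff)
  \<comment> \<open>Lagrange's identity: the product of the squared norms is the squared modulus of
    the inner product plus that of \<open>D\<close>.\<close>
  have "(a 0 * cnj (a 0) + a 1 * cnj (a 1)) * (b 0 * cnj (b 0) + b 1 * cnj (b 1)) =
      (a 0 * cnj (b 0) + a 1 * cnj (b 1)) * cnj (a 0 * cnj (b 0) + a 1 * cnj (b 1)) + D * cnj D"
    by (simp add: D_def algebra_simps)
  then have "(a 0 * cnj (a 0) + a 1 * cnj (a 1)) = 0" using A(1,4) D by simp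
  then have "complex_of_real ((cmod (a 0))\<^sup>2 + (cmod (a 1))\<^sup>2) = 0" by (simp only: complex_norm_square of_real_add)
  then have "(cmod (a 0))\<^sup>2 + (cmod (a 1))\<^sup>2 = 0" unfolding of_real_eq_0_iff .
  then show False using n by (auto simp: less_2_cases_iff add_nonneg_eq_0_iff)
qed

lemma mat_unit_mult:
  assumes "j < n" "l < n"
  shows "mat_unit n i j * mat_unit n l m = (if j = l then mat_unit n i m else 0\<^sub>m n n)"
proof (rule eq_matI)
  fix a b assume "a < dim_row (if j = l then mat_unit n i m else 0\<^sub>m n n)" "b < dim_col (if j = l then mat_unit n i m else 0\<^sub>m n n)"
  then have ab: "a < n" "b < n" by (auto simp: mat_unit_def split: if_splits)
  have "(mat_unit n i j * mat_unit n l m) $$ (a, b) = (\<Sum>c<n. mat_unit n i j $$ (a, c) * mat_unit n l m $$ (c, b))"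
    using ab by (simp add: mat_unit_def scalar_prod_def atLeast0LessThan)
  also have "\<dots> = mat_unit n i j $$ (a, j) * mat_unit n l m $$ (j, b)"
    using ab assms by (intro sum_eq_single) (auto simp: mat_unit_def)
  also have "\<dots> = (if j = l then mat_unit n i m else 0\<^sub>m n n) $$ (a, b)"
    using ab assms by (auto simp: mat_unit_def)
  finally show "(mat_unit n i j * mat_unit n l m) $$ (a, b) = (if j = l then mat_unit n i m else 0\<^sub>m n n) $$ (a, b)" .
qed (auto simp: mat_unit_def)

lemma mat_adjoint_unit: "mat_adjoint (mat_unit n i j) = mat_unit n j i"
  by (rule eq_matI) (auto simp: mat_unit_def)

lemma mat_unit_nonzero: "i < n \<Longrightarrow> j < n \<Longrightarrow> mat_unit n i j \<noteq> 0\<^sub>m n n"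
  by (auto simp: mat_unit_def dest!: arg_cong[where f = "\<lambda>A. A $$ (i, j)"])

lemma dominating_confusing:
  assumes A: "confusing N d A" and d: "0 < d"
    and iso: "\<And>a b. a < d \<Longrightarrow> b < d \<Longrightarrow> (\<Sum>l<N. cnj (A $$ (l, a)) * A $$ (l, b)) = (if a = b then 1 else 0)"
  shows "dominating_transmittable d N (kraus_map d N {..<N} (measure_op N d A)) (op_algebra 1)"
  unfolding dominating_transmittable_def
  using op_algebra_1_transmittable[OF quantum_channel_measure[OF iso] measure_op_carrier d] confusing_imp_trivial[OF A]
  by blast

lemma no_common_upper_bound:
  assumes A: "confusing N d A"
    and C: "C \<in> transmittable_algebras (d * 2) (N * 2)
      (kraus_map (d * 2) (N * 2) ({..<N} \<times> {()}) (ampl_measure_op N d A 2))"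
    and emb: "embeds (op_algebra 2) C" "embeds (pattern_algebra 3 Id) C"
  shows False
proof (rule transmittable_kraus_map_obtain[OF C])
  let ?K = "ampl_measure_op N d A 2"
  fix k V \<rho> assume V: "V \<in> carrier_mat (d * 2) k" "mat_adjoint V * V = 1\<^sub>m k"
    and \<rho>: "\<rho> \<in> star_hom C (op_algebra k)" "inj_on \<rho> (carrier C)"
    and S: "star_subalgebra k (\<rho> ` carrier C)" "1\<^sub>m k \<in> \<rho> ` carrier C"
    and comm: "\<And>X i \<psi> \<phi>. X \<in> \<rho> ` carrier C \<Longrightarrow> i \<in> {..<N} \<times> {()} \<Longrightarrow> \<psi> \<in> carrier_vec k \<Longrightarrow> \<phi> \<in> carrier_vec k \<Longrightarrow>
      (?K i *\<^sub>v (V *\<^sub>v (X *\<^sub>v \<psi>))) \<bullet>c (?K i *\<^sub>v (V *\<^sub>v \<phi>)) = (?K i *\<^sub>v (V *\<^sub>v \<psi>)) \<bullet>c (?K i *\<^sub>v (V *\<^sub>v (mat_adjoint X *\<^sub>v \<phi>)))"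
  note D = star_subalgebraD[OF S(1)]
  \<comment> \<open>Composition with \<open>\<rho>\<close> places both algebras inside one concrete
    matrix algebra that contains the identity, although neither need contribute that
    identity.\<close>
  have hom: "\<exists>h. h \<in> star_hom (pattern_algebra n R) (op_algebra k) \<and> inj_on h (carrier (pattern_algebra n R)) \<and>
      h ` carrier (pattern_algebra n R) \<subseteq> \<rho> ` carrier C" if "embeds (pattern_algebra n R) C" for n R
  proof -
    obtain f where f: "f \<in> star_hom (pattern_algebra n R) C" "inj_on f (carrier (pattern_algebra n R))"
      using \<open>embeds (pattern_algebra n R) C\<close> unfolding embeds_def by blast
    have fC: "f ` carrier (pattern_algebra n R) \<subseteq> carrier C" using star_homD(1)[OF f(1)] by blast
    have "inj_on (\<rho> \<circ> f) (carrier (pattern_algebra n R))"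
      by (rule comp_inj_on[OF f(2) inj_on_subset[OF \<rho>(2) fC]])
    then show ?thesis
      using star_hom_comp[OF f(1) \<rho>(1)] fC by (intro exI[of _ "\<rho> \<circ> f"]) (auto simp: image_comp[symmetric])
  qed
  obtain h where h: "h \<in> star_hom (pattern_algebra 2 UNIV) (op_algebra k)" "inj_on h (carrier (pattern_algebra 2 UNIV))"
    "h ` carrier (pattern_algebra 2 UNIV) \<subseteq> \<rho> ` carrier C"
    using hom[of 2 UNIV] emb(1) unfolding op_algebra_pattern[of 2] by blast
  obtain g where g: "g \<in> star_hom (pattern_algebra 3 Id) (op_algebra k)" "inj_on g (carrier (pattern_algebra 3 Id))"
    "g ` carrier (pattern_algebra 3 Id) \<subseteq> \<rho> ` carrier C"
    using hom[of 3 Id] emb(2) by blast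
  define e where "e i j = h (mat_unit 2 i j)" for i j
  define q where "q a = g (mat_unit 3 a a)" for a
  have uc: "mat_unit 2 i j \<in> carrier (pattern_algebra 2 UNIV)" "mat_unit 3 a a \<in> carrier (pattern_algebra 3 Id)" for i j a
    by (auto simp: mat_unit_def)
  have zc: "0\<^sub>m 2 2 \<in> carrier (pattern_algebra 2 UNIV)" "0\<^sub>m 3 3 \<in> carrier (pattern_algebra 3 Id)" by auto
  have e: "e i j \<in> \<rho> ` carrier C" for i j using h(3) uc(1) unfolding e_def by blast
  have q: "q a \<in> \<rho> ` carrier C" for a using g(3) uc(2) unfolding q_def by blast
  have e_mult: "e i j * e l m = (if j = l then e i m else 0\<^sub>m k k)" if "j < 2" "l < 2" for i j l m
    using star_homD(3)[OF h(1) uc(1) uc(1), of i j l m] mat_unit_mult[OF that] star_hom_zero[OF h(1)]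
    by (cases "j = l") (simp_all add: e_def)
  have q_mult: "q a * q b = (if a = b then q a else 0\<^sub>m k k)" if "a < 3" "b < 3" for a b
    using star_homD(3)[OF g(1) uc(2) uc(2), of a b] mat_unit_mult[OF that] star_hom_zero[OF g(1)]
    by (cases "a = b") (simp_all add: q_def)
  have e_adj: "mat_adjoint (e i j) = e j i" for i j
    using star_homD(5)[OF h(1) uc(1), of i j] by (simp add: e_def mat_adjoint_unit)
  have e_nz: "e 0 0 \<noteq> 0\<^sub>m k k"
    using inj_onD[OF h(2) _ uc(1) zc(1)] star_hom_zero[OF h(1)] mat_unit_nonzero[of 0 2 0] unfolding e_def by force
  have q_nz: "q a \<noteq> 0\<^sub>m k k" if "a < 3" for a
    using inj_onD[OF g(2) _ uc(2) zc(2)] star_hom_zero[OF g(1)] mat_unit_nonzero[OF that that] unfolding q_def by force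
  obtain B \<psi> \<chi> where B: "B \<in> \<rho> ` carrier C" and c: "\<psi> \<in> carrier_vec k" "\<chi> \<in> carrier_vec k"
    and nz: "\<psi> \<noteq> 0\<^sub>v k" "B *\<^sub>v \<chi> \<noteq> 0\<^sub>v k" and fix00: "e 0 0 *\<^sub>v \<psi> = \<psi>"
    and z: "mat_adjoint B *\<^sub>v \<psi> = 0\<^sub>v k" "mat_adjoint B *\<^sub>v (e 1 0 *\<^sub>v \<psi>) = 0\<^sub>v k"
    by (rule matrix_units_and_three_idempotents[OF S e e_mult e_adj e_nz q q_nz q_mult]) blast+
  have act: "X *\<^sub>v v \<in> carrier_vec k" if "X \<in> \<rho> ` carrier C" "v \<in> carrier_vec k" for X v
    by (rule mult_mat_vec_carrier[OF D(1)[OF that(1)] that(2)])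
  have ee: "e i j *\<^sub>v (e l m *\<^sub>v \<psi>) = (if j = l then e i m *\<^sub>v \<psi> else 0\<^sub>v k)" if "j < 2" "l < 2" for i j l m
    using assoc_mult_mat_vec[OF D(1)[OF e] D(1)[OF e] c(1), of i j l m] e_mult[OF that, of i m] c(1)
    by (auto simp: zero_mat_mult_vec)
  \<comment> \<open>\<open>u1\<close> and \<open>u2\<close> are exchanged by the matrix units;
    \<open>u3\<close> comes from the range of \<open>B\<close>, whose adjoint kills the code vectors
    of \<open>u1\<close> and \<open>u2\<close>.\<close>
  define u1 u2 u3 where "u1 = V *\<^sub>v \<psi>" and "u2 = V *\<^sub>v (e 1 0 *\<^sub>v \<psi>)" and "u3 = V *\<^sub>v (B *\<^sub>v \<chi>)"
  have V0: "V *\<^sub>v 0\<^sub>v k = 0\<^sub>v (d * 2)" using V(1) by (intro eq_vecI) auto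
  have Vc: "V *\<^sub>v v \<in> carrier_vec (d * 2)" if "v \<in> carrier_vec k" for v by (rule mult_mat_vec_carrier[OF V(1) that])
  have ec: "e 1 0 *\<^sub>v \<psi> \<in> carrier_vec k" and Bc: "B *\<^sub>v \<chi> \<in> carrier_vec k" using act e B c by blast+
  have uc: "u1 \<in> carrier_vec (d * 2)" "u2 \<in> carrier_vec (d * 2)" "u3 \<in> carrier_vec (d * 2)"
    unfolding u1_def u2_def u3_def by (intro Vc c ec Bc)+
  have u_nz: "u1 \<noteq> 0\<^sub>v (d * 2)" "u3 \<noteq> 0\<^sub>v (d * 2)"
    unfolding u1_def u3_def using isometry_vec_nonzero[OF V c(1) nz(1)] isometry_vec_nonzero[OF V Bc nz(2)] by blast+
  let ?r = "\<lambda>u l t. residual d 2 A u l t"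
  have r0: "?r (0\<^sub>v (d * 2)) l t = 0" if "t < 2" for l t
    using index_product_less[of _ d t 2] that by (simp add: residual_def)
  have outcome: "(\<forall>t<2. ?r u3 l t = 0) \<or> (\<forall>t<2. ?r u1 l t = 0)" if l: "l < N" for l
  proof -
    have sc: "(?K (l, ()) *\<^sub>v u) \<bullet>c (?K (l, ()) *\<^sub>v v) = (\<Sum>t<2. ?r u l t * cnj (?r v l t))"
      if "u \<in> carrier_vec (d * 2)" "v \<in> carrier_vec (d * 2)" for u v
      using measure_op_kron_cscalar[OF that l] by (simp add: ampl_measure_op_def)
    have move: "(\<Sum>t<2. ?r (V *\<^sub>v (X *\<^sub>v \<phi>)) l t * cnj (?r (V *\<^sub>v \<phi>') l t)) =
        (\<Sum>t<2. ?r (V *\<^sub>v \<phi>) l t * cnj (?r (V *\<^sub>v (mat_adjoint X *\<^sub>v \<phi>')) l t))"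
      if X: "X \<in> \<rho> ` carrier C" and v: "\<phi> \<in> carrier_vec k" "\<phi>' \<in> carrier_vec k" for X \<phi> \<phi>'
      using comm[OF X _ v, of "(l, ())"] l act[OF X v(1)] act[OF D(5)[OF X] v(2)]
      by (simp add: sc Vc v)
    \<comment> \<open>Each condition is one application of \<open>move\<close>. Orthogonality to
      \<open>u3\<close> uses \<open>mat_adjoint B\<close>. The other two use \<open>e 0 1\<close>,
      the adjoint of \<open>e 1 0\<close>: it kills \<open>\<psi> = e 0 0 *\<^sub>v \<psi>\<close>,
      and it returns \<open>e 1 0 *\<^sub>v \<psi>\<close> to \<open>\<psi>\<close>, whence equal
      norms.\<close>
    show ?thesis
    proof (rule orthogonal_in_plane)
      show "(\<Sum>t<2. ?r u1 l t * cnj (?r u2 l t)) = 0"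
        unfolding u1_def u2_def using move[OF e[of 0 1] c(1) c(1)] ee[of 1 0 0 0] fix00
        by (simp add: e_adj V0 r0)
      show "(\<Sum>t<2. ?r u1 l t * cnj (?r u3 l t)) = 0"
        unfolding u1_def u3_def using move[OF D(5)[OF B] c(1) c(2)] by (simp add: z V0 r0)
      show "(\<Sum>t<2. ?r u2 l t * cnj (?r u3 l t)) = 0"
        unfolding u2_def u3_def using move[OF D(5)[OF B] ec c(2)] z(2) by (simp add: V0 r0)
      show "(\<Sum>t<2. ?r u2 l t * cnj (?r u2 l t)) = (\<Sum>t<2. ?r u1 l t * cnj (?r u1 l t))"
        unfolding u1_def u2_def using move[OF e[of 0 1] ec c(1)] ee[of 1 1 0 0] fix00
        by (simp add: e_adj)
    qed
  qed
  \<comment> \<open>The component of \<open>u\<close> along \<open>e_t\<close> in the second factor.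
    Its amplitude at outcome \<open>l\<close> is coordinate \<open>t\<close> of the residual of
    \<open>u\<close>, so \<open>outcome\<close> shows that no outcome accepts both a slice of
    \<open>u3\<close> and a slice of \<open>u1\<close>.\<close>
  define slice where "slice u t = vec d (\<lambda>a. u $ (a * 2 + t))" for u :: "complex vec" and t
  have sl: "residual d 1 A (slice u t) l 0 = ?r u l t" for u l t
    by (simp add: residual_def slice_def)
  have "slice u3 s = 0\<^sub>v d \<or> slice u1 t = 0\<^sub>v d" if "s < 2" "t < 2" for s t
  proof -
    have "\<forall>l<N. residual d 1 A (slice u3 s) l 0 = 0 \<or> residual d 1 A (slice u1 t) l 0 = 0"
      unfolding sl using outcome that by blast
    moreover have "slice u3 s \<in> carrier_vec d" "slice u1 t \<in> carrier_vec d" by (simp_all add: slice_def)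
    ultimately show ?thesis using A unfolding confusing_def by blast
  qed
  moreover have "u = 0\<^sub>v (d * 2)" if u: "u \<in> carrier_vec (d * 2)" "\<And>t. t < 2 \<Longrightarrow> slice u t = 0\<^sub>v d" for u
  proof (rule eq_vecI)
    fix i assume "i < dim_vec (0\<^sub>v (d * 2) :: complex vec)"
    then have i: "i < d * 2" "i div 2 < d" "i mod 2 < 2" by auto
    have "slice u (i mod 2) $ (i div 2) = 0" using u(2)[OF i(3)] i(2) by simp
    then show "u $ i = 0\<^sub>v (d * 2) $ i" using i by (simp add: slice_def)
  qed (use u in simp)
  ultimately show False using uc u_nz by meson
qed (auto simp: ampl_measure_op_carrier)

theorem theorem5p2:
  shows "\<exists>n m n' m' \<Phi> \<Psi>.
    quantum_channel n m \<Phi> \<and> quantum_channel n' m' \<Psi> \<and>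
    (\<exists>A. dominating_transmittable n m \<Phi> A) \<and>
    (\<exists>B. dominating_transmittable n' m' \<Psi> B) \<and>
    \<not> (\<exists>C. dominating_transmittable (n * n') (m * m') (tensor_map n m n' m' \<Phi> \<Psi>) C)"
proof -
  let ?\<Phi> = "kraus_map 4 12 {..<12} (measure_op 12 4 povm)"
  have "\<not> (\<exists>C. dominating_transmittable (4 * 2) (12 * 2) (tensor_map 4 12 2 2 ?\<Phi> (\<lambda>Y. Y)) C)"
  proof
    assume "\<exists>C. dominating_transmittable (4 * 2) (12 * 2) (tensor_map 4 12 2 2 ?\<Phi> (\<lambda>Y. Y)) C"
    then obtain C where C: "C \<in> transmittable_algebras (4 * 2) (12 * 2) (tensor_map 4 12 2 2 ?\<Phi> (\<lambda>Y. Y))"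
      "\<And>B. B \<in> transmittable_algebras (4 * 2) (12 * 2) (tensor_map 4 12 2 2 ?\<Phi> (\<lambda>Y. Y)) \<Longrightarrow> embeds B C"
      unfolding dominating_transmittable_def by blast
    note C = C[unfolded tensor_measure]
    have "embeds (op_algebra 2) C"
      by (rule C(2)[OF op_algebra_ampl_transmittable[OF povm_isometry]]) auto
    then show False
      using no_common_upper_bound[OF povm_confusing C(1)] C(2)[OF diagonal_transmittable] by blast
  qed
  moreover have "dominating_transmittable 4 12 ?\<Phi> (op_algebra 1)"
    by (rule dominating_confusing[OF povm_confusing _ povm_isometry]) simp
  moreover have "dominating_transmittable 2 2 (\<lambda>Y. Y) (op_algebra 2)"
    by (rule dominating_id) simp
  moreover have "quantum_channel 4 12 ?\<Phi>" by (rule quantum_channel_measure[OF povm_isometry])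
  ultimately show ?thesis using quantum_channel_id[of 2] by blast
qed

end
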